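(* Let $\{x^k\}_{k\ge0}$ be the random sequence generated by the RBPDN method (described in the context) from $x^0\in\mathrm{dom}(F)$. Suppose there exists $c_3>0$ such that $\|\tilde d(x)\|\ge c_3\bar\lambda(x)$ for all $x\in\mathcal{S}(x^0)$. Then $$\mathbf{E}[F(x^k)-F^*]\le\left[1-\frac{c_4^2p_{\min}^2(1-\omega_*^{-1}(\delta_0))}{2(1+c_4p_{\min}\omega_*^{-1}(\delta_0))}\right]^k(F(x^0)-F^* ),\qquad\forall k\ge0,$$ where $\delta_0=F(x^0)-F^*$ and $$c_4=\frac{c_1c_3\sqrt{n\sigma_f}}{1-\eta},$$ and $\tilde d$, $\bar\lambda$, $\mathcal{S}(x^0)$, $p_{\min}$, $c_1$, $\sigma_f$, $\omega_*^{-1}$ are as defined in the context.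
   Context: Problem and standing assumptions. Consider $F^*=\min_{x\in\mathbb{R}^N}\{F(x):=f(x)+g(x)\}$, where $f,g:\mathbb{R}^N\to\mathbb{R}\cup\{\infty\}$. The components of $x\in\mathbb{R}^N$ are partitioned into subvectors $x_1,\dots,x_n$ with $x_i\in\mathbb{R}^{N_i}$, and $g(x)=\sum_{i=1}^n g_i(x_i)$ with each $g_i:\mathbb{R}^{N_i}\to\mathbb{R}\cup\{\infty\}$ proper closed convex. The function $f$ is standard self-concordant: it is a closed convex function with open domain $\mathrm{dom}(f)$, three times continuously differentiable on $\mathrm{dom}(f)$, and $|\psi'''(0)|\le 2(\psi''(0))^{3/2}$ for all $x\in\mathrm{dom}(f)$, $u\in\mathbb{R}^N$, where $\psi(t)=f(x+tu)$. Also $\nabla^2 f$ is continuous and positive definite on $\mathrm{dom}(F)$, and the problem has a unique optimal solution $x^*$ (so $F^*=F(x^* )$). Notation. $\|\cdot\|$ is the Euclidean norm of a vector or spectral norm of a matrix. $\|v\|^*_x:=\sqrt{\langle v,(\nabla^2 f(x))^{-1}v\rangle}$ for $v\in\mathbb{R}^N$. $\nabla_i f(x)$ is the subvector of $\nabla f(x)$, and $\nabla^2_{ii}f(x)$ the submatrix of $\nabla^2 f(x)$, corresponding to $x_i$. For $y,z\in\mathbb{R}^{N_i}$, $\|y\|_{x_i}:=\sqrt{\langle y,\nabla^2_{ii}f(x)y\rangle}$ and $\|z\|^*_{x_i}:=\sqrt{\langle z,(\nabla^2_{ii}f(x))^{-1}z\rangle}$. For $x\in\mathrm{dom}(F)$,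 $\tilde d(x):=\arg\min_d\{f(x)+\langle\nabla f(x),d\rangle+\frac12\langle d,\nabla^2 f(x)d\rangle+g(x+d)\}$ and $\bar\lambda(x):=\min_{s\in\partial F(x)}\|s\|^*_x$ (with value $+\infty$ if $\partial F(x)=\emptyset$). RBPDN method. Fix $x^0\in\mathrm{dom}(F)$, $\eta\in[0,1/4]$ and $p_1,\dots,p_n>0$ with $\sum_i p_i=1$. For each $x\in\mathrm{dom}(F)$ and each $i$, $d_i(x)\in\mathbb{R}^{N_i}$ denotes an approximate solution of $\min_{d_i}\{f(x)+\langle\nabla_i f(x),d_i\rangle+\frac12\langle d_i,\nabla^2_{ii}f(x)d_i\rangle+g_i(x_i+d_i)\}$ in the sense that, for some $v_i$, $-v_i\in\nabla_i f(x)+\nabla^2_{ii}f(x)d_i(x)+\partial g_i(x_i+d_i(x))$ and $\|v_i\|^*_{x_i}\le\eta\|d_i(x)\|_{x_i}$. Put $\lambda_i(x):=\|d_i(x)\|_{x_i}$. At iteration $k\ge0$, pick $\iota\in\{1,\dots,n\}$ at random (independently of the past) with probability $p_\iota$, and set $x^{k+1}_j=x^k_j$ for $j\ne\iota$ and $x^{k+1}_\iota=x^k_\iota+d_\iota(x^k)/(1+\lambda_\iota(x^k))$. $\mathbf{E}$ is expectation over all random block choices. Constants. $\mathcal{S}(x^0):=\{x:F(x)\le F(x^0)\}$ (a compact set), $\sigma_f:=\min_{x\in\mathcal{S}(x^0)}\lambda_{\min}(\nabla^2 f(x))$ with $\lambda_{\min}$ the minimal eigenvalue, $H(x):=\mathrm{Diag}(\nabla^2_{11}f(x),\dots,\nabla^2_{nn}f(x))$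 (block diagonal), $p_{\min}:=\min_i p_i$, $$c_1:=\frac{1-\eta}{\sqrt n\,\max_{x\in\mathcal{S}(x^0)}\left\{(1+\eta)\|H(x)^{1/2}(\nabla^2 f(x))^{-1/2}\|+\|H(x)^{-1/2}(\nabla^2 f(x))^{1/2}\|\right\}}.$$ $\omega_*(t):=-t-\ln(1-t)$ and $\omega_*^{-1}:[0,\infty)\to[0,1)$ is the inverse of $\omega_*$ restricted to $[0,1)$. *)

theory Defs
  imports "HOL-Probability.Probability"
begin

section \<open>Extended-valued functions\<close>

definition effective_domain :: "('a \<Rightarrow> ereal) \<Rightarrow> 'a set" where
  "effective_domain f = {x. f x < \<infinity>}"

text \<open>
  The epigraph of an extended-valued function on a set \<open>S\<close>; the library notion is restricted
  to real-valued functions. A function is closed (lower semicontinuous) and convex iff its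
  epigraph is closed and convex.
\<close>

definition ereal_epigraph :: "'a set \<Rightarrow> ('a \<Rightarrow> ereal) \<Rightarrow> ('a \<times> real) set" where
  "ereal_epigraph S f = {(x, r). x \<in> S \<and> f x \<le> ereal r}"

definition closed_convex_on :: "'a::real_normed_vector set \<Rightarrow> ('a \<Rightarrow> ereal) \<Rightarrow> bool" where
  "closed_convex_on S f \<longleftrightarrow> closed (ereal_epigraph S f) \<and> convex (ereal_epigraph S f)"

definition proper_on :: "'a set \<Rightarrow> ('a \<Rightarrow> ereal) \<Rightarrow> bool" where
  "proper_on S f \<longleftrightarrow> (\<forall>x\<in>S. f x \<noteq> -\<infinity>) \<and> (\<exists>x\<in>S. f x < \<infinity>)"

text \<open>
  \<open>E\<close> is a linear subspace, identified with its own dual. The full space is \<open>E = UNIV\<close>.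
\<close>

definition subdifferential_on :: "'a::real_inner set \<Rightarrow> ('a \<Rightarrow> ereal) \<Rightarrow> 'a \<Rightarrow> 'a set" where
  "subdifferential_on E f x = {s \<in> E. \<forall>y\<in>E. f y \<ge> f x + ereal (s \<bullet> (y - x))}"


section \<open>Derivatives and self-concordance\<close>

text \<open>The derivatives of an extended-valued function are only meaningful inside its domain.\<close>

definition gradient :: "(real^'n \<Rightarrow> ereal) \<Rightarrow> real^'n \<Rightarrow> real^'n" where
  "gradient f x = (THE D. GDERIV (\<lambda>y. real_of_ereal (f y)) x :> D)"

definition hessian :: "(real^'n \<Rightarrow> ereal) \<Rightarrow> real^'n \<Rightarrow> real^'n^'n" where
  "hessian f x = matrix (frechet_derivative (gradient f) (at x))"

text \<open>\<open>k\<close>-fold continuous differentiability on an open set \<open>S\<close>.\<close>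

fun Ck_on :: "nat \<Rightarrow> ('a::euclidean_space \<Rightarrow> real) \<Rightarrow> 'a set \<Rightarrow> bool" where
  "Ck_on 0 f S \<longleftrightarrow> continuous_on S f"
| "Ck_on (Suc k) f S \<longleftrightarrow>
     (\<forall>x\<in>S. f differentiable (at x)) \<and>
     (\<forall>b\<in>Basis. Ck_on k (\<lambda>x. frechet_derivative f (at x) b) S)"

definition self_concordant :: "(real^'n \<Rightarrow> ereal) \<Rightarrow> bool" where
  "self_concordant f \<longleftrightarrow>
     (\<forall>x. f x \<noteq> -\<infinity>) \<and>
     closed_convex_on UNIV f \<and>
     open (effective_domain f) \<and>
     Ck_on 3 (\<lambda>x. real_of_ereal (f x)) (effective_domain f) \<and>
     (\<forall>x\<in>effective_domain f. \<forall>u.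
        let \<psi> = (\<lambda>t::real. real_of_ereal (f (x + t *\<^sub>R u)))
        in \<bar>(deriv ^^ 3) \<psi> 0\<bar> \<le> 2 * ((deriv ^^ 2) \<psi> 0) powr (3/2))"


section \<open>Matrices\<close>

definition pos_def :: "real^'n^'n \<Rightarrow> bool" where
  "pos_def A \<longleftrightarrow> transpose A = A \<and> (\<forall>v. v \<noteq> 0 \<longrightarrow> v \<bullet> (A *v v) > 0)"

definition lambda_min :: "real^'n^'n \<Rightarrow> real" where
  "lambda_min A = Min {l. \<exists>v. v \<noteq> 0 \<and> A *v v = l *\<^sub>R v}"

text \<open>The unique symmetric positive semidefinite square root.\<close>

definition sqrt_matrix :: "real^'n^'n \<Rightarrow> real^'n^'n" where
  "sqrt_matrix A =
     (THE B. transpose B = B \<and> (\<forall>v. v \<bullet> (B *v v) \<ge> 0) \<and> B ** B = A)"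

definition spectral_norm :: "real^'n^'n \<Rightarrow> real" where
  "spectral_norm A = onorm (\<lambda>v. A *v v)"

definition dual_norm :: "real^'n^'n \<Rightarrow> real^'n \<Rightarrow> real" where
  "dual_norm A v = sqrt (v \<bullet> (matrix_inv A *v v))"


section \<open>Block structure\<close>

text \<open>
  The function \<open>blk\<close> assigns to every coordinate the block containing it; the blocks are the
  elements of the finite type \<open>'b\<close>, so there are \<open>CARD('b)\<close> of them, and \<open>blk\<close> is required to be
  surjective wherever it is used, so that no block is empty. As the dimension of a block depends
  on the block, the space of the \<open>i\<close>-th subvectors is represented by the coordinate subspace
  of all vectors supported on block \<open>i\<close>. The \<open>i\<close>-th diagonal submatrix of \<open>A\<close> is
  correspondingly padded by zeros and acts as a linear operator on that subspace.
\<close>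

definition block_space :: "('n::finite \<Rightarrow> 'b) \<Rightarrow> 'b \<Rightarrow> (real^'n) set" where
  "block_space blk i = {x. \<forall>j. blk j \<noteq> i \<longrightarrow> x $ j = 0}"

definition block_proj :: "('n::finite \<Rightarrow> 'b) \<Rightarrow> 'b \<Rightarrow> real^'n \<Rightarrow> real^'n" where
  "block_proj blk i x = (\<chi> j. if blk j = i then x $ j else 0)"

definition block_matrix :: "('n::finite \<Rightarrow> 'b) \<Rightarrow> 'b \<Rightarrow> real^'n^'n \<Rightarrow> real^'n^'n" where
  "block_matrix blk i A = (\<chi> r c. if blk r = i \<and> blk c = i then A $ r $ c else 0)"

definition block_diag :: "('n::finite \<Rightarrow> 'b) \<Rightarrow> real^'n^'n \<Rightarrow> real^'n^'n" where
  "block_diag blk A = (\<chi> r c. if blk r = blk c then A $ r $ c else 0)"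

definition block_norm :: "('n::finite \<Rightarrow> 'b) \<Rightarrow> 'b \<Rightarrow> real^'n^'n \<Rightarrow> real^'n \<Rightarrow> real" where
  "block_norm blk i A y = sqrt (y \<bullet> (block_matrix blk i A *v y))"

text \<open>
  The zero-padded submatrix is singular as a full matrix, so its inverse is taken as an operator
  on the subspace of block \<open>i\<close>.
\<close>

definition block_dual_norm :: "('n::finite \<Rightarrow> 'b) \<Rightarrow> 'b \<Rightarrow> real^'n^'n \<Rightarrow> real^'n \<Rightarrow> real" where
  "block_dual_norm blk i A z =
     sqrt (z \<bullet> inv_into (block_space blk i) (\<lambda>y. block_matrix blk i A *v y) z)"

definition separable_sum ::
    "('n::finite \<Rightarrow> 'b::finite) \<Rightarrow> ('b \<Rightarrow> real^'n \<Rightarrow> ereal) \<Rightarrow> real^'n \<Rightarrow> ereal" where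
  "separable_sum blk gi x = (\<Sum>i\<in>UNIV. gi i (block_proj blk i x))"


section \<open>The randomized block proximal damped Newton method\<close>

text \<open>The exact proximal Newton direction \<open>\<tilde>d(x)\<close> for the objective \<open>f + g\<close>.\<close>

definition newton_direction ::
    "(real^'n \<Rightarrow> ereal) \<Rightarrow> (real^'n \<Rightarrow> ereal) \<Rightarrow> real^'n \<Rightarrow> real^'n" where
  "newton_direction f g x =
     (ARG_MIN (\<lambda>d. f x + ereal (gradient f x \<bullet> d) + ereal (1/2 * (d \<bullet> (hessian f x *v d)))
                   + g (x + d)) d. True)"

text \<open>
  The least dual norm of a subgradient of \<open>F\<close>; the infimum of the empty set is \<open>\<infinity>\<close>.
\<close>

definition lambda_bar ::
    "(real^'n \<Rightarrow> ereal) \<Rightarrow> (real^'n \<Rightarrow> ereal) \<Rightarrow> real^'n \<Rightarrow> ereal" where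
  "lambda_bar f F x = (INF s \<in> subdifferential_on UNIV F x. ereal (dual_norm (hessian f x) s))"

text \<open>\<open>di\<close> is an admissible approximate solution of the \<open>i\<close>-th subproblem at \<open>x\<close>.\<close>

definition approx_block_direction ::
    "('n::finite \<Rightarrow> 'b::finite) \<Rightarrow> (real^'n \<Rightarrow> ereal) \<Rightarrow> ('b \<Rightarrow> real^'n \<Rightarrow> ereal) \<Rightarrow> real
      \<Rightarrow> real^'n \<Rightarrow> 'b \<Rightarrow> real^'n \<Rightarrow> bool" where
  "approx_block_direction blk f gi \<eta> x i di \<longleftrightarrow>
     di \<in> block_space blk i \<and>
     (\<exists>v \<in> block_space blk i.
        (\<exists>s \<in> subdifferential_on (block_space blk i) (gi i) (block_proj blk i x + di).
           - v = block_proj blk i (gradient f x) + block_matrix blk i (hessian f x) *v di + s) \<and>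
        block_dual_norm blk i (hessian f x) v \<le> \<eta> * block_norm blk i (hessian f x) di)"

definition rbpdn_step ::
    "('n::finite \<Rightarrow> 'b) \<Rightarrow> (real^'n \<Rightarrow> ereal) \<Rightarrow> (real^'n \<Rightarrow> 'b \<Rightarrow> real^'n)
      \<Rightarrow> 'b \<Rightarrow> real^'n \<Rightarrow> real^'n" where
  "rbpdn_step blk f d i x =
     (\<chi> j. if blk j = i then x $ j + d x i $ j / (1 + block_norm blk i (hessian f x) (d x i))
           else x $ j)"

definition omega_star :: "real \<Rightarrow> real" where
  "omega_star t = - t - ln (1 - t)"

definition omega_star_inv :: "real \<Rightarrow> real" where
  "omega_star_inv = the_inv_into {0..<1} omega_star"

text \<open>
  The extrema over the (compact) sublevel set \<open>S\<close> below are attained, so they are rendered by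
  the infimum and the supremum.
\<close>

definition sigma_f :: "(real^'n \<Rightarrow> ereal) \<Rightarrow> (real^'n) set \<Rightarrow> real" where
  "sigma_f f S = (INF x\<in>S. lambda_min (hessian f x))"

definition rbpdn_c1 ::
    "('n::finite \<Rightarrow> 'b::finite) \<Rightarrow> (real^'n \<Rightarrow> ereal) \<Rightarrow> real \<Rightarrow> (real^'n) set \<Rightarrow> real" where
  "rbpdn_c1 blk f \<eta> S =
     (1 - \<eta>) /
     (sqrt (real CARD('b)) *
      (SUP x\<in>S.
         (1 + \<eta>) * spectral_norm (sqrt_matrix (block_diag blk (hessian f x))
                                   ** sqrt_matrix (matrix_inv (hessian f x)))
         + spectral_norm (sqrt_matrix (matrix_inv (block_diag blk (hessian f x)))
                          ** sqrt_matrix (hessian f x))))"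

end

theory Submission
  imports Defs
begin

text \<open>
  Write \<open>B\<close> for the Hessian of \<open>f\<close> at \<open>x\<close>, \<open>H\<close> for its block diagonal part, \<open>\<lambda>\<^sub>i\<close> for the local length
  of the \<open>i\<close>-th block direction and \<open>\<delta>(x) = F(x) - F(x\<^sup>*)\<close>. The theorem follows from a contraction
  of \<open>\<delta>\<close> in conditional expectation on the initial sublevel set, which every step preserves. With
  \<open>\<phi>(s) = s\<^sup>2 / (2 (1 + s))\<close> the contraction combines three estimates.

  \<^item> A step in block \<open>i\<close> decreases \<open>F\<close> by at least \<open>\<phi>(\<lambda>\<^sub>i) / 2\<close> (\<open>block_step_descent\<close>): the damped step has
    local length \<open>\<lambda>\<^sub>i / (1 + \<lambda>\<^sub>i) < 1\<close>, where self-concordance bounds \<open>f\<close> from above. As \<open>\<phi>\<close> is convex and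
    increasing, the expected decrease is at least \<open>\<phi>(p\<^sub>m\<^sub>i\<^sub>n \<Sum>\<^sub>i \<lambda>\<^sub>i) / 2\<close>.

  \<^item> The gap is controlled by subgradients: \<open>\<delta>(x) \<le> \<omega>\<^sub>*(\<parallel>s\<parallel>\<^sup>*)\<close> for every subgradient \<open>s\<close> of \<open>F\<close> at \<open>x\<close> with
    dual norm below one (\<open>gap_le_omega_star\<close>). This is the self-concordant lower bound for \<open>f\<close>
    followed by the Fenchel inequality between \<open>r - ln (1 + r)\<close> and \<open>\<omega>\<^sub>*\<close>. Hence \<open>\<omega>\<^sub>*\<^sup>-\<^sup>1(\<delta>(x))\<close> is at most
    the least dual norm of a subgradient, which the hypothesis with constant \<open>c\<^sub>3\<close> bounds by the
    length of the exact proximal Newton direction.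

  \<^item> The exact direction is bounded by the block directions
    (\<open>newton_direction_le_block_directions\<close>): the optimality conditions of both problems and
    monotonicity of the subdifferential of \<open>g\<close> bound its \<open>B\<close>-norm by \<open>(\<Sum>\<^sub>i \<lambda>\<^sub>i\<^sup>2)\<^sup>1\<^sup>/\<^sup>2\<close> times the expression
    in spectral norms whose maximum enters \<open>c\<^sub>1\<close>.

  The last two give \<open>\<Sum>\<^sub>i \<lambda>\<^sub>i \<ge> c\<^sub>4 t\<close> with \<open>t = \<omega>\<^sub>*\<^sup>-\<^sup>1(\<delta>(x))\<close> (\<open>block_lengths_ge_gap\<close>), so the expected decrease
  is at least \<open>\<phi>(c\<^sub>4 p\<^sub>m\<^sub>i\<^sub>n t) / 2\<close>. Comparing with \<open>\<delta>(x) = \<omega>\<^sub>*(t) \<le> t\<^sup>2 / (2 (1 - t))\<close> and using that \<open>t\<close> is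
  at most its value at the starting point yields the stated factor (\<open>rate_bound\<close>).

  Suprema over the sublevel set are meaningful only if they are bounded. The set is bounded
  because self-concordance makes \<open>F\<close> grow around the minimizer, it is closed because \<open>f\<close> and the
  \<open>g\<^sub>i\<close> have closed epigraphs, and the Hessian is continuous and positive definite on it.
\<close>

section \<open>Scalar inequalities\<close>

text \<open>
  The derivative of the difference of both sides is \<open>(1 - 1/y)\<^sup>2 / 2\<close>. Taking \<open>y = 1 + t\<close> and
  \<open>y = 1 / (1 - t)\<close> gives the quadratic bounds on \<open>t - ln (1 + t)\<close> and on \<open>\<omega>\<^sub>*(t)\<close>.
\<close>

lemma ln_le_half_diff_inverse:
  fixes y :: real
  assumes "1 \<le> y"
  shows "ln y \<le> (y - 1 / y) / 2"
proof -
  define h where "h = (\<lambda>y::real. (y - 1 / y) / 2 - ln y)"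
  have "h 1 \<le> h y"
  proof (rule DERIV_nonneg_imp_nondecreasing[OF assms])
    fix t :: real assume t: "1 \<le> t" "t \<le> y"
    have "(h has_real_derivative ((1 + 1 / t^2) / 2 - 1 / t)) (at t)"
      unfolding h_def using t
      by (auto intro!: derivative_eq_intros simp: power2_eq_square field_simps)
    moreover have "(1 + 1 / t^2) / 2 - 1 / t = (1 - 1 / t)^2 / 2"
      using t by (simp add: power2_eq_square field_simps)
    ultimately show "\<exists>z. DERIV h t :> z \<and> 0 \<le> z" by force
  qed
  thus ?thesis by (simp add: h_def)
qed

lemma half_square_le_diff_ln:
  fixes t :: real
  assumes "0 \<le> t"
  shows "t^2 / (2 * (1 + t)) \<le> t - ln (1 + t)"
  using ln_le_half_diff_inverse[of "1 + t"] assms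
  by (simp add: field_simps power2_eq_square)

lemma omega_star_le:
  fixes t :: real
  assumes "0 \<le> t" "t < 1"
  shows "omega_star t \<le> t^2 / (2 * (1 - t))"
proof -
  have "ln (1 / (1 - t)) \<le> (1 / (1 - t) - (1 - t)) / 2"
    using ln_le_half_diff_inverse[of "1 / (1 - t)"] assms by simp
  hence "- ln (1 - t) \<le> (1 / (1 - t) - (1 - t)) / 2"
    using assms by (simp add: ln_div)
  moreover have "(1 / (1 - t) - (1 - t)) / 2 = t + t^2 / (2 * (1 - t))"
    using assms by (simp add: field_simps power2_eq_square)
  ultimately show ?thesis by (simp add: omega_star_def)
qed

text \<open>
  Since \<open>(1 + r) (1 - l) = 1 + r - l - r l\<close>, this is \<open>ln (1 + z) \<le> z\<close> with \<open>z = r - l - r l\<close>.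
\<close>

lemma omega_star_fenchel:
  fixes r l :: real
  assumes "0 \<le> r" "0 \<le> l" "l < 1"
  shows "r * l \<le> (r - ln (1 + r)) + omega_star l"
proof -
  have "ln ((1 + r) * (1 - l)) \<le> (1 + r) * (1 - l) - 1"
    using assms by (intro ln_le_minus_one) auto
  moreover have "ln ((1 + r) * (1 - l)) = ln (1 + r) + ln (1 - l)"
    using assms by (simp add: ln_mult)
  ultimately show ?thesis by (simp add: omega_star_def algebra_simps)
qed

lemma omega_star_strict_mono: "strict_mono_on {0..<1} omega_star"
proof (rule strict_mono_onI)
  fix s t :: real assume st: "s \<in> {0..<1}" "t \<in> {0..<1}" "s < t"
  have "ln ((1 - t) / (1 - s)) \<le> (1 - t) / (1 - s) - 1"
    using st by (intro ln_le_minus_one) auto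
  moreover have "ln ((1 - t) / (1 - s)) = ln (1 - t) - ln (1 - s)"
    using st by (simp add: ln_div)
  moreover have "1 - (1 - t) / (1 - s) > t - s \<or> (s = 0 \<and> 1 - (1 - t) / (1 - s) = t - s)"
    using st by (auto simp: field_simps)
  moreover have "ln (1 - t) < - t" if "s = 0"
    using ln_eq_minus_one[of "1 - t"] ln_le_minus_one[of "1 - t"] st that
    by fastforce
  ultimately show "omega_star s < omega_star t"
    by (auto simp: omega_star_def)
qed

lemma omega_star_inv:
  fixes \<delta> :: real
  assumes "0 \<le> \<delta>"
  shows "omega_star_inv \<delta> \<in> {0..<1}" "omega_star (omega_star_inv \<delta>) = \<delta>"
proof -
  define b where "b = 1 - exp (- (\<delta> + 1))"
  have b: "0 \<le> b" "b < 1" using assms by (auto simp: b_def)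
  have "continuous_on {0..b} omega_star"
    unfolding omega_star_def using b by (intro continuous_intros) auto
  moreover have "omega_star 0 \<le> \<delta>" "\<delta> \<le> omega_star b"
    using assms by (auto simp: omega_star_def b_def)
  ultimately obtain t where t: "0 \<le> t" "t \<le> b" "omega_star t = \<delta>"
    using IVT'[of omega_star 0 \<delta> b] b by auto
  have inj: "inj_on omega_star {0..<1}"
    by (rule strict_mono_on_imp_inj_on[OF omega_star_strict_mono])
  have "omega_star_inv \<delta> = t"
    unfolding omega_star_inv_def using the_inv_into_f_f[OF inj, of t] t b by auto
  thus "omega_star_inv \<delta> \<in> {0..<1}" "omega_star (omega_star_inv \<delta>) = \<delta>"
    using t b by auto
qed

lemma omega_star_inv_mono:
  fixes \<delta> \<delta>' :: real
  assumes "0 \<le> \<delta>" "\<delta> \<le> \<delta>'"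
  shows "omega_star_inv \<delta> \<le> omega_star_inv \<delta>'"
proof (rule ccontr)
  assume "\<not> ?thesis"
  hence "omega_star (omega_star_inv \<delta>') < omega_star (omega_star_inv \<delta>)"
    using omega_star_inv(1)[of \<delta>] omega_star_inv(1)[of \<delta>'] assms
    by (intro strict_mono_onD[OF omega_star_strict_mono]) auto
  thus False using omega_star_inv(2)[of \<delta>] omega_star_inv(2)[of \<delta>'] assms by auto
qed

lemma half_square_mono:
  fixes s t :: real
  assumes "0 \<le> s" "s \<le> t"
  shows "s^2 / (2 * (1 + s)) \<le> t^2 / (2 * (1 + t))"
proof -
  have "s^2 * (1 + t) \<le> t^2 * (1 + s)"
  proof -
    have "s * s \<le> t * t" "s * s * t \<le> t * t * s"
      using assms by (auto simp: mult_mono mult.commute mult.left_commute mult_left_mono)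
    thus ?thesis by (simp add: power2_eq_square algebra_simps)
  qed
  thus ?thesis using assms by (simp add: field_simps)
qed

text \<open>
  Convexity of \<open>s\<^sup>2 / (2 (1 + s)) = (s - 1 + 1 / (1 + s)) / 2\<close> as a tangent inequality: it reduces
  to \<open>0 \<le> (a b - 1)\<^sup>2 / b\<close> for \<open>a = 1 / (1 + u)\<close> and \<open>b = 1 + s\<close>.
\<close>

lemma half_square_tangent:
  fixes s u :: real
  assumes "0 \<le> s" "0 \<le> u"
  shows "u^2 / (2 * (1 + u)) + (1 - 1 / (1 + u)^2) / 2 * (s - u) \<le> s^2 / (2 * (1 + s))"
proof -
  have eq: "x^2 / (2 * (1 + x)) = (x - 1 + 1 / (1 + x)) / 2" if "0 \<le> x" for x :: real
    using that by (simp add: field_simps power2_eq_square)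
  define a b where "a = 1 / (1 + u)" and "b = 1 + s"
  have a: "1 + u = 1 / a" "0 < a" and b: "0 < b" using assms by (auto simp: a_def b_def)
  have "2 * a - a^2 * b \<le> 1 / b"
  proof -
    have "0 \<le> (a * b - 1)^2 / b" using b by simp
    also have "\<dots> = a^2 * b - 2 * a + 1 / b"
      using b by (simp add: field_simps power2_eq_square)
    finally show ?thesis by simp
  qed
  moreover have "a^2 * (s - u) = a^2 * b - a"
  proof -
    have "a^2 * (1 + u) = a" using a by (simp add: power2_eq_square)
    moreover have "s - u = b - (1 + u)" by (simp add: b_def)
    ultimately show ?thesis by (simp only: right_diff_distrib)
  qed
  ultimately have "a - a^2 * (s - u) \<le> 1 / b" by simp
  hence "1 / (1 + u) - 1 / (1 + u)^2 * (s - u) \<le> 1 / (1 + s)"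
    by (simp add: a_def b_def power_divide)
  moreover have "(1 - 1 / (1 + u)^2) / 2 * (s - u) = ((s - u) - 1 / (1 + u)^2 * (s - u)) / 2"
    by (simp add: left_diff_distrib)
  ultimately show ?thesis unfolding eq[OF assms(1)] eq[OF assms(2)] by argo
qed

text \<open>
  Jensen's inequality, obtained by averaging the tangent inequality at the mean.
\<close>

lemma half_square_jensen:
  fixes p l :: "'b::finite \<Rightarrow> real"
  assumes "\<And>i. 0 \<le> p i" "(\<Sum>i\<in>UNIV. p i) = 1" "\<And>i. 0 \<le> l i"
  defines "u \<equiv> (\<Sum>i\<in>UNIV. p i * l i)"
  shows "u^2 / (2 * (1 + u)) \<le> (\<Sum>i\<in>UNIV. p i * ((l i)^2 / (2 * (1 + l i))))"
proof -
  define c where "c = (1 - 1 / (1 + u)^2) / 2"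
  define k where "k = u^2 / (2 * (1 + u))"
  have u: "0 \<le> u" unfolding u_def using assms by (intro sum_nonneg) auto
  have "(\<Sum>i\<in>UNIV. p i * (k + c * (l i - u))) = k * (\<Sum>i\<in>UNIV. p i) + c * (u - u * (\<Sum>i\<in>UNIV. p i))"
  proof -
    have "(\<Sum>i\<in>UNIV. p i * (k + c * (l i - u)))
        = (\<Sum>i\<in>UNIV. k * p i + c * (p i * l i) - c * u * p i)"
      by (simp add: algebra_simps)
    also have "\<dots> = k * (\<Sum>i\<in>UNIV. p i) + c * u - c * u * (\<Sum>i\<in>UNIV. p i)"
      by (simp add: u_def sum.distrib sum_subtractf flip: sum_distrib_left)
    finally show ?thesis by (simp add: algebra_simps)
  qed
  also have "\<dots> = k" by (simp add: assms)
  finally have "k = (\<Sum>i\<in>UNIV. p i * (k + c * (l i - u)))" ..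
  also have "\<dots> \<le> (\<Sum>i\<in>UNIV. p i * ((l i)^2 / (2 * (1 + l i))))"
    unfolding k_def c_def
    using assms u by (intro sum_mono mult_left_mono half_square_tangent) auto
  finally show ?thesis by (simp add: k_def)
qed

text \<open>
  Coercivity of quadratics, used to bound sublevel sets: for \<open>t > 1\<close> the constant \<open>a\<close> is at most
  \<open>\<bar>a\<bar> t\<close>, and \<open>t\<close> can be cancelled.
\<close>

lemma quadratic_bound:
  fixes t :: real
  assumes "0 < m" "0 \<le> t" "0 \<le> b" "m / 2 * t^2 \<le> a + b * t"
  shows "t \<le> 1 + 2 * (\<bar>a\<bar> + b) / m"
proof (cases "t \<le> 1")
  case True
  have "0 \<le> 2 * (\<bar>a\<bar> + b) / m" using assms by simp
  thus ?thesis using True by linarith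
next
  case False
  have "\<bar>a\<bar> * 1 \<le> \<bar>a\<bar> * t" using False by (intro mult_left_mono) auto
  hence "m / 2 * t^2 \<le> (\<bar>a\<bar> + b) * t" using assms(4) by (simp add: distrib_right)
  hence "(m / 2 * t) * t \<le> (\<bar>a\<bar> + b) * t" by (simp add: power2_eq_square)
  hence "m / 2 * t \<le> \<bar>a\<bar> + b" using False by simp
  thus ?thesis using assms(1) by (simp add: field_simps)
qed

text \<open>
  Here \<open>\<omega>\<^sub>*(t)\<close> is the current gap and the right-hand side the guaranteed decrease. The bound
  \<open>\<omega>\<^sub>*(t) \<le> t\<^sup>2 / (2 (1 - t))\<close> reduces the claim to the monotonicity of \<open>(1 - t) / (1 + c t)\<close> in \<open>t\<close>.
\<close>

lemma rate_bound:
  fixes c t t0 :: real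
  assumes c: "0 \<le> c" and t: "0 \<le> t" "t \<le> t0" "t0 < 1"
  shows "c^2 * (1 - t0) / (2 * (1 + c * t0)) * omega_star t \<le> 1/2 * ((c * t)^2 / (2 * (1 + c * t)))"
proof -
  have ct: "c * t \<le> c * t0" "0 \<le> c * t" using c t by (auto intro: mult_left_mono)
  have pos: "0 < 2 * (1 + c * t)" by (intro mult_pos_pos add_pos_nonneg) (use ct in auto)
  have "c^2 * (1 - t0) / (2 * (1 + c * t0)) * omega_star t
      \<le> c^2 * (1 - t0) / (2 * (1 + c * t0)) * (t^2 / (2 * (1 - t)))"
    using c t ct by (intro mult_left_mono omega_star_le divide_nonneg_nonneg mult_nonneg_nonneg) auto
  also have "\<dots> \<le> c^2 * (1 - t) / (2 * (1 + c * t)) * (t^2 / (2 * (1 - t)))"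
    by (intro mult_right_mono frac_le mult_left_mono mult_nonneg_nonneg pos) (use c t ct in auto)
  also have "\<dots> = 1/2 * ((c * t)^2 / (2 * (1 + c * t)))"
  proof -
    have "c^2 * a / b * (t^2 / (2 * a)) = 1/2 * ((c * t)^2 / b)" if "a \<noteq> 0" for a b :: real
      using that by (simp add: power_mult_distrib)
    moreover have "1 - t \<noteq> 0" using t by simp
    ultimately show ?thesis by blast
  qed
  finally show ?thesis .
qed

section \<open>Symmetric and positive definite matrices\<close>

lemma symmetric_matrix_inner:
  fixes A :: "real^'n^'n"
  assumes "transpose A = A"
  shows "x \<bullet> (A *v y) = (A *v x) \<bullet> y"
  by (metis assms dot_lmul_matrix transpose_matrix_vector)

lemma symmetric_matrixI:
  fixes A :: "real^'n^'n"
  assumes "\<And>x y. x \<bullet> (A *v y) = (A *v x) \<bullet> y"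
  shows "transpose A = A"
proof -
  have "(x v* A) \<bullet> y = (A *v x) \<bullet> y" for x y
    by (simp add: assms dot_lmul_matrix)
  hence "x v* A = A *v x" for x by (metis vector_eq_rdot)
  hence "transpose A *v x = A *v x" for x by simp
  thus ?thesis by (metis matrix_eq)
qed

text \<open>
  The Rayleigh quotient attains its minimum \<open>m\<close> on the unit sphere of \<open>V\<close>, at \<open>v\<close> say. Then
  \<open>w \<bullet> A w - m \<parallel>w\<parallel>\<^sup>2\<close> is nonnegative on \<open>V\<close> and vanishes at \<open>v\<close>; perturbing \<open>v\<close> in the direction
  \<open>w = A v - m v\<close> shows that the residual \<open>w\<close> is zero.
\<close>

lemma rayleigh_minimum:
  fixes A :: "real^'n^'n"
  assumes sym: "transpose A = A" and V: "subspace V" "\<And>v. v \<in> V \<Longrightarrow> A *v v \<in> V" "V \<noteq> {0}"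
  obtains v m where "v \<in> V" "norm v = 1" "A *v v = m *\<^sub>R v"
    "\<And>w. w \<in> V \<Longrightarrow> m * (norm w)^2 \<le> w \<bullet> (A *v w)"
proof -
  define K where "K = sphere 0 1 \<inter> V"
  have "compact K" unfolding K_def by (intro compact_Int_closed closed_subspace V) auto
  moreover have "K \<noteq> {}"
  proof -
    obtain u where u: "u \<in> V" "u \<noteq> 0" using V subspace_0 by blast
    hence "(1 / norm u) *\<^sub>R u \<in> K" using V by (auto simp: K_def subspace_scale)
    thus ?thesis by blast
  qed
  moreover have "continuous_on K (\<lambda>w. w \<bullet> (A *v w))"
    by (intro continuous_intros matrix_vector_mult_linear_continuous_on)
  ultimately obtain v where v: "v \<in> K" "\<And>w. w \<in> K \<Longrightarrow> v \<bullet> (A *v v) \<le> w \<bullet> (A *v w)"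
    using continuous_attains_inf[of K "\<lambda>w. w \<bullet> (A *v w)"] by blast
  define m where "m = v \<bullet> (A *v v)"
  have vV: "v \<in> V" "norm v = 1" using v by (auto simp: K_def)
  have low: "m * (norm w)^2 \<le> w \<bullet> (A *v w)" if w: "w \<in> V" for w
  proof (cases "w = 0")
    case False
    have "(1 / norm w) *\<^sub>R w \<in> K" using w False V by (auto simp: K_def subspace_scale)
    from v(2)[OF this] have "m \<le> ((1 / norm w) *\<^sub>R w) \<bullet> (A *v ((1 / norm w) *\<^sub>R w))"
      by (simp only: m_def)
    also have "\<dots> = (w \<bullet> (A *v w)) / (norm w)^2"
      by (simp add: matrix_vector_mult_scaleR power2_eq_square)
    finally show ?thesis using False by (simp add: field_simps)
  qed simp
  define w where "w = A *v v - m *\<^sub>R v"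
  have wV: "w \<in> V" unfolding w_def by (intro subspace_diff subspace_scale V vV)
  have vw: "v \<bullet> (A *v w) = w \<bullet> (A *v v)"
    using symmetric_matrix_inner[OF sym, of v w] by (simp add: inner_commute)
  have "w \<bullet> w = 0"
  proof (rule ccontr)
    assume nz: "w \<bullet> w \<noteq> 0"
    hence pos: "w \<bullet> w > 0" by simp
    define Q where "Q = w \<bullet> (A *v w) - m * (w \<bullet> w)"
    have Q0: "Q \<ge> 0" using low[OF wV] by (simp add: Q_def power2_norm_eq_inner)
    have ineq: "0 \<le> 2 * t * (w \<bullet> w) + t^2 * Q" for t
    proof -
      have "m * (norm (v + t *\<^sub>R w))^2 \<le> (v + t *\<^sub>R w) \<bullet> (A *v (v + t *\<^sub>R w))"
        using V vV wV by (intro low subspace_add subspace_scale)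
      also have "(v + t *\<^sub>R w) \<bullet> (A *v (v + t *\<^sub>R w))
           = m + 2 * t * (w \<bullet> (A *v v)) + t^2 * (w \<bullet> (A *v w))"
        by (simp add: matrix_vector_right_distrib matrix_vector_mult_scaleR inner_add_left
            inner_add_right vw m_def power2_eq_square algebra_simps)
      finally have *: "m * ((v + t *\<^sub>R w) \<bullet> (v + t *\<^sub>R w))
           \<le> m + 2 * t * (w \<bullet> (A *v v)) + t^2 * (w \<bullet> (A *v w))"
        by (simp add: power2_norm_eq_inner)
      have vv: "v \<bullet> v = 1" using vV by (simp add: norm_eq_1)
      have a: "(v + t *\<^sub>R w) \<bullet> (v + t *\<^sub>R w) = 1 + 2 * t * (w \<bullet> v) + t^2 * (w \<bullet> w)"
        using vv by (simp add: inner_add_left inner_add_right inner_commute power2_eq_square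
            algebra_simps)
      have b: "w \<bullet> (A *v v) = w \<bullet> w + m * (w \<bullet> v)"
        unfolding w_def by (simp add: inner_diff_left inner_diff_right algebra_simps)
      from * show ?thesis unfolding a b by (simp add: Q_def algebra_simps)
    qed
    show False
    proof (cases "Q = 0")
      case True thus False using ineq[of "-1"] pos by simp
    next
      case False
      hence "Q > 0" using Q0 by simp
      hence "w \<bullet> w * (w \<bullet> w) \<le> 0" using ineq[of "- (w \<bullet> w) / Q"]
        by (simp add: power2_eq_square field_simps)
      thus False using mult_pos_pos[OF pos pos] by simp
    qed
  qed
  hence "A *v v = m *\<^sub>R v" by (simp add: w_def)
  thus ?thesis using that vV low by blast
qed

text \<open>
  Induction on the dimension: split off one eigenvector; its orthogonal complement in \<open>V\<close> is
  again invariant because \<open>A\<close> is symmetric.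
\<close>

lemma spectral_subspace:
  fixes A :: "real^'n^'n"
  assumes sym: "transpose A = A" and "subspace V" "\<And>v. v \<in> V \<Longrightarrow> A *v v \<in> V"
  shows "\<exists>B. finite B \<and> pairwise orthogonal B \<and> (\<forall>b\<in>B. norm b = 1 \<and> (\<exists>l. A *v b = l *\<^sub>R b))
    \<and> span B = V"
  using assms(2,3)
proof (induction "dim V" arbitrary: V rule: less_induct)
  case less
  show ?case
  proof (cases "V = {0}")
    case True
    thus ?thesis by (intro exI[of _ "{}"]) auto
  next
    case False
    obtain v m where v: "v \<in> V" "norm v = 1" "A *v v = m *\<^sub>R v"
      using rayleigh_minimum[OF sym less.prems False] by metis
    define W where "W = {w \<in> V. v \<bullet> w = 0}"
    have W: "subspace W" unfolding W_def using less.prems(1)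
      by (auto simp: subspace_def inner_add_right)
    have AW: "A *v w \<in> W" if "w \<in> W" for w
      using that v less.prems symmetric_matrix_inner[OF sym, of v w] by (auto simp: W_def)
    have "v \<notin> W" using v by (auto simp: W_def)
    moreover have "W \<subseteq> V" by (auto simp: W_def)
    ultimately have "W \<subset> V" using v(1) by blast
    hence "span W \<subset> span V" using W less.prems(1) by (simp add: span_eq_iff[THEN iffD2])
    hence "dim W < dim V" by (rule dim_psubset)
    from less.hyps[OF this W AW] obtain B where B: "finite B" "pairwise orthogonal B"
      "\<And>b. b \<in> B \<Longrightarrow> norm b = 1 \<and> (\<exists>l. A *v b = l *\<^sub>R b)" "span B = W" by blast
    have BW: "B \<subseteq> W" using B(4) span_superset by blast
    have "span (insert v B) = V"
    proof
      show "span (insert v B) \<subseteq> V"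
        using BW v less.prems(1) by (intro span_minimal) (auto simp: W_def)
      show "V \<subseteq> span (insert v B)"
      proof
        fix x assume x: "x \<in> V"
        have vv: "v \<bullet> v = 1" using v by (simp add: norm_eq_1)
        have "x - (v \<bullet> x) *\<^sub>R v \<in> W"
          using x v vv less.prems(1) by (auto simp: W_def subspace_diff subspace_scale inner_diff_right)
        thus "x \<in> span (insert v B)" using B(4) by (auto simp: span_insert)
      qed
    qed
    moreover have "pairwise orthogonal (insert v B)"
      using B(2) BW by (auto simp: pairwise_insert W_def orthogonal_def inner_commute)
    ultimately show ?thesis using B v by (intro exI[of _ "insert v B"]) auto
  qed
qed

lemma orthonormal_eigenbasis:
  fixes A :: "real^'n^'n"
  assumes "transpose A = A"
  obtains B l where "finite B" "pairwise orthogonal B" "span B = UNIV"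
    "\<And>b. b \<in> B \<Longrightarrow> norm b = 1" "\<And>b. b \<in> B \<Longrightarrow> A *v b = l b *\<^sub>R b"
proof -
  obtain B where B: "finite B" "pairwise orthogonal B"
      "\<And>b. b \<in> B \<Longrightarrow> norm b = 1 \<and> (\<exists>l. A *v b = l *\<^sub>R b)" "span B = UNIV"
    using spectral_subspace[OF assms subspace_UNIV] by auto
  then obtain l where "\<And>b. b \<in> B \<Longrightarrow> A *v b = l b *\<^sub>R b" by metis
  with B that show thesis by blast
qed

lemma matrix_eq_on_spanning_set:
  fixes A C :: "real^'n^'n"
  assumes "span B = UNIV" "\<And>b. b \<in> B \<Longrightarrow> A *v b = C *v b"
  shows "A = C"
proof -
  have "A *v x = C *v x" for x
    using assms by (intro linear_eq_on[of "(*v) A" "(*v) C" x B]) auto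
  thus ?thesis by (metis matrix_eq)
qed

lemma pos_def_sym: "pos_def A \<Longrightarrow> transpose A = A"
  by (simp add: pos_def_def)

lemma pos_def_pos: "pos_def A \<Longrightarrow> v \<noteq> 0 \<Longrightarrow> 0 < v \<bullet> (A *v v)"
  by (simp add: pos_def_def)

lemma pos_def_nonneg: "pos_def A \<Longrightarrow> 0 \<le> v \<bullet> (A *v v)"
  using pos_def_pos[of A v] by (cases "v = 0") auto

lemma pos_def_invertible:
  fixes A :: "real^'n^'n"
  assumes "pos_def A"
  shows "invertible A"
proof -
  have "x = 0" if "A *v x = 0" for x
    using pos_def_pos[OF assms, of x] that by auto
  thus ?thesis
    using matrix_left_invertible_ker[of A] invertible_left_inverse[of A] by blast
qed

lemma matrix_inv_works:
  fixes A :: "real^'n^'n"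
  assumes "pos_def A"
  shows "A ** matrix_inv A = mat 1" "matrix_inv A ** A = mat 1"
    "A *v (matrix_inv A *v x) = x" "matrix_inv A *v (A *v x) = x"
proof -
  have "A ** matrix_inv A = mat 1 \<and> matrix_inv A ** A = mat 1"
    unfolding matrix_inv_def
    by (rule someI_ex) (use pos_def_invertible[OF assms] in \<open>simp add: invertible_def\<close>)
  thus *: "A ** matrix_inv A = mat 1" "matrix_inv A ** A = mat 1" by auto
  show "A *v (matrix_inv A *v x) = x" "matrix_inv A *v (A *v x) = x"
    using * by (simp_all add: matrix_vector_mul_assoc)
qed

lemma pos_def_matrix_inv:
  fixes A :: "real^'n^'n"
  assumes "pos_def A"
  shows "pos_def (matrix_inv A)"
  unfolding pos_def_def
proof safe
  note inv = matrix_inv_works[OF assms]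
  show "transpose (matrix_inv A) = matrix_inv A"
  proof (rule symmetric_matrixI)
    fix x y
    show "x \<bullet> (matrix_inv A *v y) = (matrix_inv A *v x) \<bullet> y"
      using symmetric_matrix_inner[OF pos_def_sym[OF assms], of "matrix_inv A *v x" "matrix_inv A *v y"]
      by (simp add: inv inner_commute)
  qed
  fix v :: "real^'n" assume "v \<noteq> 0"
  hence "matrix_inv A *v v \<noteq> 0" using inv(3)[of v] by auto
  from pos_def_pos[OF assms this] show "v \<bullet> (matrix_inv A *v v) > 0"
    by (simp add: inv inner_commute)
qed

lemma matrix_inv_unique:
  fixes A C :: "real^'n^'n"
  assumes "pos_def A" "C ** A = mat 1"
  shows "C = matrix_inv A"
  by (metis assms matrix_inv_works(1) matrix_mul_assoc matrix_mul_lid matrix_mul_rid)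

text \<open>
  If \<open>C\<close> is a positive semidefinite square root of \<open>A\<close> and \<open>A b = \<mu> b\<close> with \<open>\<mu> > 0\<close>, then
  \<open>w = C b - \<surd>\<mu> b\<close> satisfies \<open>C w = - \<surd>\<mu> w\<close>, and semidefiniteness forces \<open>w = 0\<close>. So
  every square root acts on an eigenbasis of \<open>A\<close> in the same way.
\<close>

lemma square_root_eigenvector:
  fixes A C :: "real^'n^'n"
  assumes "\<And>v. 0 \<le> v \<bullet> (C *v v)" "C ** C = A" "A *v b = \<mu> *\<^sub>R b" "0 < \<mu>"
  shows "C *v b = sqrt \<mu> *\<^sub>R b"
proof -
  define w where "w = C *v b - sqrt \<mu> *\<^sub>R b"
  have "C *v w = \<mu> *\<^sub>R b - sqrt \<mu> *\<^sub>R (C *v b)"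
    using assms(2,3) by (simp add: w_def matrix_vector_mult_diff_distrib matrix_vector_mult_scaleR
        matrix_vector_mul_assoc)
  also have "\<dots> = - sqrt \<mu> *\<^sub>R w"
    using assms(4) by (simp add: w_def scaleR_diff_right flip: scaleR_scaleR) (simp add: flip: power2_eq_square)
  finally have "w \<bullet> (C *v w) = - sqrt \<mu> * (w \<bullet> w)" by simp
  hence "sqrt \<mu> * (w \<bullet> w) \<le> 0" using assms(1)[of w] by simp
  hence "w \<bullet> w \<le> 0" using assms(4) by (simp add: mult_le_0_iff)
  hence "w = 0" by (meson inner_gt_zero_iff not_less)
  thus ?thesis by (simp add: w_def)
qed

lemma square_root_exists:
  fixes A :: "real^'n^'n"
  assumes A: "pos_def A"
  obtains R where "pos_def R" "R ** R = A"
proof -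
  obtain B l where B: "finite B" "pairwise orthogonal B" "span B = UNIV"
    "\<And>b. b \<in> B \<Longrightarrow> norm b = 1" "\<And>b. b \<in> B \<Longrightarrow> A *v b = l b *\<^sub>R b"
    using orthonormal_eigenbasis[OF pos_def_sym[OF A]] by metis
  have l: "0 < l b" if "b \<in> B" for b
    using pos_def_pos[OF A, of b] B(4,5)[OF that] by (force simp: norm_eq_1)
  define T where "T = (\<lambda>v. \<Sum>b\<in>B. (sqrt (l b) * (b \<bullet> v)) *\<^sub>R b)"
  have "linear T"
    unfolding T_def by (rule linearI)
      (simp_all add: inner_add_right algebra_simps sum.distrib scaleR_sum_right)
  define R where "R = matrix T"
  have R: "R *v v = T v" for v using \<open>linear T\<close> by (simp add: R_def matrix_works)
  have Tb: "T b = sqrt (l b) *\<^sub>R b" if "b \<in> B" for b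
  proof -
    have "T b = (\<Sum>c\<in>B. if c = b then sqrt (l b) *\<^sub>R b else 0)"
      unfolding T_def using B(2,4) that
      by (intro sum.cong) (auto simp: pairwise_def orthogonal_def norm_eq_1)
    thus ?thesis using B(1) that by simp
  qed
  have "R ** R = A"
  proof (rule matrix_eq_on_spanning_set[OF B(3)])
    fix b assume b: "b \<in> B"
    have "(R ** R) *v b = R *v (R *v b)" by (simp add: matrix_vector_mul_assoc)
    also have "\<dots> = (sqrt (l b) * sqrt (l b)) *\<^sub>R b"
      using Tb[OF b] by (simp add: R matrix_vector_mult_scaleR linear_scale[OF \<open>linear T\<close>])
    also have "\<dots> = A *v b" using l[OF b] B(5)[OF b] by simp
    finally show "(R ** R) *v b = A *v b" .
  qed
  moreover have "pos_def R"
    unfolding pos_def_def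
  proof safe
    show "transpose R = R"
      by (rule symmetric_matrixI)
        (auto simp: R T_def inner_sum_left inner_sum_right inner_commute intro!: sum.cong)
    fix v :: "real^'n" assume v: "v \<noteq> 0"
    have "R *v v \<noteq> 0"
    proof
      assume "R *v v = 0"
      hence "R *v (R *v v) = 0" by simp
      hence "A *v v = 0" using \<open>R ** R = A\<close> by (simp add: matrix_vector_mul_assoc)
      thus False using pos_def_pos[OF A v] by simp
    qed
    have vR: "v \<bullet> (R *v v) = (\<Sum>b\<in>B. sqrt (l b) * (b \<bullet> v)^2)"
      by (simp add: R T_def inner_sum_right power2_eq_square inner_commute mult.assoc)
    have nn: "0 \<le> sqrt (l b) * (b \<bullet> v)^2" if "b \<in> B" for b using l[OF that] by simp
    show "0 < v \<bullet> (R *v v)"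
    proof (rule ccontr)
      assume "\<not> ?thesis"
      hence "(\<Sum>b\<in>B. sqrt (l b) * (b \<bullet> v)^2) = 0"
        using sum_nonneg[OF nn] vR by force
      hence "sqrt (l b) * (b \<bullet> v)^2 = 0" if "b \<in> B" for b
        using sum_nonneg_eq_0_iff[OF B(1), of "\<lambda>b. sqrt (l b) * (b \<bullet> v)^2"] nn that by blast
      hence "b \<bullet> v = 0" if "b \<in> B" for b using l[OF that] that by fastforce
      hence "T v = 0" by (simp add: T_def)
      thus False using \<open>R *v v \<noteq> 0\<close> R by simp
    qed
  qed
  ultimately show thesis using that by blast
qed

lemma sqrt_matrix_eqI:
  fixes A R :: "real^'n^'n"
  assumes A: "pos_def A" and R: "pos_def R" "R ** R = A"
  shows "sqrt_matrix A = R"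
  unfolding sqrt_matrix_def
proof (rule the_equality)
  show "transpose R = R \<and> (\<forall>v. 0 \<le> v \<bullet> (R *v v)) \<and> R ** R = A"
    using R pos_def_sym pos_def_nonneg by blast
next
  fix C assume C: "transpose C = C \<and> (\<forall>v. 0 \<le> v \<bullet> (C *v v)) \<and> C ** C = A"
  obtain B l where B: "finite B" "pairwise orthogonal B" "span B = UNIV"
    "\<And>b. b \<in> B \<Longrightarrow> norm b = 1" "\<And>b. b \<in> B \<Longrightarrow> A *v b = l b *\<^sub>R b"
    using orthonormal_eigenbasis[OF pos_def_sym[OF A]] by metis
  show "C = R"
  proof (rule matrix_eq_on_spanning_set[OF B(3)])
    fix b assume b: "b \<in> B"
    have "0 < l b"
      using pos_def_pos[OF A, of b] B(4,5)[OF b] by (force simp: norm_eq_1)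
    thus "C *v b = R *v b"
      using square_root_eigenvector[OF _ _ B(5)[OF b], of C]
        square_root_eigenvector[OF pos_def_nonneg[OF R(1)] R(2) B(5)[OF b]] C by simp
  qed
qed

lemma sqrt_matrix:
  fixes A :: "real^'n^'n"
  assumes "pos_def A"
  shows "pos_def (sqrt_matrix A)" "sqrt_matrix A ** sqrt_matrix A = A"
    "sqrt_matrix A *v (sqrt_matrix A *v x) = A *v x"
proof -
  obtain R where R: "pos_def R" "R ** R = A" using square_root_exists[OF assms] .
  moreover have "sqrt_matrix A = R" by (rule sqrt_matrix_eqI[OF assms R])
  ultimately show "pos_def (sqrt_matrix A)" "sqrt_matrix A ** sqrt_matrix A = A"
    "sqrt_matrix A *v (sqrt_matrix A *v x) = A *v x"
    by (auto simp: matrix_vector_mul_assoc)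
qed

text \<open>
  The inverse of the square root is a positive definite square root of the inverse, and square
  roots are unique.
\<close>

lemma sqrt_matrix_inv:
  fixes A :: "real^'n^'n"
  assumes "pos_def A"
  shows "sqrt_matrix (matrix_inv A) = matrix_inv (sqrt_matrix A)"
proof (rule sqrt_matrix_eqI)
  let ?R = "sqrt_matrix A"
  note R = sqrt_matrix[OF assms]
  show "pos_def (matrix_inv A)" by (rule pos_def_matrix_inv[OF assms])
  show "pos_def (matrix_inv ?R)" by (rule pos_def_matrix_inv[OF R(1)])
  have "(matrix_inv ?R ** matrix_inv ?R) ** A = (matrix_inv ?R ** matrix_inv ?R) ** (?R ** ?R)"
    by (simp add: R(2))
  also have "\<dots> = matrix_inv ?R ** (matrix_inv ?R ** ?R) ** ?R"
    by (simp only: matrix_mul_assoc)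
  also have "\<dots> = mat 1" by (simp add: matrix_inv_works[OF R(1)])
  finally show "matrix_inv ?R ** matrix_inv ?R = matrix_inv A"
    by (rule matrix_inv_unique[OF assms])
qed

lemma sqrt_matrix_inv_cancel:
  fixes A :: "real^'n^'n"
  assumes "pos_def A"
  shows "sqrt_matrix (matrix_inv A) *v (sqrt_matrix A *v x) = x"
    "sqrt_matrix A *v (sqrt_matrix (matrix_inv A) *v x) = x"
  using matrix_inv_works(3,4)[OF sqrt_matrix(1)[OF assms]] by (simp_all add: sqrt_matrix_inv[OF assms])

subsection \<open>Local norms\<close>

text \<open>
  The local norm at a point, if \<open>A\<close> is the Hessian there. On the vectors of one block it agrees
  with the norm of that block.
\<close>

definition energy_norm :: "real^'n^'n \<Rightarrow> real^'n \<Rightarrow> real" where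
  "energy_norm A v = sqrt (v \<bullet> (A *v v))"

lemma inner_eq_sqrt_matrix:
  fixes A :: "real^'n^'n"
  assumes "pos_def A"
  shows "u \<bullet> (A *v v) = (sqrt_matrix A *v u) \<bullet> (sqrt_matrix A *v v)"
  using symmetric_matrix_inner[OF pos_def_sym[OF sqrt_matrix(1)[OF assms]]]
  by (metis sqrt_matrix(3)[OF assms])

lemma energy_norm_eq:
  fixes A :: "real^'n^'n"
  assumes "pos_def A"
  shows "energy_norm A v = norm (sqrt_matrix A *v v)"
  by (simp add: energy_norm_def inner_eq_sqrt_matrix[OF assms] norm_eq_sqrt_inner)

lemma energy_norm_sq:
  fixes A :: "real^'n^'n"
  assumes "pos_def A"
  shows "(energy_norm A v)^2 = v \<bullet> (A *v v)"
  by (simp add: energy_norm_def pos_def_nonneg[OF assms])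

lemma energy_norm_nonneg: "pos_def A \<Longrightarrow> 0 \<le> energy_norm A v"
  by (simp add: energy_norm_def pos_def_nonneg)

lemma energy_cauchy_schwarz:
  fixes A :: "real^'n^'n"
  assumes "pos_def A"
  shows "\<bar>u \<bullet> (A *v v)\<bar> \<le> energy_norm A u * energy_norm A v"
  unfolding inner_eq_sqrt_matrix[OF assms] energy_norm_eq[OF assms]
  by (rule Cauchy_Schwarz_ineq2)

lemma energy_norm_triangle:
  fixes A :: "real^'n^'n"
  assumes "pos_def A"
  shows "energy_norm A (u + v) \<le> energy_norm A u + energy_norm A v"
  unfolding energy_norm_eq[OF assms] by (simp add: matrix_vector_right_distrib norm_triangle_ineq)

lemma dual_norm_cauchy_schwarz:
  fixes A :: "real^'n^'n"
  assumes "pos_def A"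
  shows "\<bar>s \<bullet> v\<bar> \<le> dual_norm A s * energy_norm A v"
proof -
  have "s \<bullet> v = (matrix_inv A *v s) \<bullet> (A *v v)"
    by (simp add: symmetric_matrix_inner[OF pos_def_sym[OF assms]] matrix_inv_works[OF assms])
  also have "\<bar>\<dots>\<bar> \<le> energy_norm A (matrix_inv A *v s) * energy_norm A v"
    by (rule energy_cauchy_schwarz[OF assms])
  also have "energy_norm A (matrix_inv A *v s) = dual_norm A s"
    by (simp add: energy_norm_def dual_norm_def matrix_inv_works[OF assms] inner_commute)
  finally show ?thesis .
qed

lemma spectral_norm_bound: "norm (A *v v) \<le> spectral_norm A * norm v" for A :: "real^'n^'n"
  unfolding spectral_norm_def by (rule onorm) (rule matrix_vector_mul_bounded_linear)

lemma spectral_norm_nonneg: "0 \<le> spectral_norm A" for A :: "real^'n^'n"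
  unfolding spectral_norm_def by (rule onorm_pos_le) (rule matrix_vector_mul_bounded_linear)

text \<open>
  Insert \<open>B\<^sup>-\<^sup>1\<^sup>/\<^sup>2 B\<^sup>1\<^sup>/\<^sup>2\<close> in \<open>H\<^sup>1\<^sup>/\<^sup>2 v\<close>: the spectral norm of \<open>H\<^sup>1\<^sup>/\<^sup>2 B\<^sup>-\<^sup>1\<^sup>/\<^sup>2\<close> compares the local norms of \<open>H\<close> and \<open>B\<close>.
\<close>

lemma energy_norm_le_spectral_norm:
  fixes H B :: "real^'n^'n"
  assumes "pos_def H" "pos_def B"
  shows "energy_norm H v \<le> spectral_norm (sqrt_matrix H ** sqrt_matrix (matrix_inv B)) * energy_norm B v"
proof -
  have "sqrt_matrix H *v v
      = (sqrt_matrix H ** sqrt_matrix (matrix_inv B)) *v (sqrt_matrix B *v v)"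
    by (simp add: sqrt_matrix_inv_cancel[OF assms(2)] flip: matrix_vector_mul_assoc)
  thus ?thesis unfolding energy_norm_eq[OF assms(1)] energy_norm_eq[OF assms(2)]
    by (metis spectral_norm_bound)
qed

text \<open>
  The counterpart for \<open>H\<^sup>-\<^sup>1\<^sup>/\<^sup>2 B\<^sup>1\<^sup>/\<^sup>2\<close>: move this factor to \<open>B\<^sup>1\<^sup>/\<^sup>2 u\<close> in
  \<open>\<langle>B u, v\<rangle> = \<langle>H\<^sup>-\<^sup>1\<^sup>/\<^sup>2 B\<^sup>1\<^sup>/\<^sup>2 B\<^sup>1\<^sup>/\<^sup>2 u, H\<^sup>1\<^sup>/\<^sup>2 v\<rangle>\<close> and apply the Cauchy-Schwarz inequality.
\<close>

lemma inner_le_spectral_norm_inv: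
  fixes H B :: "real^'n^'n"
  assumes "pos_def H" "pos_def B"
  shows "u \<bullet> (B *v v) \<le> spectral_norm (sqrt_matrix (matrix_inv H) ** sqrt_matrix B)
           * energy_norm B u * energy_norm H v"
proof -
  let ?N = "sqrt_matrix (matrix_inv H) ** sqrt_matrix B"
  have "u \<bullet> (B *v v) = (B *v u) \<bullet> v"
    by (rule symmetric_matrix_inner[OF pos_def_sym[OF assms(2)]])
  also have "\<dots> = (B *v u) \<bullet> (sqrt_matrix (matrix_inv H) *v (sqrt_matrix H *v v))"
    by (simp add: sqrt_matrix_inv_cancel[OF assms(1)])
  also have "\<dots> = (sqrt_matrix (matrix_inv H) *v (B *v u)) \<bullet> (sqrt_matrix H *v v)"
    by (rule symmetric_matrix_inner[OF pos_def_sym[OF sqrt_matrix(1)[OF pos_def_matrix_inv[OF assms(1)]]]])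
  also have "sqrt_matrix (matrix_inv H) *v (B *v u) = ?N *v (sqrt_matrix B *v u)"
    by (simp add: sqrt_matrix(3)[OF assms(2)] flip: matrix_vector_mul_assoc)
  also have "(?N *v (sqrt_matrix B *v u)) \<bullet> (sqrt_matrix H *v v)
      \<le> norm (?N *v (sqrt_matrix B *v u)) * norm (sqrt_matrix H *v v)"
    by (rule norm_cauchy_schwarz)
  also have "\<dots> \<le> (spectral_norm ?N * norm (sqrt_matrix B *v u)) * norm (sqrt_matrix H *v v)"
    by (intro mult_right_mono spectral_norm_bound) simp
  finally show ?thesis unfolding energy_norm_eq[OF assms(1)] energy_norm_eq[OF assms(2)] .
qed

text \<open>
  The factor \<open>H\<^sup>1\<^sup>/\<^sup>2\<close> stretches by at most \<open>\<surd>K\<close> and \<open>B\<^sup>-\<^sup>1\<^sup>/\<^sup>2\<close> by at most \<open>1 / \<surd>m\<close>, in either order. The two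
  orders serve the two spectral norms in the constant of the method, with the roles of the
  Hessian and its block diagonal part exchanged.
\<close>

lemma spectral_norm_sqrt_le:
  fixes H B :: "real^'n^'n"
  assumes H: "pos_def H" and B: "pos_def B" and m: "0 < m"
    and HM: "\<And>v. v \<bullet> (H *v v) \<le> K * (norm v)^2" and Bm: "\<And>v. m * (norm v)^2 \<le> v \<bullet> (B *v v)"
  shows "spectral_norm (sqrt_matrix H ** sqrt_matrix (matrix_inv B)) \<le> sqrt (K / m)"
    and "spectral_norm (sqrt_matrix (matrix_inv B) ** sqrt_matrix H) \<le> sqrt (K / m)"
proof -
  have H': "(norm (sqrt_matrix H *v v))^2 \<le> K * (norm v)^2" for v
    using HM[of v] energy_norm_sq[OF H, of v] by (simp add: energy_norm_eq[OF H])
  have B': "m * (norm (sqrt_matrix (matrix_inv B) *v v))^2 \<le> (norm v)^2" for v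
    using Bm[of "sqrt_matrix (matrix_inv B) *v v"]
      energy_norm_sq[OF B, of "sqrt_matrix (matrix_inv B) *v v"]
    by (simp add: energy_norm_eq[OF B] sqrt_matrix_inv_cancel[OF B])
  have K: "0 \<le> K"
  proof -
    have "0 \<le> K * (norm (axis undefined 1 :: real^'n))^2"
      using H'[of "axis undefined 1"] order_trans zero_le_power2 by blast
    thus ?thesis by simp
  qed
  have root: "norm a \<le> sqrt (K / m) * norm b" if "m * (norm a)^2 \<le> K * (norm b)^2" for a b :: "real^'n"
  proof -
    have "(norm a)^2 \<le> (K / m) * (norm b)^2" using that m by (simp add: field_simps)
    hence "sqrt ((norm a)^2) \<le> sqrt ((K / m) * (norm b)^2)" by (rule real_sqrt_le_mono)
    thus ?thesis by (simp only: real_sqrt_mult real_sqrt_abs abs_norm_cancel)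
  qed
  show "spectral_norm (sqrt_matrix H ** sqrt_matrix (matrix_inv B)) \<le> sqrt (K / m)"
    unfolding spectral_norm_def
  proof (rule onorm_bound)
    show "0 \<le> sqrt (K / m)" using K m by simp
    fix v
    have "m * (norm (sqrt_matrix H *v (sqrt_matrix (matrix_inv B) *v v)))^2
       \<le> m * (K * (norm (sqrt_matrix (matrix_inv B) *v v))^2)"
      using m by (intro mult_left_mono H') auto
    also have "\<dots> = K * (m * (norm (sqrt_matrix (matrix_inv B) *v v))^2)" by simp
    also have "\<dots> \<le> K * (norm v)^2" using K by (intro mult_left_mono B')
    finally show "norm ((sqrt_matrix H ** sqrt_matrix (matrix_inv B)) *v v) \<le> sqrt (K / m) * norm v"
      by (intro root) (simp flip: matrix_vector_mul_assoc)
  qed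
  show "spectral_norm (sqrt_matrix (matrix_inv B) ** sqrt_matrix H) \<le> sqrt (K / m)"
    unfolding spectral_norm_def
  proof (rule onorm_bound)
    show "0 \<le> sqrt (K / m)" using K m by simp
    fix v
    have "m * (norm (sqrt_matrix (matrix_inv B) *v (sqrt_matrix H *v v)))^2
       \<le> (norm (sqrt_matrix H *v v))^2" by (rule B')
    also have "\<dots> \<le> K * (norm v)^2" by (rule H')
    finally show "norm ((sqrt_matrix (matrix_inv B) ** sqrt_matrix H) *v v) \<le> sqrt (K / m) * norm v"
      by (intro root) (simp flip: matrix_vector_mul_assoc)
  qed
qed

subsection \<open>The least eigenvalue\<close>

text \<open>
  The minimum of the Rayleigh quotient is an eigenvalue below all others, and an eigenbasis shows
  that there are only finitely many eigenvalues.
\<close>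

lemma lambda_min_bound:
  fixes A :: "real^'n^'n"
  assumes sym: "transpose A = A"
  shows "lambda_min A * (norm w)^2 \<le> w \<bullet> (A *v w)"
    and "\<exists>v. norm v = 1 \<and> A *v v = lambda_min A *\<^sub>R v"
proof -
  have "(UNIV :: (real^'n) set) \<noteq> {0}"
  proof -
    have "axis undefined 1 \<noteq> (0 :: real^'n)" by simp
    thus ?thesis by blast
  qed
  then obtain v m where v: "norm v = 1" "A *v v = m *\<^sub>R v"
    and low: "\<And>w. m * (norm w)^2 \<le> w \<bullet> (A *v w)"
    using rayleigh_minimum[OF sym subspace_UNIV] by auto
  obtain B l where B: "finite B" "pairwise orthogonal B" "span B = UNIV"
    "\<And>b. b \<in> B \<Longrightarrow> norm b = 1" "\<And>b. b \<in> B \<Longrightarrow> A *v b = l b *\<^sub>R b"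
    using orthonormal_eigenbasis[OF sym] by metis
  let ?E = "{l. \<exists>v. v \<noteq> 0 \<and> A *v v = l *\<^sub>R v}"
  have "?E \<subseteq> l ` B"
  proof safe
    fix k v assume v: "v \<noteq> 0" "A *v v = k *\<^sub>R v"
    have "\<exists>b\<in>B. v \<bullet> b \<noteq> 0"
    proof (rule ccontr)
      assume "\<not> ?thesis"
      hence "\<And>b. b \<in> B \<Longrightarrow> orthogonal v b" by (simp add: orthogonal_def)
      hence "orthogonal v x" if "x \<in> span B" for x
        by (rule orthogonal_to_span[OF that])
      hence "orthogonal v v" using B(3) by simp
      thus False using v by (simp add: orthogonal_self)
    qed
    then obtain b where b: "b \<in> B" "v \<bullet> b \<noteq> 0" by blast
    have "l b * (v \<bullet> b) = v \<bullet> (A *v b)" by (simp add: B(5)[OF b(1)])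
    also have "\<dots> = k * (v \<bullet> b)" by (simp add: symmetric_matrix_inner[OF sym] v(2))
    finally have "k = l b" using b(2) by simp
    thus "k \<in> l ` B" using b by simp
  qed
  hence fin: "finite ?E" using B(1) finite_surj by blast
  have "v \<noteq> 0" using v(1) by auto
  hence "m \<in> ?E" using v(2) by (intro CollectI exI[of _ v] conjI)
  moreover have "m \<le> k" if "k \<in> ?E" for k
  proof -
    from that have "\<exists>u. u \<noteq> 0 \<and> A *v u = k *\<^sub>R u" by (rule CollectD)
    then obtain u where u: "u \<noteq> 0" "A *v u = k *\<^sub>R u" by metis
    have "m * (norm u)^2 \<le> k * (norm u)^2" using low[of u] u by (simp add: power2_norm_eq_inner)
    thus ?thesis using u by simp
  qed
  ultimately have "lambda_min A = m" unfolding lambda_min_def using fin by (intro Min_eqI) auto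
  thus "lambda_min A * (norm w)^2 \<le> w \<bullet> (A *v w)"
    "\<exists>v. norm v = 1 \<and> A *v v = lambda_min A *\<^sub>R v" using low v by auto
qed

lemma lambda_min_pos:
  fixes A :: "real^'n^'n"
  assumes "pos_def A"
  shows "0 < lambda_min A"
proof -
  obtain v where v: "norm v = 1" "A *v v = lambda_min A *\<^sub>R v"
    using lambda_min_bound(2)[OF pos_def_sym[OF assms]] by blast
  hence "v \<noteq> 0" by auto
  from pos_def_pos[OF assms this] v show ?thesis by (simp add: norm_eq_1)
qed

section \<open>Block structure\<close>

lemma subspace_block_space: "subspace (block_space blk i)"
  by (auto simp: block_space_def subspace_def)

lemma block_proj_in: "block_proj blk i x \<in> block_space blk i"
  by (simp add: block_space_def block_proj_def)

lemma block_proj_id: "x \<in> block_space blk i \<Longrightarrow> block_proj blk i x = x"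
  by (auto simp: block_space_def block_proj_def vec_eq_iff)

lemma block_proj_other: "x \<in> block_space blk i \<Longrightarrow> j \<noteq> i \<Longrightarrow> block_proj blk j x = 0"
  by (auto simp: block_space_def block_proj_def vec_eq_iff)

lemma linear_block_proj: "linear (block_proj blk i)"
  by (rule linearI) (auto simp: block_proj_def vec_eq_iff)

lemma sum_block_proj: "(\<Sum>i\<in>UNIV. block_proj blk i x) = x" for blk :: "'n::finite \<Rightarrow> 'b::finite"
  by (simp add: vec_eq_iff block_proj_def)

lemma inner_block_proj:
  "block_proj blk i x \<bullet> y = x \<bullet> block_proj blk i y"
  by (auto simp: inner_vec_def block_proj_def intro!: sum.cong)

lemma block_matrix_mult:
  "block_matrix blk i A *v x = block_proj blk i (A *v block_proj blk i x)"
  by (auto simp: vec_eq_iff matrix_vector_mult_def block_matrix_def block_proj_def intro!: sum.cong)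

lemma block_diag_mult:
  fixes blk :: "'n::finite \<Rightarrow> 'b::finite" and A :: "real^'n^'n"
  shows "block_proj blk i (block_diag blk A *v x) = block_matrix blk i A *v x"
  by (auto simp: vec_eq_iff matrix_vector_mult_def block_matrix_def block_proj_def block_diag_def
      intro!: sum.cong)

lemma block_norm_eq:
  assumes "d \<in> block_space blk i"
  shows "block_norm blk i A d = energy_norm A d"
  by (simp add: block_norm_def energy_norm_def block_matrix_mult block_proj_id[OF assms]
      flip: inner_block_proj)

lemma block_diag_inner:
  fixes blk :: "'n::finite \<Rightarrow> 'b::finite" and A :: "real^'n^'n"
  shows "u \<bullet> (block_diag blk A *v v) = (\<Sum>i\<in>UNIV. block_proj blk i u \<bullet> (A *v block_proj blk i v))"
proof -
  have "u \<bullet> (block_diag blk A *v v) = (\<Sum>i\<in>UNIV. u \<bullet> block_proj blk i (block_diag blk A *v v))"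
    by (simp add: sum_block_proj flip: inner_sum_right)
  also have "\<dots> = (\<Sum>i\<in>UNIV. block_proj blk i u \<bullet> (A *v block_proj blk i v))"
    by (simp add: block_diag_mult block_matrix_mult inner_block_proj)
  finally show ?thesis .
qed

lemma norm_block_proj_sum:
  fixes blk :: "'n::finite \<Rightarrow> 'b::finite"
  shows "(norm x)^2 = (\<Sum>i\<in>UNIV. (norm (block_proj blk i x))^2)"
proof -
  have "x \<bullet> x = (\<Sum>i\<in>UNIV. x \<bullet> block_proj blk i x)"
    by (simp add: sum_block_proj flip: inner_sum_right)
  also have "\<dots> = (\<Sum>i\<in>UNIV. block_proj blk i x \<bullet> block_proj blk i x)"
    by (simp add: inner_block_proj block_proj_id[OF block_proj_in])
  finally show ?thesis by (simp add: power2_norm_eq_inner)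
qed

lemma pos_def_block_diag:
  fixes blk :: "'n::finite \<Rightarrow> 'b::finite" and A :: "real^'n^'n"
  assumes "pos_def A"
  shows "pos_def (block_diag blk A)"
  unfolding pos_def_def
proof safe
  show "transpose (block_diag blk A) = block_diag blk A"
  proof (rule symmetric_matrixI)
    fix x y :: "real^'n"
    have "x \<bullet> (block_diag blk A *v y) = y \<bullet> (block_diag blk A *v x)"
      unfolding block_diag_inner
      by (intro sum.cong refl) (metis inner_commute symmetric_matrix_inner[OF pos_def_sym[OF assms]])
    thus "x \<bullet> (block_diag blk A *v y) = (block_diag blk A *v x) \<bullet> y" by (simp add: inner_commute)
  qed
  fix v :: "real^'n" assume "v \<noteq> 0"
  then obtain i where i: "block_proj blk i v \<noteq> 0"
    by (metis sum_block_proj sum.neutral)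
  show "0 < v \<bullet> (block_diag blk A *v v)"
    unfolding block_diag_inner
    using pos_def_nonneg[OF assms] pos_def_pos[OF assms i]
    by (intro sum_pos2[of _ i]) auto
qed

lemma energy_norm_block_diag:
  fixes blk :: "'n::finite \<Rightarrow> 'b::finite" and A :: "real^'n^'n"
  assumes "pos_def A"
  shows "(energy_norm (block_diag blk A) v)^2 = (\<Sum>i\<in>UNIV. (energy_norm A (block_proj blk i v))^2)"
  unfolding energy_norm_sq[OF assms] energy_norm_sq[OF pos_def_block_diag[OF assms]] block_diag_inner ..

text \<open>
  The block dual norm of \<open>v\<close> is the primal norm of the solution \<open>y\<close> of the block system;
  this trades dual norms for primal norms throughout.
\<close>

lemma block_dual_norm_obtain:
  fixes blk :: "'n::finite \<Rightarrow> 'b::finite" and A :: "real^'n^'n"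
  assumes A: "pos_def A" and v: "v \<in> block_space blk i"
  obtains y where "y \<in> block_space blk i" "block_matrix blk i A *v y = v"
    "block_dual_norm blk i A v = energy_norm A y"
proof -
  let ?H = "block_diag blk A" and ?T = "\<lambda>y. block_matrix blk i A *v y"
  note H = matrix_inv_works[OF pos_def_block_diag[OF A, of blk]]
  \<comment> \<open>Inverting the whole block diagonal matrix provides a preimage under the single block.\<close>
  define u where "u = matrix_inv ?H *v v"
  have "?T (block_proj blk i u) = ?T u"
    by (simp add: block_matrix_mult block_proj_id[OF block_proj_in])
  also have "\<dots> = block_proj blk i (?H *v u)" by (simp add: block_diag_mult)
  also have "\<dots> = v" by (simp add: u_def H block_proj_id[OF v])
  finally have "v = ?T (block_proj blk i u)" ..
  hence img: "v \<in> ?T ` block_space blk i" by (rule image_eqI) (rule block_proj_in)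
  define y where "y = inv_into (block_space blk i) ?T v"
  have y: "y \<in> block_space blk i" "?T y = v"
    unfolding y_def using inv_into_into[OF img] f_inv_into_f[OF img] by auto
  have "block_dual_norm blk i A v = sqrt (v \<bullet> y)" by (simp add: block_dual_norm_def y_def)
  also have "v \<bullet> y = y \<bullet> ?T y" using y by (simp add: inner_commute)
  also have "sqrt \<dots> = energy_norm A y"
    using block_norm_eq[OF y(1), of A] by (simp add: block_norm_def)
  finally show thesis using that y by blast
qed

section \<open>Self-concordance\<close>

text \<open>
  On the open domain the partial derivatives assemble to a gradient that is itself differentiable,
  so gradient and Hessian are the true derivatives. The third claim supplies the third derivative
  of \<open>f\<close> along the line in direction \<open>u\<close>.
\<close>

lemma self_concordant_derivatives:
  fixes f :: "real^'n \<Rightarrow> ereal"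
  assumes sc: "self_concordant f" and x: "x \<in> effective_domain f"
  shows "((\<lambda>y. real_of_ereal (f y)) has_derivative (\<lambda>h. gradient f x \<bullet> h)) (at x)"
    and "(gradient f has_derivative (\<lambda>h. hessian f x *v h)) (at x)"
    and "(\<lambda>z. u \<bullet> (hessian f z *v u)) differentiable (at x)"
proof -
  define \<phi> where "\<phi> = (\<lambda>y. real_of_ereal (f y))"
  define D where "D = effective_domain f"
  have D: "open D" "x \<in> D" using sc x by (auto simp: D_def self_concordant_def)
  define \<phi>1 where "\<phi>1 = (\<lambda>b x. frechet_derivative \<phi> (at x) b)"
  define \<phi>2 where "\<phi>2 = (\<lambda>b c x. frechet_derivative (\<phi>1 b) (at x) c)"
  have "Ck_on 3 \<phi> D" using sc by (simp add: self_concordant_def \<phi>_def D_def)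
  hence d0: "\<And>x. x \<in> D \<Longrightarrow> \<phi> differentiable (at x)"
    and d1: "\<And>x b. x \<in> D \<Longrightarrow> b \<in> Basis \<Longrightarrow> \<phi>1 b differentiable (at x)"
    and d2: "\<And>x b c. x \<in> D \<Longrightarrow> b \<in> Basis \<Longrightarrow> c \<in> Basis \<Longrightarrow> \<phi>2 b c differentiable (at x)"
    by (auto simp: numeral_3_eq_3 \<phi>1_def \<phi>2_def)
  have lin: "frechet_derivative p (at z) h = (\<Sum>b\<in>Basis. (h \<bullet> b) * frechet_derivative p (at z) b)"
    if "p differentiable (at z)" for p :: "real^'n \<Rightarrow> real" and z h
  proof -
    have l: "linear (frechet_derivative p (at z))" by (rule linear_frechet_derivative[OF that])
    have "frechet_derivative p (at z) h
        = frechet_derivative p (at z) (\<Sum>b\<in>Basis. (h \<bullet> b) *\<^sub>R b)" by (simp add: euclidean_representation)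
    also have "\<dots> = (\<Sum>b\<in>Basis. (h \<bullet> b) * frechet_derivative p (at z) b)"
      by (simp add: linear_sum[OF l] linear_scale[OF l])
    finally show ?thesis .
  qed
  define G where "G = (\<lambda>z. \<Sum>b\<in>Basis. \<phi>1 b z *\<^sub>R b)"
  have gd: "(\<phi> has_derivative (\<lambda>h. h \<bullet> G z)) (at z)" if "z \<in> D" for z
  proof -
    have "frechet_derivative \<phi> (at z) h = h \<bullet> G z" for h
      unfolding lin[OF d0[OF that], of h] by (simp add: G_def \<phi>1_def inner_sum_right mult.commute)
    hence "frechet_derivative \<phi> (at z) = (\<lambda>h. h \<bullet> G z)" by blast
    thus ?thesis using frechet_derivative_works[of \<phi> "at z"] d0[OF that] by simp
  qed
  have grad: "gradient f z = G z" if "z \<in> D" for z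
    unfolding gradient_def gderiv_def \<phi>_def[symmetric]
  proof (rule the_equality)
    show "(\<phi> has_derivative (\<lambda>h. h \<bullet> G z)) (at z)" by (rule gd[OF that])
  next
    fix E assume "(\<phi> has_derivative (\<lambda>h. h \<bullet> E)) (at z)"
    from has_derivative_unique[OF this gd[OF that]] have "h \<bullet> E = h \<bullet> G z" for h by metis
    thus "E = G z" by (metis vector_eq_ldot)
  qed
  show "((\<lambda>y. real_of_ereal (f y)) has_derivative (\<lambda>h. gradient f x \<bullet> h)) (at x)"
    using gd[OF D(2)] grad[OF D(2)] by (simp add: \<phi>_def inner_commute)
  have hd: "(gradient f has_derivative (\<lambda>h. \<Sum>b\<in>Basis. frechet_derivative (\<phi>1 b) (at z) h *\<^sub>R b)) (at z)"
    if z: "z \<in> D" for z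
  proof -
    have "(G has_derivative (\<lambda>h. \<Sum>b\<in>Basis. frechet_derivative (\<phi>1 b) (at z) h *\<^sub>R b)) (at z)"
      unfolding G_def
      using d1[OF z] by (intro has_derivative_sum has_derivative_scaleR_left)
        (simp add: frechet_derivative_works)
    thus ?thesis
      by (rule has_derivative_transform_within_open[OF _ D(1) z]) (simp add: grad)
  qed
  have hm: "hessian f z *v h = (\<Sum>b\<in>Basis. frechet_derivative (\<phi>1 b) (at z) h *\<^sub>R b)"
    if z: "z \<in> D" for z h
  proof -
    have eq: "frechet_derivative (gradient f) (at z)
       = (\<lambda>h. \<Sum>b\<in>Basis. frechet_derivative (\<phi>1 b) (at z) h *\<^sub>R b)"
      using frechet_derivative_at[OF hd[OF z]] by simp
    show ?thesis unfolding hessian_def eq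
      using has_derivative_linear[OF hd[OF z]] by (simp add: matrix_works)
  qed
  show "(gradient f has_derivative (\<lambda>h. hessian f x *v h)) (at x)"
    using hd[OF D(2)] by (simp add: hm[OF D(2)])
  have quad: "u \<bullet> (hessian f z *v u) = (\<Sum>b\<in>Basis. \<Sum>c\<in>Basis. (u \<bullet> b) * ((u \<bullet> c) * \<phi>2 b c z))"
    if z: "z \<in> D" for z
  proof -
    have "u \<bullet> (hessian f z *v u) = (\<Sum>b\<in>Basis. (u \<bullet> b) * frechet_derivative (\<phi>1 b) (at z) u)"
      by (simp add: hm[OF z] inner_sum_right mult.commute)
    also have "\<dots> = (\<Sum>b\<in>Basis. (u \<bullet> b) * (\<Sum>c\<in>Basis. (u \<bullet> c) * \<phi>2 b c z))"
      unfolding \<phi>2_def by (intro sum.cong refl arg_cong2[where f = "(*)"] lin d1[OF z])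
    finally show ?thesis by (simp add: sum_distrib_left)
  qed
  have "(\<lambda>z. \<Sum>b\<in>Basis. \<Sum>c\<in>Basis. (u \<bullet> b) * ((u \<bullet> c) * \<phi>2 b c z)) differentiable (at x)"
    using d2[OF D(2)] by (intro differentiable_sum differentiable_mult differentiable_const) auto
  then obtain Q' where "((\<lambda>z. \<Sum>b\<in>Basis. \<Sum>c\<in>Basis. (u \<bullet> b) * ((u \<bullet> c) * \<phi>2 b c z)) has_derivative Q') (at x)"
    by (auto simp: differentiable_def)
  hence "((\<lambda>z. u \<bullet> (hessian f z *v u)) has_derivative Q') (at x)"
    by (rule has_derivative_transform_within_open[OF _ D]) (simp add: quad)
  thus "(\<lambda>z. u \<bullet> (hessian f z *v u)) differentiable (at x)"
    by (auto simp: differentiable_def)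
qed

text \<open>
  The self-concordance inequality is postulated at the base point of a line only. Shifting the base
  point along the line gives it at every parameter.
\<close>

lemma self_concordant_line:
  fixes f :: "real^'n \<Rightarrow> ereal"
  assumes sc: "self_concordant f" and z: "x + t *\<^sub>R u \<in> effective_domain f"
  defines "q \<equiv> \<lambda>t. u \<bullet> (hessian f (x + t *\<^sub>R u) *v u)"
  shows "((\<lambda>t. real_of_ereal (f (x + t *\<^sub>R u))) has_real_derivative gradient f (x + t *\<^sub>R u) \<bullet> u) (at t)"
    and "((\<lambda>t. gradient f (x + t *\<^sub>R u) \<bullet> u) has_real_derivative q t) (at t)"
    and "\<exists>q'. (q has_real_derivative q') (at t) \<and> \<bar>q'\<bar> \<le> 2 * (q t) powr (3/2)"
proof -
  define D where "D = effective_domain f"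
  define \<phi> where "\<phi> = (\<lambda>y. real_of_ereal (f y))"
  have line: "((\<lambda>t. x + t *\<^sub>R u) has_derivative (\<lambda>h. h *\<^sub>R u)) (at t)" for x t
    by (auto intro!: derivative_eq_intros)
  have D1: "((\<lambda>t. \<phi> (x + t *\<^sub>R u)) has_real_derivative gradient f (x + t *\<^sub>R u) \<bullet> u) (at t)"
    if "x + t *\<^sub>R u \<in> D" for x t
  proof -
    have "((\<lambda>t. \<phi> (x + t *\<^sub>R u)) has_derivative (\<lambda>h. gradient f (x + t *\<^sub>R u) \<bullet> (h *\<^sub>R u))) (at t)"
      using has_derivative_compose[OF line self_concordant_derivatives(1)[OF sc]] that
      by (simp add: D_def \<phi>_def)
    thus ?thesis by (simp add: has_field_derivative_def mult.commute[of "_ \<bullet> _"] mult_commute_abs)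
  qed
  have D2: "((\<lambda>t. gradient f (x + t *\<^sub>R u) \<bullet> u) has_real_derivative
       u \<bullet> (hessian f (x + t *\<^sub>R u) *v u)) (at t)" if "x + t *\<^sub>R u \<in> D" for x t
  proof -
    have "((\<lambda>t. gradient f (x + t *\<^sub>R u) \<bullet> u) has_derivative
       (\<lambda>h. (hessian f (x + t *\<^sub>R u) *v (h *\<^sub>R u)) \<bullet> u)) (at t)"
      using has_derivative_inner_left[OF has_derivative_compose[OF line self_concordant_derivatives(2)[OF sc]]] that
      by (simp add: D_def)
    thus ?thesis
      by (simp add: has_field_derivative_def matrix_vector_mult_scaleR inner_commute mult_commute_abs)
  qed
  show "((\<lambda>t. real_of_ereal (f (x + t *\<^sub>R u))) has_real_derivative gradient f (x + t *\<^sub>R u) \<bullet> u) (at t)"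
    using D1 z by (simp add: \<phi>_def D_def)
  show "((\<lambda>t. gradient f (x + t *\<^sub>R u) \<bullet> u) has_real_derivative q t) (at t)"
    using D2 z by (simp add: q_def D_def)
  define z0 where "z0 = x + t *\<^sub>R u"
  have z0: "z0 \<in> D" using z by (simp add: z0_def D_def)
  obtain Q' where Q': "((\<lambda>z. u \<bullet> (hessian f z *v u)) has_derivative Q') (at z0)"
    using self_concordant_derivatives(3)[OF sc, of z0 u] z0 by (auto simp: D_def differentiable_def)
  have Qlin: "Q' (h *\<^sub>R u) = h * Q' u" for h
    using linear_scale[OF has_derivative_linear[OF Q']] by simp
  have q1: "(q has_real_derivative Q' u) (at t)"
    using has_derivative_compose[OF line, of "\<lambda>z. u \<bullet> (hessian f z *v u)" Q' x t] Q'
    by (simp add: q_def has_field_derivative_def z0_def Qlin[unfolded z0_def] mult_commute_abs)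
  have q2: "((\<lambda>s. u \<bullet> (hessian f (z0 + s *\<^sub>R u) *v u)) has_real_derivative Q' u) (at 0)"
    using has_derivative_compose[OF line, of "\<lambda>z. u \<bullet> (hessian f z *v u)" Q' z0 0] Q'
    by (simp add: has_field_derivative_def Qlin mult_commute_abs)
  define \<psi> where "\<psi> = (\<lambda>s. \<phi> (z0 + s *\<^sub>R u))"
  define N where "N = {s. z0 + s *\<^sub>R u \<in> D}"
  have N: "open N" "0 \<in> N"
  proof -
    have "open D" using sc by (simp add: D_def self_concordant_def)
    moreover have "continuous_on UNIV (\<lambda>s. z0 + s *\<^sub>R u)" by (intro continuous_intros)
    ultimately show "open N"
      unfolding N_def using continuous_open_preimage[of UNIV "\<lambda>s. z0 + s *\<^sub>R u" D]
      by (simp add: vimage_def)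
    show "0 \<in> N" using z0 by (simp add: N_def)
  qed
  have dpsi: "deriv \<psi> s = gradient f (z0 + s *\<^sub>R u) \<bullet> u" if "s \<in> N" for s
    unfolding \<psi>_def using that by (intro DERIV_imp_deriv D1) (simp add: N_def)
  have ddpsi: "deriv (deriv \<psi>) s = u \<bullet> (hessian f (z0 + s *\<^sub>R u) *v u)" if "s \<in> N" for s
  proof -
    have "eventually (\<lambda>s. deriv \<psi> s = gradient f (z0 + s *\<^sub>R u) \<bullet> u) (nhds s)"
      using N(1) that dpsi by (auto simp: eventually_nhds)
    hence "deriv (deriv \<psi>) s = deriv (\<lambda>s. gradient f (z0 + s *\<^sub>R u) \<bullet> u) s"
      by (rule deriv_cong_ev) simp
    also have "\<dots> = u \<bullet> (hessian f (z0 + s *\<^sub>R u) *v u)"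
      using that by (intro DERIV_imp_deriv D2) (simp add: N_def)
    finally show ?thesis .
  qed
  have "eventually (\<lambda>s. deriv (deriv \<psi>) s = u \<bullet> (hessian f (z0 + s *\<^sub>R u) *v u)) (nhds 0)"
    using N ddpsi by (auto simp: eventually_nhds)
  hence "deriv (deriv (deriv \<psi>)) 0 = deriv (\<lambda>s. u \<bullet> (hessian f (z0 + s *\<^sub>R u) *v u)) 0"
    by (rule deriv_cong_ev) simp
  also have "\<dots> = Q' u" by (rule DERIV_imp_deriv[OF q2])
  finally have "(deriv ^^ 3) \<psi> 0 = Q' u" by (simp add: numeral_3_eq_3)
  moreover have "(deriv ^^ 2) \<psi> 0 = q t"
    using ddpsi[OF N(2)] by (simp add: numeral_2_eq_2 q_def z0_def)
  moreover have "\<bar>(deriv ^^ 3) \<psi> 0\<bar> \<le> 2 * ((deriv ^^ 2) \<psi> 0) powr (3/2)"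
    using sc z0 unfolding self_concordant_def Let_def \<psi>_def \<phi>_def D_def by blast
  ultimately show "\<exists>q'. (q has_real_derivative q') (at t) \<and> \<bar>q'\<bar> \<le> 2 * (q t) powr (3/2)"
    using q1 by auto
qed

text \<open>
  The self-concordance inequality says exactly that \<open>1 / \<surd>q\<close> has slope at most one.
\<close>

lemma inverse_sqrt_lipschitz:
  fixes q :: "real \<Rightarrow> real"
  assumes T: "0 \<le> T" and pos: "\<And>t. 0 \<le> t \<Longrightarrow> t \<le> T \<Longrightarrow> 0 < q t"
    and der: "\<And>t. 0 \<le> t \<Longrightarrow> t \<le> T \<Longrightarrow> \<exists>q'. (q has_real_derivative q') (at t) \<and> \<bar>q'\<bar> \<le> 2 * (q t) powr (3/2)"
  shows "\<bar>1 / sqrt (q T) - 1 / sqrt (q 0)\<bar> \<le> T"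
proof -
  define h where "h = (\<lambda>t. 1 / sqrt (q t))"
  have h: "\<exists>h'. (h has_real_derivative h') (at t) \<and> \<bar>h'\<bar> \<le> 1" if t: "0 \<le> t" "t \<le> T" for t
  proof -
    obtain q' where q': "(q has_real_derivative q') (at t)" "\<bar>q'\<bar> \<le> 2 * (q t) powr (3/2)"
      using der[OF t] by blast
    have p: "0 < q t" by (rule pos[OF t])
    have "(q t) powr (3/2) = (q t) powr (1 + 1/2)" by simp
    also have "\<dots> = q t * sqrt (q t)" using p by (simp only: powr_add powr_half_sqrt powr_one less_imp_le)
    finally have pw: "(q t) powr (3/2) = q t * sqrt (q t)" .
    have "(h has_real_derivative - (q' / (2 * (q t * sqrt (q t))))) (at t)"
      unfolding h_def using p q'(1)
      by (auto intro!: derivative_eq_intros simp: field_simps)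
    moreover have "\<bar>- (q' / (2 * (q t * sqrt (q t))))\<bar> \<le> 1"
      using q'(2) p unfolding pw by (simp add: abs_mult field_simps)
    ultimately show ?thesis by blast
  qed
  have "h 0 + 0 \<le> h T + T"
  proof (rule DERIV_nonneg_imp_nondecreasing[OF T, where f = "\<lambda>t. h t + t"])
    fix t assume t: "0 \<le> t" "t \<le> T"
    obtain h' where h': "(h has_real_derivative h') (at t)" "\<bar>h'\<bar> \<le> 1" using h[OF t] by blast
    have "((\<lambda>t. h t + t) has_real_derivative h' + 1) (at t)"
      by (intro derivative_intros h')
    thus "\<exists>y. ((\<lambda>t. h t + t) has_real_derivative y) (at t) \<and> 0 \<le> y" using h'(2) by force
  qed
  moreover have "0 - h 0 \<le> T - h T"
  proof (rule DERIV_nonneg_imp_nondecreasing[OF T, where f = "\<lambda>t. t - h t"])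
    fix t assume t: "0 \<le> t" "t \<le> T"
    obtain h' where h': "(h has_real_derivative h') (at t)" "\<bar>h'\<bar> \<le> 1" using h[OF t] by blast
    have "((\<lambda>t. t - h t) has_real_derivative 1 - h') (at t)"
      by (intro derivative_intros h')
    thus "\<exists>y. ((\<lambda>t. t - h t) has_real_derivative y) (at t) \<and> 0 \<le> y" using h'(2) by force
  qed
  ultimately show ?thesis by (simp add: h_def)
qed

text \<open>
  Integrates a second-order inequality twice, with the comparison function already subtracted.
\<close>

lemma nonneg_second_derivative:
  fixes p p1 p2 :: "real \<Rightarrow> real"
  assumes T: "0 \<le> T"
    and d1: "\<And>t. 0 \<le> t \<Longrightarrow> t \<le> T \<Longrightarrow> (p has_real_derivative p1 t) (at t)"
    and d2: "\<And>t. 0 \<le> t \<Longrightarrow> t \<le> T \<Longrightarrow> (p1 has_real_derivative p2 t) (at t)"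
    and nn: "\<And>t. 0 \<le> t \<Longrightarrow> t \<le> T \<Longrightarrow> 0 \<le> p2 t" and p10: "0 \<le> p1 0"
  shows "p 0 \<le> p T"
proof (rule DERIV_nonneg_imp_nondecreasing[OF T])
  fix t assume t: "0 \<le> t" "t \<le> T"
  have "p1 0 \<le> p1 t"
    using t d2 nn by (intro DERIV_nonneg_imp_nondecreasing[OF t(1)]) force
  thus "\<exists>y. (p has_real_derivative y) (at t) \<and> 0 \<le> y" using d1[OF t] p10 by force
qed

text \<open>
  By \<open>1 / \<surd>q(t) \<le> 1 / r + t\<close> the second derivative of \<open>\<psi>\<close> is at least \<open>(r / (1 + r t))\<^sup>2\<close>, which is the second
  derivative of \<open>r t - ln (1 + r t)\<close>.
\<close>

lemma self_concordant_1d_lower: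
  fixes \<psi> \<psi>1 q :: "real \<Rightarrow> real"
  assumes d1: "\<And>t. 0 \<le> t \<Longrightarrow> t \<le> 1 \<Longrightarrow> (\<psi> has_real_derivative \<psi>1 t) (at t)"
    and d2: "\<And>t. 0 \<le> t \<Longrightarrow> t \<le> 1 \<Longrightarrow> (\<psi>1 has_real_derivative q t) (at t)"
    and pos: "\<And>t. 0 \<le> t \<Longrightarrow> t \<le> 1 \<Longrightarrow> 0 < q t"
    and der: "\<And>t. 0 \<le> t \<Longrightarrow> t \<le> 1 \<Longrightarrow> \<exists>q'. (q has_real_derivative q') (at t) \<and> \<bar>q'\<bar> \<le> 2 * (q t) powr (3/2)"
  defines "r \<equiv> sqrt (q 0)"
  shows "\<psi> 0 + \<psi>1 0 + (r - ln (1 + r)) \<le> \<psi> 1"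
proof -
  have r: "0 < r" using pos[of 0] by (simp add: r_def)
  have rt: "0 < 1 + r * t" if "0 \<le> t" for t using r that by (simp add: add_pos_nonneg)
  have low: "(r / (1 + r * t))^2 \<le> q t" if t: "0 \<le> t" "t \<le> 1" for t
  proof -
    have "1 / sqrt (q t) \<le> 1 / r + t"
      using inverse_sqrt_lipschitz[of t q] t pos der unfolding r_def by force
    also have "\<dots> = (1 + r * t) / r" using r by (simp add: field_simps)
    finally have "r / (1 + r * t) \<le> sqrt (q t)"
      using r rt[OF t(1)] pos[OF t] by (simp add: field_simps)
    hence "(r / (1 + r * t))^2 \<le> (sqrt (q t))^2"
      using r rt[OF t(1)] by (intro power_mono) auto
    thus ?thesis using pos[OF t] by simp
  qed
  define p where "p = (\<lambda>t. \<psi> t - \<psi> 0 - t * \<psi>1 0 - (r * t - ln (1 + r * t)))"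
  have "p 0 \<le> p 1"
  proof (rule nonneg_second_derivative[where ?p1.0 = "\<lambda>t. \<psi>1 t - \<psi>1 0 - (r - r / (1 + r * t))"
        and ?p2.0 = "\<lambda>t. q t - (r / (1 + r * t))^2"])
    fix t :: real assume t: "0 \<le> t" "t \<le> 1"
    show "(p has_real_derivative \<psi>1 t - \<psi>1 0 - (r - r / (1 + r * t))) (at t)"
      unfolding p_def using rt[OF t(1)] by (auto intro!: derivative_eq_intros d1[OF t])
    show "((\<lambda>t. \<psi>1 t - \<psi>1 0 - (r - r / (1 + r * t))) has_real_derivative q t - (r / (1 + r * t))^2) (at t)"
      using rt[OF t(1)]
      by (auto intro!: derivative_eq_intros d2[OF t] simp: power2_eq_square)
    show "0 \<le> q t - (r / (1 + r * t))^2" using low[OF t] by simp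
  qed auto
  thus ?thesis by (simp add: p_def)
qed

text \<open>
  By \<open>1 / \<surd>q(t) \<ge> 1 / r - t\<close> the second derivative of \<open>\<psi>\<close> is at most \<open>(r / (1 - r t))\<^sup>2\<close>, which is the second
  derivative of \<open>\<omega>\<^sub>*(r t)\<close>.
\<close>

lemma self_concordant_1d_upper:
  fixes \<psi> \<psi>1 q :: "real \<Rightarrow> real"
  assumes T: "0 \<le> T"
    and d1: "\<And>t. 0 \<le> t \<Longrightarrow> t \<le> T \<Longrightarrow> (\<psi> has_real_derivative \<psi>1 t) (at t)"
    and d2: "\<And>t. 0 \<le> t \<Longrightarrow> t \<le> T \<Longrightarrow> (\<psi>1 has_real_derivative q t) (at t)"
    and pos: "\<And>t. 0 \<le> t \<Longrightarrow> t \<le> T \<Longrightarrow> 0 < q t"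
    and der: "\<And>t. 0 \<le> t \<Longrightarrow> t \<le> T \<Longrightarrow> \<exists>q'. (q has_real_derivative q') (at t) \<and> \<bar>q'\<bar> \<le> 2 * (q t) powr (3/2)"
  defines "r \<equiv> sqrt (q 0)"
  assumes rT: "r * T < 1"
  shows "\<psi> T \<le> \<psi> 0 + T * \<psi>1 0 + omega_star (r * T)"
proof -
  have r: "0 < r" using pos[of 0] T by (simp add: r_def)
  have rt: "0 < 1 - r * t" if "t \<le> T" for t
  proof -
    have "r * t \<le> r * T" using r that by simp
    thus ?thesis using rT by linarith
  qed
  have upp: "q t \<le> (r / (1 - r * t))^2" if t: "0 \<le> t" "t \<le> T" for t
  proof -
    have "1 / r - t \<le> 1 / sqrt (q t)"
      using inverse_sqrt_lipschitz[of t q] t pos der unfolding r_def by force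
    moreover have "1 / r - t = (1 - r * t) / r" using r by (simp add: field_simps)
    ultimately have "sqrt (q t) \<le> r / (1 - r * t)"
      using r rt[OF t(2)] pos[OF t] by (simp add: field_simps)
    hence "(sqrt (q t))^2 \<le> (r / (1 - r * t))^2"
      using pos[OF t] by (intro power_mono) auto
    thus ?thesis using pos[OF t] by simp
  qed
  define p where "p = (\<lambda>t. \<psi> 0 + t * \<psi>1 0 + (- (r * t) - ln (1 - r * t)) - \<psi> t)"
  have "p 0 \<le> p T"
  proof (rule nonneg_second_derivative[OF T, where ?p1.0 = "\<lambda>t. \<psi>1 0 + (r / (1 - r * t) - r) - \<psi>1 t"
        and ?p2.0 = "\<lambda>t. (r / (1 - r * t))^2 - q t"])
    fix t :: real assume t: "0 \<le> t" "t \<le> T"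
    show "(p has_real_derivative \<psi>1 0 + (r / (1 - r * t) - r) - \<psi>1 t) (at t)"
      unfolding p_def using rt[OF t(2)] by (auto intro!: derivative_eq_intros d1[OF t])
    show "((\<lambda>t. \<psi>1 0 + (r / (1 - r * t) - r) - \<psi>1 t) has_real_derivative (r / (1 - r * t))^2 - q t) (at t)"
      using rt[OF t(2)]
      by (auto intro!: derivative_eq_intros d2[OF t] simp: power2_eq_square)
    show "0 \<le> (r / (1 - r * t))^2 - q t" using upp[OF t] by simp
  qed auto
  thus ?thesis by (simp add: p_def omega_star_def)
qed

lemma ereal_epigraph_convexD:
  assumes "convex (ereal_epigraph S f)" "x \<in> S" "y \<in> S" "f x \<le> ereal a" "f y \<le> ereal b"
    "0 \<le> t" "t \<le> 1"
  shows "f ((1 - t) *\<^sub>R x + t *\<^sub>R y) \<le> ereal ((1 - t) * a + t * b)"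
    "(1 - t) *\<^sub>R x + t *\<^sub>R y \<in> S"
proof -
  have "(1 - t) *\<^sub>R (x, a) + t *\<^sub>R (y, b) \<in> ereal_epigraph S f"
    using assms by (intro convexD_alt) (auto simp: ereal_epigraph_def)
  thus "f ((1 - t) *\<^sub>R x + t *\<^sub>R y) \<le> ereal ((1 - t) * a + t * b)"
    "(1 - t) *\<^sub>R x + t *\<^sub>R y \<in> S" by (auto simp: ereal_epigraph_def)
qed

lemma self_concordant_finite:
  assumes "self_concordant f" "x \<in> effective_domain f"
  shows "f x = ereal (real_of_ereal (f x))"
  using assms by (cases "f x") (auto simp: self_concordant_def effective_domain_def)

lemma self_concordant_domain_segment:
  assumes sc: "self_concordant f" and "x \<in> effective_domain f" "y \<in> effective_domain f"
    "0 \<le> t" "t \<le> 1"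
  shows "(1 - t) *\<^sub>R x + t *\<^sub>R y \<in> effective_domain f"
proof -
  have "convex (ereal_epigraph UNIV f)"
    using sc by (auto simp: self_concordant_def closed_convex_on_def)
  note * = ereal_epigraph_convexD(1)[OF this UNIV_I UNIV_I _ _ assms(4,5), of x _ y]
  have "f ((1 - t) *\<^sub>R x + t *\<^sub>R y)
      \<le> ereal ((1 - t) * real_of_ereal (f x) + t * real_of_ereal (f y))"
    by (rule *) (simp_all flip: self_concordant_finite[OF sc assms(2)] self_concordant_finite[OF sc assms(3)])
  also have "\<dots> < \<infinity>" by simp
  finally show ?thesis by (simp add: effective_domain_def)
qed

lemma self_concordant_lower_bound:
  fixes f :: "real^'n \<Rightarrow> ereal"
  assumes sc: "self_concordant f" and x: "x \<in> effective_domain f" and y: "y \<in> effective_domain f"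
    and pd: "\<And>t. 0 \<le> t \<Longrightarrow> t \<le> 1 \<Longrightarrow> pos_def (hessian f (x + t *\<^sub>R (y - x)))"
  defines "r \<equiv> energy_norm (hessian f x) (y - x)"
  shows "real_of_ereal (f x) + gradient f x \<bullet> (y - x) + (r - ln (1 + r)) \<le> real_of_ereal (f y)"
proof (cases "y = x")
  case True thus ?thesis by (simp add: r_def energy_norm_def)
next
  case False
  let ?u = "y - x"
  have dom: "x + t *\<^sub>R ?u \<in> effective_domain f" if "0 \<le> t" "t \<le> 1" for t
    using self_concordant_domain_segment[OF sc x y that] by (simp add: algebra_simps)
  note L = self_concordant_line[OF sc dom]
  show ?thesis
    using self_concordant_1d_lower[OF L(1) L(2) _ L(3)] pos_def_pos[OF pd] False
    by (auto simp: r_def energy_norm_def)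
qed

text \<open>
  The bound holds as long as the ray stays in the domain; as the epigraph is closed and the bound
  is finite, the ray cannot leave the domain before the local length one is reached.
\<close>

lemma self_concordant_upper_bound:
  fixes f :: "real^'n \<Rightarrow> ereal"
  assumes sc: "self_concordant f" and x: "x \<in> effective_domain f"
    and pd: "\<And>t. 0 \<le> t \<Longrightarrow> t \<le> 1 \<Longrightarrow> x + t *\<^sub>R u \<in> effective_domain f \<Longrightarrow>
               pos_def (hessian f (x + t *\<^sub>R u))"
  defines "r \<equiv> energy_norm (hessian f x) u"
  assumes r1: "r < 1"
  shows "x + u \<in> effective_domain f"
    and "real_of_ereal (f (x + u)) \<le> real_of_ereal (f x) + gradient f x \<bullet> u + omega_star r"
proof -
  define \<phi> where "\<phi> = (\<lambda>y. real_of_ereal (f y))"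
  have *: "x + u \<in> effective_domain f \<and> \<phi> (x + u) \<le> \<phi> x + gradient f x \<bullet> u + omega_star r"
  proof (cases "u = 0")
    case True thus ?thesis using x by (simp add: r_def energy_norm_def omega_star_def)
  next
    case False
    define D where "D = effective_domain f"
    have xD: "x \<in> D" using x by (simp add: D_def)
    have r: "0 < r" using pd[of 0] x False pos_def_pos[of "hessian f x" u]
      by (simp add: r_def energy_norm_def)
    have bound: "\<phi> (x + t *\<^sub>R u) \<le> \<phi> x + t * (gradient f x \<bullet> u) + omega_star (r * t)"
      if t: "0 \<le> t" "t \<le> 1" "x + t *\<^sub>R u \<in> D" for t
    proof -
      have dom: "x + s *\<^sub>R u \<in> effective_domain f" if s: "0 \<le> s" "s \<le> t" for s
      proof (cases "t = 0")
        case True thus ?thesis using s x by simp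
      next
        case False
        have "(1 - s / t) *\<^sub>R x + (s / t) *\<^sub>R (x + t *\<^sub>R u) = x + s *\<^sub>R u"
          using False by (simp add: algebra_simps)
        thus ?thesis
          using self_concordant_domain_segment[OF sc x, of "x + t *\<^sub>R u" "s / t"] s t False
          by (simp add: D_def)
      qed
      note L = self_concordant_line[OF sc dom]
      have "r * t \<le> r" using r t by (intro mult_left_le) auto
      hence "r * t < 1" using r1 by linarith
      thus ?thesis
        using self_concordant_1d_upper[OF t(1) L(1) L(2) _ L(3)] pos_def_pos[OF pd[OF _ _ dom]] False t
        by (auto simp: r_def energy_norm_def \<phi>_def)
    qed
    \<comment> \<open>A bound on \<open>f\<close> along the ray that is uniform in \<open>t\<close> turns \<open>A\<close> into a section of the epigraph.\<close>
    define C where "C = \<phi> x + \<bar>gradient f x \<bullet> u\<bar> + omega_star r"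
    define A where "A = {t \<in> {0..1}. x + t *\<^sub>R u \<in> D}"
    have C: "\<phi> (x + t *\<^sub>R u) \<le> C" if "t \<in> A" for t
    proof -
      have t: "0 \<le> t" "t \<le> 1" "x + t *\<^sub>R u \<in> D" using that by (auto simp: A_def)
      have "t * (gradient f x \<bullet> u) \<le> t * \<bar>gradient f x \<bullet> u\<bar>" using t by (intro mult_left_mono) auto
      also have "\<dots> \<le> \<bar>gradient f x \<bullet> u\<bar>" using t by (intro mult_left_le_one_le) auto
      finally have "t * (gradient f x \<bullet> u) \<le> \<bar>gradient f x \<bullet> u\<bar>" .
      moreover have "omega_star (r * t) \<le> omega_star r"
      proof (rule strict_mono_on_leD[OF omega_star_strict_mono])
        show le: "r * t \<le> r" using r t by (intro mult_left_le) auto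
        have "r * t < 1" using le r1 by (rule le_less_trans)
        thus "r * t \<in> {0..<1}" "r \<in> {0..<1}" using r r1 t by auto
      qed
      ultimately show ?thesis using bound[OF t] by (simp add: C_def)
    qed
    have cont: "continuous_on {0..1} (\<lambda>t. x + t *\<^sub>R u)" by (intro continuous_intros)
    have "A = {0..1} \<inter> (\<lambda>t. (x + t *\<^sub>R u, C)) -` ereal_epigraph UNIV f"
    proof
      show "A \<subseteq> {0..1} \<inter> (\<lambda>t. (x + t *\<^sub>R u, C)) -` ereal_epigraph UNIV f"
      proof
        fix t assume t: "t \<in> A"
        have "f (x + t *\<^sub>R u) = ereal (\<phi> (x + t *\<^sub>R u))"
          unfolding \<phi>_def using t by (intro self_concordant_finite[OF sc]) (auto simp: A_def D_def)
        thus "t \<in> {0..1} \<inter> (\<lambda>t. (x + t *\<^sub>R u, C)) -` ereal_epigraph UNIV f"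
          using C[OF t] t by (auto simp: A_def ereal_epigraph_def)
      qed
      show "{0..1} \<inter> (\<lambda>t. (x + t *\<^sub>R u, C)) -` ereal_epigraph UNIV f \<subseteq> A"
        by (auto simp: A_def ereal_epigraph_def D_def effective_domain_def intro: le_less_trans)
    qed
    moreover have "closedin (top_of_set {0..1}) ({0..1} \<inter> (\<lambda>t. (x + t *\<^sub>R u, C)) -` ereal_epigraph UNIV f)"
      using sc by (intro continuous_closedin_preimage continuous_intros)
        (auto simp: self_concordant_def closed_convex_on_def)
    ultimately have "closedin (top_of_set {0..1}) A" by simp
    moreover have "openin (top_of_set {0..1}) A"
    proof -
      have "open D" using sc by (simp add: D_def self_concordant_def)
      from continuous_openin_preimage_gen[OF cont this] show ?thesis
        by (simp add: A_def Int_def vimage_def)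
    qed
    moreover have "A \<noteq> {}" using xD by (auto simp: A_def intro!: exI[of _ 0])
    ultimately have "A = {0..1}"
      using connected_clopen[of "{0..1::real}"] connected_Icc by blast
    hence "1 \<in> A" by simp
    hence "x + u \<in> D" by (simp add: A_def)
    thus ?thesis using bound[of 1] by (simp add: D_def)
  qed
  show "x + u \<in> effective_domain f" using * by blast
  show "real_of_ereal (f (x + u)) \<le> real_of_ereal (f x) + gradient f x \<bullet> u + omega_star r"
    using * by (simp add: \<phi>_def)
qed

section \<open>Sums of closed functions\<close>

text \<open>
  A sublevel set of a finite sum of closed functions is the projection of the set of all points
  together with upper bounds for the single summands. This lifted set is visibly closed, and it
  is bounded as soon as the sublevel set is bounded and the summands are bounded below on it.
\<close>

lemma compact_lifted_sublevel:
  fixes h :: "'c::finite \<Rightarrow> 'a::euclidean_space \<Rightarrow> ereal"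
  assumes closed: "\<And>j. closed (ereal_epigraph UNIV (h j))"
    and bdd: "bounded {x. (\<Sum>j\<in>UNIV. h j x) \<le> ereal c}"
    and low: "\<forall>j x. (\<Sum>j\<in>UNIV. h j x) \<le> ereal c \<longrightarrow> ereal (- L) \<le> h j x"
  defines "K \<equiv> {(x, r :: real^'c). (\<forall>j. h j x \<le> ereal (r $ j)) \<and> (\<Sum>j\<in>UNIV. r $ j) \<le> c}"
  shows "compact K" "fst ` K = {x. (\<Sum>j\<in>UNIV. h j x) \<le> ereal c}"
    "\<And>x. (\<Sum>j\<in>UNIV. h j x) \<le> ereal c \<Longrightarrow> \<exists>r. (x, r) \<in> K \<and> (\<Sum>j\<in>UNIV. h j x) = ereal (\<Sum>j\<in>UNIV. r $ j)"
proof -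
  have sub: "(\<Sum>j\<in>UNIV. h j x) \<le> ereal (\<Sum>j\<in>UNIV. r $ j)" if "(x, r) \<in> K" for x r
  proof -
    have "(\<Sum>j\<in>UNIV. h j x) \<le> (\<Sum>j\<in>UNIV. ereal (r $ j))"
      using that by (intro sum_mono) (auto simp: K_def)
    thus ?thesis by simp
  qed
  have sub': "(\<Sum>j\<in>UNIV. h j x) \<le> ereal c" if "(x, r) \<in> K" for x r
    using sub[OF that] that by (auto simp: K_def intro: order_trans)
  show lift: "\<exists>r. (x, r) \<in> K \<and> (\<Sum>j\<in>UNIV. h j x) = ereal (\<Sum>j\<in>UNIV. r $ j)"
    if x: "(\<Sum>j\<in>UNIV. h j x) \<le> ereal c" for x
  proof -
    have "(\<Sum>j\<in>UNIV. h j x) \<noteq> \<infinity>" using x by auto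
    hence "h j x \<noteq> \<infinity>" for j using sum_Pinfty[of "\<lambda>j. h j x" UNIV] by auto
    moreover have "h j x \<noteq> - \<infinity>" for j proof -
      have "ereal (- L) \<le> h j x" using low x by blast
      thus ?thesis by auto
    qed
    ultimately have eq: "h j x = ereal (real_of_ereal (h j x))" for j
      by (metis real_of_ereal.elims real_of_ereal.simps(1))
    have "(\<Sum>j\<in>UNIV. h j x) = (\<Sum>j\<in>UNIV. ereal (real_of_ereal (h j x)))"
      using eq by (intro sum.cong) auto
    hence s: "(\<Sum>j\<in>UNIV. h j x) = ereal (\<Sum>j\<in>UNIV. real_of_ereal (h j x))" by simp
    show ?thesis
      using s x eq by (intro exI[of _ "\<chi> j. real_of_ereal (h j x)"]) (auto simp: K_def)
  qed
  show "fst ` K = {x. (\<Sum>j\<in>UNIV. h j x) \<le> ereal c}"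
    using sub' lift by force
  have "closed K"
  proof -
    have "K = (\<Inter>j. (\<lambda>z. (fst z, snd z $ j)) -` ereal_epigraph UNIV (h j))
        \<inter> {z. (\<Sum>j\<in>UNIV. snd z $ j) \<le> c}"
      by (auto simp: K_def ereal_epigraph_def)
    moreover have "closed (\<Inter>j. (\<lambda>z. (fst z, snd z $ j)) -` ereal_epigraph UNIV (h j))"
      by (intro closed_INT ballI closed_vimage closed continuous_intros)
    moreover have "closed {z :: 'a \<times> (real^'c). (\<Sum>j\<in>UNIV. snd z $ j) \<le> c}"
      by (intro closed_Collect_le continuous_intros)
    ultimately show ?thesis by (simp only: closed_Int)
  qed
  moreover have "bounded K"
  proof -
    obtain R where R: "\<And>x. (\<Sum>j\<in>UNIV. h j x) \<le> ereal c \<Longrightarrow> norm x \<le> R"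
      using bdd by (auto simp: bounded_iff)
    have "norm z \<le> R + (c + (\<Sum>j\<in>(UNIV::'c set). 2 * \<bar>L\<bar>))" if z: "z \<in> K" for z
    proof -
      obtain x r where xr: "z = (x, r)" by (cases z)
      have r: "- L \<le> r $ j" for j
      proof -
        have "ereal (- L) \<le> h j x" using low sub'[OF z[unfolded xr]] by blast
        also have "\<dots> \<le> ereal (r $ j)" using z xr by (simp add: K_def)
        finally have "ereal (- L) \<le> ereal (r $ j)" .
        thus ?thesis by simp
      qed
      have "norm r \<le> (\<Sum>j\<in>UNIV. \<bar>r $ j\<bar>)" by (rule norm_le_l1_cart)
      also have "\<dots> \<le> (\<Sum>j\<in>UNIV. r $ j + 2 * \<bar>L\<bar>)"
      proof (rule sum_mono)
        fix j show "\<bar>r $ j\<bar> \<le> r $ j + 2 * \<bar>L\<bar>" using r[of j] by linarith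
      qed
      also have "\<dots> \<le> c + (\<Sum>j\<in>(UNIV::'c set). 2 * \<bar>L\<bar>)"
        using z xr by (auto simp: K_def sum.distrib)
      finally have "norm x + norm r \<le> R + (c + (\<Sum>j\<in>(UNIV::'c set). 2 * \<bar>L\<bar>))"
        by (intro add_mono R sub'[OF z[unfolded xr]])
      thus ?thesis unfolding xr using norm_Pair_le[of x r] by (rule order_trans[rotated])
    qed
    thus ?thesis unfolding bounded_iff by blast
  qed
  ultimately show "compact K" by (simp add: compact_eq_bounded_closed)
qed

text \<open>
  The sublevel set is the image of the compact lifted set under the projection.
\<close>

lemma compact_sublevel_sum:
  fixes h :: "'c::finite \<Rightarrow> 'a::euclidean_space \<Rightarrow> ereal"
  assumes "\<And>j. closed (ereal_epigraph UNIV (h j))"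
    and "bounded {x. (\<Sum>j\<in>UNIV. h j x) \<le> ereal c}"
    and "\<forall>j x. (\<Sum>j\<in>UNIV. h j x) \<le> ereal c \<longrightarrow> ereal (- L) \<le> h j x"
  shows "compact {x. (\<Sum>j\<in>UNIV. h j x) \<le> ereal c}"
proof -
  note K = compact_lifted_sublevel[OF assms]
  show ?thesis
    unfolding K(2)[symmetric] by (intro compact_continuous_image K(1) continuous_intros)
qed

text \<open>
  On the compact lifted set the objective becomes the continuous function \<open>\<Sum>\<^sub>j r\<^sub>j\<close>.
\<close>

lemma sum_attains_min:
  fixes h :: "'c::finite \<Rightarrow> 'a::euclidean_space \<Rightarrow> ereal"
  assumes "\<And>j. closed (ereal_epigraph UNIV (h j))"
    and "bounded {x. (\<Sum>j\<in>UNIV. h j x) \<le> ereal c}"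
    and "\<forall>j x. (\<Sum>j\<in>UNIV. h j x) \<le> ereal c \<longrightarrow> ereal (- L) \<le> h j x"
    and x1: "(\<Sum>j\<in>UNIV. h j x1) \<le> ereal c"
  shows "\<exists>x. \<forall>y. (\<Sum>j\<in>UNIV. h j x) \<le> (\<Sum>j\<in>UNIV. h j y)"
proof -
  define K where "K = {(x, r :: real^'c). (\<forall>j. h j x \<le> ereal (r $ j)) \<and> (\<Sum>j\<in>UNIV. r $ j) \<le> c}"
  note K = compact_lifted_sublevel[OF assms(1-3), folded K_def]
  have "K \<noteq> {}" using K(3)[OF x1] by auto
  moreover have "continuous_on K (\<lambda>z. \<Sum>j\<in>UNIV. snd z $ j)" by (intro continuous_intros)
  ultimately obtain z where z: "z \<in> K" "\<And>w. w \<in> K \<Longrightarrow> (\<Sum>j\<in>UNIV. snd z $ j) \<le> (\<Sum>j\<in>UNIV. snd w $ j)"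
    using continuous_attains_inf[OF K(1), of "\<lambda>z. \<Sum>j\<in>UNIV. snd z $ j"] by auto
  obtain x r where xr: "z = (x, r)" by (cases z)
  have "(\<Sum>j\<in>UNIV. h j x) \<le> (\<Sum>j\<in>UNIV. ereal (r $ j))"
    using z(1) xr by (intro sum_mono) (auto simp: K_def)
  hence x: "(\<Sum>j\<in>UNIV. h j x) \<le> ereal (\<Sum>j\<in>UNIV. r $ j)" by simp
  have "(\<Sum>j\<in>UNIV. h j x) \<le> (\<Sum>j\<in>UNIV. h j y)" for y
  proof (cases "(\<Sum>j\<in>UNIV. h j y) \<le> ereal c")
    case True
    then obtain s where s: "(y, s) \<in> K" "(\<Sum>j\<in>UNIV. h j y) = ereal (\<Sum>j\<in>UNIV. s $ j)"
      using K(3) by blast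
    have "ereal (\<Sum>j\<in>UNIV. r $ j) \<le> ereal (\<Sum>j\<in>UNIV. s $ j)" using z(2)[OF s(1)] xr by simp
    thus ?thesis using x s(2) by (simp add: order_trans)
  next
    case False
    have "ereal (\<Sum>j\<in>UNIV. r $ j) \<le> ereal c" using z(1) xr by (auto simp: K_def)
    thus ?thesis using x False by (meson linear order_trans)
  qed
  thus ?thesis by blast
qed

lemma sum_option_UNIV:
  fixes k :: "'b::finite option \<Rightarrow> 'a::comm_monoid_add"
  shows "(\<Sum>j\<in>UNIV. k j) = k None + (\<Sum>i\<in>UNIV. k (Some i))"
  by (simp add: UNIV_option_conv sum.reindex)

text \<open>
  Turns minimality or a subgradient inequality along a segment into a first-order condition.
\<close>

lemma derivative_ge_of_right_growth:
  fixes \<psi> :: "real \<Rightarrow> real"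
  assumes der: "(\<psi> has_real_derivative D) (at 0)" and "0 < T"
    and grow: "\<And>t. 0 < t \<Longrightarrow> t < T \<Longrightarrow> \<psi> 0 + c * t \<le> \<psi> t"
  shows "c \<le> D"
proof -
  have "((\<lambda>t. (\<psi> t - \<psi> 0) / t) \<longlongrightarrow> D) (at_right 0)"
    using der tendsto_within_subset[where S = UNIV and T = "{0<..}" and x = "0::real"]
    by (simp add: has_field_derivative_iff)
  moreover have "eventually (\<lambda>t. c \<le> (\<psi> t - \<psi> 0) / t) (at_right 0)"
    unfolding eventually_at_right_field
    using \<open>0 < T\<close> grow by (intro exI[of _ T]) (auto simp: field_simps)
  ultimately show ?thesis by (intro tendsto_lowerbound) auto
qed

section \<open>Composite minimization\<close>

text \<open>
  Values are extended reals. Below, \<open>f_val\<close>, \<open>g_val\<close> and \<open>F_val\<close> are their real parts, which agree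
  with the original functions on the effective domains; all estimates are made on these. The set
  \<open>g_dom\<close> is the effective domain of \<open>g\<close>, block by block.
\<close>

locale composite =
  fixes blk :: "'n::finite \<Rightarrow> 'b::finite"
    and f g F :: "real^'n \<Rightarrow> ereal"
    and gi :: "'b \<Rightarrow> real^'n \<Rightarrow> ereal"
  assumes gi_proper: "\<And>i. proper_on (block_space blk i) (gi i)"
    and gi_closed_convex: "\<And>i. closed_convex_on (block_space blk i) (gi i)"
    and g_def: "g = separable_sum blk gi"
    and F_def: "F = (\<lambda>x. f x + g x)"
    and f_sc: "self_concordant f"
    and hess_pd: "\<And>x. x \<in> effective_domain F \<Longrightarrow> pos_def (hessian f x)"
begin

abbreviation proj :: "'b \<Rightarrow> real^'n \<Rightarrow> real^'n" where
  "proj \<equiv> block_proj blk"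

definition g_dom :: "(real^'n) set" where
  "g_dom = {x. \<forall>i. gi i (proj i x) < \<infinity>}"

abbreviation f_val :: "real^'n \<Rightarrow> real" where
  "f_val x \<equiv> real_of_ereal (f x)"

definition g_val :: "real^'n \<Rightarrow> real" where
  "g_val x = (\<Sum>i\<in>UNIV. real_of_ereal (gi i (proj i x)))"

definition F_val :: "real^'n \<Rightarrow> real" where
  "F_val x = f_val x + g_val x"

lemma f_finite: "x \<in> effective_domain f \<Longrightarrow> f x = ereal (f_val x)"
  by (rule self_concordant_finite[OF f_sc])

lemma f_not_MInfty: "f x \<noteq> - \<infinity>"
  using f_sc by (simp add: self_concordant_def)

lemma gi_not_MInfty: "y \<in> block_space blk i \<Longrightarrow> gi i y \<noteq> - \<infinity>"
  using gi_proper[of i] by (simp add: proper_on_def)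

lemma gi_finite: "y \<in> block_space blk i \<Longrightarrow> gi i y < \<infinity> \<Longrightarrow> gi i y = ereal (real_of_ereal (gi i y))"
  using gi_not_MInfty[of y i] by (auto simp: ereal_real)

lemma gi_proj_finite: "x \<in> g_dom \<Longrightarrow> gi i (proj i x) = ereal (real_of_ereal (gi i (proj i x)))"
  by (rule gi_finite) (auto simp: g_dom_def block_proj_in)

lemma g_finite: "x \<in> g_dom \<Longrightarrow> g x = ereal (g_val x)"
proof -
  assume x: "x \<in> g_dom"
  have "g x = (\<Sum>i\<in>UNIV. ereal (real_of_ereal (gi i (proj i x))))"
    unfolding g_def separable_sum_def by (intro sum.cong refl gi_proj_finite[OF x])
  thus ?thesis by (simp add: g_val_def)
qed

lemma g_infinite: "x \<notin> g_dom \<Longrightarrow> g x = \<infinity>"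
  by (auto simp: g_dom_def g_def separable_sum_def sum_Pinfty)

lemma dom_iff: "x \<in> effective_domain F \<longleftrightarrow> x \<in> effective_domain f \<and> x \<in> g_dom"
proof (cases "x \<in> g_dom")
  case True
  thus ?thesis using g_finite[OF True] by (cases "f x") (auto simp: F_def effective_domain_def)
next
  case False
  thus ?thesis using g_infinite[OF False] f_not_MInfty[of x]
    by (cases "f x") (auto simp: F_def effective_domain_def)
qed

lemma F_finite: "x \<in> effective_domain F \<Longrightarrow> F x = ereal (F_val x)"
proof -
  assume "x \<in> effective_domain F"
  hence "f x = ereal (f_val x)" "g x = ereal (g_val x)"
    by (auto simp: dom_iff intro: f_finite g_finite)
  hence "f x + g x = ereal (f_val x) + ereal (g_val x)" by (rule arg_cong2)
  thus ?thesis by (simp add: F_def F_val_def)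
qed

lemma F_infinite: "x \<notin> effective_domain F \<Longrightarrow> F x = \<infinity>"
  by (simp add: effective_domain_def)

lemma gi_segment:
  assumes "y \<in> block_space blk i" "z \<in> block_space blk i" "gi i y < \<infinity>" "gi i z < \<infinity>" "0 \<le> t" "t \<le> 1"
  shows "gi i ((1 - t) *\<^sub>R y + t *\<^sub>R z) < \<infinity>"
    "real_of_ereal (gi i ((1 - t) *\<^sub>R y + t *\<^sub>R z))
       \<le> (1 - t) * real_of_ereal (gi i y) + t * real_of_ereal (gi i z)"
proof -
  have c: "convex (ereal_epigraph (block_space blk i) (gi i))"
    using gi_closed_convex[of i] by (simp add: closed_convex_on_def)
  have *: "gi i ((1 - t) *\<^sub>R y + t *\<^sub>R z)
      \<le> ereal ((1 - t) * real_of_ereal (gi i y) + t * real_of_ereal (gi i z))"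
    using gi_finite[OF assms(1,3)] gi_finite[OF assms(2,4)]
    by (intro ereal_epigraph_convexD(1)[OF c assms(1,2) _ _ assms(5,6)]) simp_all
  show fin: "gi i ((1 - t) *\<^sub>R y + t *\<^sub>R z) < \<infinity>"
    using * by (rule le_less_trans) simp
  have "(1 - t) *\<^sub>R y + t *\<^sub>R z \<in> block_space blk i"
    using subspace_block_space[of blk i] assms(1,2) by (intro subspace_add subspace_scale)
  from gi_finite[OF this fin] * show "real_of_ereal (gi i ((1 - t) *\<^sub>R y + t *\<^sub>R z))
       \<le> (1 - t) * real_of_ereal (gi i y) + t * real_of_ereal (gi i z)"
    by (metis ereal_less_eq(3))
qed

lemma proj_linear: "proj i (x + y) = proj i x + proj i y" "proj i (c *\<^sub>R x) = c *\<^sub>R proj i x"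
  by (rule linear_add[OF linear_block_proj]) (rule linear_scale[OF linear_block_proj])

lemma g_segment:
  assumes "x \<in> g_dom" "y \<in> g_dom" "0 \<le> t" "t \<le> 1"
  shows "(1 - t) *\<^sub>R x + t *\<^sub>R y \<in> g_dom"
    "g_val ((1 - t) *\<^sub>R x + t *\<^sub>R y) \<le> (1 - t) * g_val x + t * g_val y"
proof -
  have fin: "gi i (proj i x) < \<infinity>" "gi i (proj i y) < \<infinity>" for i
    using assms by (auto simp: g_dom_def)
  note seg = gi_segment[OF block_proj_in block_proj_in fin assms(3,4)]
  show "(1 - t) *\<^sub>R x + t *\<^sub>R y \<in> g_dom"
    using seg(1) by (simp add: g_dom_def proj_linear)
  have "g_val ((1 - t) *\<^sub>R x + t *\<^sub>R y)
      \<le> (\<Sum>i\<in>UNIV. (1 - t) * real_of_ereal (gi i (proj i x)) + t * real_of_ereal (gi i (proj i y)))"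
    unfolding g_val_def proj_linear by (intro sum_mono seg(2))
  thus "g_val ((1 - t) *\<^sub>R x + t *\<^sub>R y) \<le> (1 - t) * g_val x + t * g_val y"
    by (simp add: g_val_def sum.distrib sum_distrib_left)
qed

lemma g_ray:
  assumes "x \<in> g_dom" "y \<in> g_dom" "0 \<le> t" "t \<le> 1"
  shows "x + t *\<^sub>R (y - x) \<in> g_dom" "g_val (x + t *\<^sub>R (y - x)) \<le> g_val x + t * (g_val y - g_val x)"
proof -
  have "(1 - t) *\<^sub>R x + t *\<^sub>R y = x + t *\<^sub>R (y - x)" by (simp add: algebra_simps)
  thus "x + t *\<^sub>R (y - x) \<in> g_dom" "g_val (x + t *\<^sub>R (y - x)) \<le> g_val x + t * (g_val y - g_val x)"
    using g_segment[OF assms] by (simp_all add: algebra_simps)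
qed

lemma dom_ray:
  assumes "x \<in> effective_domain F" "y \<in> effective_domain F" "0 \<le> t" "t \<le> 1"
  shows "x + t *\<^sub>R (y - x) \<in> effective_domain F"
proof -
  have "(1 - t) *\<^sub>R x + t *\<^sub>R y = x + t *\<^sub>R (y - x)" by (simp add: algebra_simps)
  thus ?thesis
    using g_ray(1)[of x y t] self_concordant_domain_segment[OF f_sc, of x y t] assms
    by (simp add: dom_iff)
qed

lemma f_directional:
  assumes "x \<in> effective_domain f"
  shows "((\<lambda>t. f_val (x + t *\<^sub>R u)) has_real_derivative gradient f x \<bullet> u) (at 0)"
  using self_concordant_line(1)[OF f_sc, of x 0 u] assms by simp

text \<open>
  The nontrivial half of \<open>\<partial>F = \<nabla>f + \<partial>g\<close>: divide the subgradient inequality at \<open>x + t (y - x)\<close>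
  by \<open>t\<close>, use convexity of \<open>g\<close>, and let \<open>t\<close> tend to zero.
\<close>

lemma subgradient_split:
  assumes x: "x \<in> effective_domain F" and s: "s \<in> subdifferential_on UNIV F x" and y: "y \<in> g_dom"
  shows "g_val x + (s - gradient f x) \<bullet> (y - x) \<le> g_val y"
proof -
  let ?u = "y - x"
  have xd: "x \<in> effective_domain f" "x \<in> g_dom" using x by (auto simp: dom_iff)
  have "open (effective_domain f)" using f_sc by (simp add: self_concordant_def)
  moreover have "continuous_on UNIV (\<lambda>t. x + t *\<^sub>R ?u)" by (intro continuous_intros)
  ultimately have "open ((\<lambda>t. x + t *\<^sub>R ?u) -` effective_domain f)" by (rule open_vimage)
  moreover have "0 \<in> (\<lambda>t. x + t *\<^sub>R ?u) -` effective_domain f" using xd by simp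
  ultimately obtain e where "0 < e" "ball 0 e \<subseteq> (\<lambda>t. x + t *\<^sub>R ?u) -` effective_domain f"
    by (meson openE)
  hence e: "0 < e" "\<And>t. \<bar>t\<bar> < e \<Longrightarrow> x + t *\<^sub>R ?u \<in> effective_domain f"
    by (auto simp: dist_real_def subset_iff)
  have "s \<bullet> ?u - (g_val y - g_val x) \<le> gradient f x \<bullet> ?u"
  proof (rule derivative_ge_of_right_growth[OF f_directional[OF xd(1)], of "min e 1"])
    fix t assume t: "0 < t" "t < min e 1"
    have dom: "x + t *\<^sub>R ?u \<in> effective_domain F"
      using e(2)[of t] t g_ray(1)[OF xd(2) y, of t] by (simp add: dom_iff)
    have "\<forall>z. F x + ereal (s \<bullet> (z - x)) \<le> F z"
      using s by (simp add: subdifferential_on_def)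
    hence "F x + ereal (s \<bullet> (x + t *\<^sub>R ?u - x)) \<le> F (x + t *\<^sub>R ?u)" by (rule spec)
    hence "F_val x + t * (s \<bullet> ?u) \<le> F_val (x + t *\<^sub>R ?u)"
      by (simp add: F_finite[OF dom] F_finite[OF x])
    thus "f_val (x + 0 *\<^sub>R ?u) + (s \<bullet> ?u - (g_val y - g_val x)) * t \<le> f_val (x + t *\<^sub>R ?u)"
      using g_ray(2)[OF xd(2) y, of t] t by (simp add: F_val_def algebra_simps)
  qed (use e in auto)
  thus ?thesis by (simp add: inner_diff_left)
qed

text \<open>
  Add the self-concordant lower bound for \<open>f\<close> to the subgradient inequality for \<open>g\<close>.
\<close>

lemma growth:
  assumes x: "x \<in> effective_domain F" and s: "s \<in> subdifferential_on UNIV F x"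
    and y: "y \<in> effective_domain F"
  defines "r \<equiv> energy_norm (hessian f x) (y - x)"
  shows "F_val x + s \<bullet> (y - x) + (r - ln (1 + r)) \<le> F_val y"
proof -
  have "f_val x + gradient f x \<bullet> (y - x) + (r - ln (1 + r)) \<le> f_val y"
    unfolding r_def using x y
    by (intro self_concordant_lower_bound[OF f_sc] hess_pd dom_ray) (auto simp: dom_iff)
  thus ?thesis
    using subgradient_split[OF x s, of y] y by (simp add: F_val_def dom_iff inner_diff_left)
qed

text \<open>
  In the growth estimate bound \<open>s \<bullet> (y - x)\<close> below by \<open>- \<parallel>s\<parallel>\<^sup>* r\<close>; by the Fenchel inequality
  \<open>r - ln (1 + r) - \<parallel>s\<parallel>\<^sup>* r\<close> is at least \<open>- \<omega>\<^sub>*(\<parallel>s\<parallel>\<^sup>*)\<close>, whatever \<open>r\<close> is.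
\<close>

lemma gap_le_omega_star:
  assumes x: "x \<in> effective_domain F" and s: "s \<in> subdifferential_on UNIV F x"
    and y: "y \<in> effective_domain F"
    and l: "dual_norm (hessian f x) s < 1"
  shows "F_val x - F_val y \<le> omega_star (dual_norm (hessian f x) s)"
proof -
  let ?B = "hessian f x"
  define r where "r = energy_norm ?B (y - x)"
  define l where "l = dual_norm ?B s"
  have pd: "pos_def ?B" by (rule hess_pd[OF x])
  have r: "0 \<le> r" unfolding r_def by (rule energy_norm_nonneg[OF pd])
  have l0: "0 \<le> l" unfolding l_def dual_norm_def
    by (simp add: pos_def_nonneg[OF pos_def_matrix_inv[OF pd]])
  have "- (l * r) \<le> s \<bullet> (y - x)"
    using dual_norm_cauchy_schwarz[OF pd, of s "y - x"] by (simp add: l_def r_def)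
  thus ?thesis
    using growth[OF x s y] omega_star_fenchel[OF r l0] l
    by (simp add: l_def r_def mult.commute)
qed

text \<open>
  A subgradient of dual norm at least one is above every value of \<open>\<omega>\<^sub>*\<^sup>-\<^sup>1\<close>; for the others invert the
  bound on the gap.
\<close>

lemma omega_star_inv_gap_le_lambda_bar:
  assumes x: "x \<in> effective_domain F" and y: "y \<in> effective_domain F" and "F_val y \<le> F_val x"
  shows "ereal (omega_star_inv (F_val x - F_val y)) \<le> lambda_bar f F x"
  unfolding lambda_bar_def
proof (rule INF_greatest)
  fix s assume s: "s \<in> subdifferential_on UNIV F x"
  let ?l = "dual_norm (hessian f x) s" and ?t = "omega_star_inv (F_val x - F_val y)"
  have t: "?t \<in> {0..<1}" "omega_star ?t = F_val x - F_val y"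
    using omega_star_inv assms(3) by auto
  have l0: "0 \<le> ?l" unfolding dual_norm_def
    by (simp add: pos_def_nonneg[OF pos_def_matrix_inv[OF hess_pd[OF x]]])
  have "?t \<le> ?l"
  proof (rule ccontr)
    assume "\<not> ?thesis"
    hence lt: "?l < ?t" by simp
    hence "?l < 1" using t by simp
    with gap_le_omega_star[OF x s y] have "F_val x - F_val y \<le> omega_star ?l" by simp
    moreover have "omega_star ?l < omega_star ?t"
      using lt l0 t by (intro strict_mono_onD[OF omega_star_strict_mono]) auto
    ultimately show False using t by simp
  qed
  thus "ereal ?t \<le> ereal ?l" by simp
qed

text \<open>
  The shift by \<open>x\<close> serves the Newton model, where the variable is the direction.
\<close>

lemma closed_epigraph_gi_shift:
  "closed (ereal_epigraph UNIV (\<lambda>y. gi i (proj i (x + y))))"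
proof -
  have cont: "continuous_on UNIV (proj i)"
    by (rule linear_continuous_on) (rule linear_block_proj[THEN linear_conv_bounded_linear[THEN iffD1]])
  have "ereal_epigraph UNIV (\<lambda>y. gi i (proj i (x + y)))
      = (\<lambda>z. (proj i (x + fst z), snd z)) -` ereal_epigraph (block_space blk i) (gi i)"
    by (auto simp: ereal_epigraph_def block_proj_in)
  moreover have "closed (ereal_epigraph (block_space blk i) (gi i))"
    using gi_closed_convex by (simp add: closed_convex_on_def)
  moreover have "continuous_on UNIV (\<lambda>z :: (real^'n) \<times> real. (proj i (x + fst z), snd z))"
    by (intro continuous_on_Pair continuous_on_compose2[OF cont] continuous_intros) simp
  ultimately show ?thesis by (simp only: closed_vimage)
qed

text \<open>
  The subgradients that come with the approximate block directions thus bound each \<open>g\<^sub>i\<close> below by an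
  affine function, which yields coercivity of the Newton model and compactness of sublevel sets.
\<close>

lemma gi_affine_minorant:
  assumes w: "w \<in> block_space blk i" and s: "s \<in> subdifferential_on (block_space blk i) (gi i) w"
  shows "gi i w < \<infinity>"
    "ereal (real_of_ereal (gi i w) + s \<bullet> (proj i y - w)) \<le> gi i (proj i y)"
proof -
  have ineq: "gi i w + ereal (s \<bullet> (z - w)) \<le> gi i z" if "z \<in> block_space blk i" for z
    using s that by (simp add: subdifferential_on_def)
  obtain z where "z \<in> block_space blk i" "gi i z < \<infinity>"
    using gi_proper[of i] by (auto simp: proper_on_def)
  with ineq[of z] show fin: "gi i w < \<infinity>" by (cases "gi i w") auto
  have "gi i w + ereal (s \<bullet> (proj i y - w)) \<le> gi i (proj i y)" by (rule ineq[OF block_proj_in])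
  thus "ereal (real_of_ereal (gi i w) + s \<bullet> (proj i y - w)) \<le> gi i (proj i y)"
    by (subst (asm) gi_finite[OF w fin]) simp
qed

subsection \<open>The exact proximal Newton direction\<close>

definition newton_model :: "real^'n \<Rightarrow> real^'n \<Rightarrow> ereal" where
  "newton_model x d = f x + ereal (gradient f x \<bullet> d) + ereal (1/2 * (d \<bullet> (hessian f x *v d))) + g (x + d)"

lemma newton_model_finite:
  assumes "x \<in> effective_domain F" "x + d \<in> g_dom"
  shows "newton_model x d = ereal (f_val x + gradient f x \<bullet> d + 1/2 * (d \<bullet> (hessian f x *v d)) + g_val (x + d))"
proof -
  obtain r where "f x = ereal r"
    using f_finite[of x] assms(1) by (auto simp: dom_iff)
  thus ?thesis using g_finite[OF assms(2)] by (simp add: newton_model_def)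
qed

lemma norm_proj_le: "norm (proj i y) \<le> norm y"
proof (rule power2_le_imp_le)
  show "(norm (proj i y))^2 \<le> (norm y)^2"
    unfolding norm_block_proj_sum[of y blk] by (rule member_le_sum) auto
qed simp

text \<open>
  The affine minorants of the \<open>g\<^sub>i\<close> and the positive definite quadratic term make the model coercive, so
  its sublevel set at the value for \<open>d = 0\<close> is bounded and the minimum is attained.
\<close>

lemma newton_direction_minimizes:
  assumes x: "x \<in> effective_domain F"
    and w: "\<And>i. w i \<in> block_space blk i"
    and s: "\<And>i. s i \<in> subdifferential_on (block_space blk i) (gi i) (w i)"
  shows "newton_model x (newton_direction f g x) \<le> newton_model x d"
proof -
  let ?B = "hessian f x" and ?G = "norm (gradient f x)"
  define q where "q = (\<lambda>d. f_val x + gradient f x \<bullet> d + 1/2 * (d \<bullet> (?B *v d)))"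
  define h where "h = (\<lambda>j d. case j of None \<Rightarrow> ereal (q d) | Some i \<Rightarrow> gi i (proj i (x + d)))"
  have xd: "x \<in> effective_domain f" "x \<in> g_dom" using x by (auto simp: dom_iff)
  obtain fx where fx: "f x = ereal fx" "f_val x = fx" using f_finite[OF xd(1)] by simp
  have sum_h: "(\<Sum>j\<in>UNIV. h j d) = newton_model x d" for d
  proof -
    have "(\<Sum>i\<in>UNIV. gi i (proj i (x + d))) = g (x + d)" by (simp add: g_def separable_sum_def)
    thus ?thesis by (simp add: sum_option_UNIV h_def q_def newton_model_def fx)
  qed
  have closed: "closed (ereal_epigraph UNIV (h j))" for j
  proof (cases j)
    case None
    have "ereal_epigraph UNIV (h j) = {z. q (fst z) \<le> snd z}"
      by (auto simp: None h_def ereal_epigraph_def)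
    moreover have "continuous_on UNIV (\<lambda>z::(real^'n) \<times> real. ?B *v fst z)"
      by (rule continuous_on_compose2[OF matrix_vector_mult_linear_continuous_on[of UNIV]])
        (auto intro: continuous_intros)
    ultimately show ?thesis
      unfolding q_def by (auto intro!: closed_Collect_le continuous_intros)
  next
    case (Some i)
    thus ?thesis using closed_epigraph_gi_shift[of i x] by (simp add: h_def)
  qed
  define a where "a = (\<lambda>i. real_of_ereal (gi i (w i)))"
  define A where "A = (\<Sum>i\<in>UNIV. \<bar>a i\<bar> + norm (s i) * (norm x + norm (w i)))"
  define C where "C = (\<Sum>i\<in>UNIV. norm (s i))"
  have C0: "0 \<le> C" unfolding C_def by (intro sum_nonneg) auto
  \<comment> \<open>A lower bound for the \<open>i\<close>-th summand that is affine in \<open>\<parallel>y\<parallel>\<close> and nonpositive.\<close>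
  define l where "l = (\<lambda>i (y :: real^'n). - (\<bar>a i\<bar> + norm (s i) * (norm x + norm (w i))) - norm (s i) * norm y)"
  have l_sum: "(\<Sum>i\<in>UNIV. l i y) = - A - C * norm y" for y :: "real^'n"
    by (simp add: l_def A_def C_def sum_subtractf sum_negf sum_distrib_right sum.distrib)
  have l_nonpos: "l i y \<le> 0" for i and y :: "real^'n"
  proof -
    have "0 \<le> norm (s i) * (norm x + norm (w i))" "0 \<le> norm (s i) * norm y" by auto
    thus ?thesis unfolding l_def using abs_ge_zero[of "a i"] by linarith
  qed
  have l_le: "ereal (l i y) \<le> h (Some i) y" for i y
  proof -
    have "norm (proj i (x + y) - w i) \<le> norm (proj i (x + y)) + norm (w i)"
      by (rule norm_triangle_ineq4)
    also have "\<dots> \<le> norm (x + y) + norm (w i)" by (simp add: norm_proj_le)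
    also have "\<dots> \<le> norm x + norm y + norm (w i)" by (simp add: norm_triangle_ineq)
    finally have "norm (s i) * norm (proj i (x + y) - w i) \<le> norm (s i) * (norm x + norm y + norm (w i))"
      by (intro mult_left_mono) auto
    moreover have "\<bar>s i \<bullet> (proj i (x + y) - w i)\<bar> \<le> norm (s i) * norm (proj i (x + y) - w i)"
      by (rule Cauchy_Schwarz_ineq2)
    ultimately have "l i y \<le> a i + s i \<bullet> (proj i (x + y) - w i)"
      unfolding l_def distrib_left by linarith
    hence "ereal (l i y) \<le> ereal (a i + s i \<bullet> (proj i (x + y) - w i))" by simp
    also have "\<dots> \<le> gi i (proj i (x + y))" unfolding a_def by (rule gi_affine_minorant(2)[OF w s])
    finally show ?thesis by (simp add: h_def)
  qed
  have l_low: "- A - C * norm y \<le> l i y" for i and y :: "real^'n"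
  proof -
    have "(\<Sum>i\<in>UNIV. - l i y) \<ge> - l i y" using l_nonpos by (intro member_le_sum) auto
    thus ?thesis using l_sum[of y] by (simp add: sum_negf)
  qed
  define m where "m = lambda_min ?B"
  have m: "0 < m" unfolding m_def by (rule lambda_min_pos[OF hess_pd[OF x]])
  have q_low: "f_val x - ?G * norm y + m / 2 * (norm y)^2 \<le> q y" for y
  proof -
    have "\<bar>gradient f x \<bullet> y\<bar> \<le> ?G * norm y" by (rule Cauchy_Schwarz_ineq2)
    moreover have "m * (norm y)^2 \<le> y \<bullet> (?B *v y)"
      unfolding m_def by (rule lambda_min_bound(1)[OF pos_def_sym[OF hess_pd[OF x]]])
    ultimately show ?thesis by (simp add: q_def)
  qed
  define c where "c = F_val x"
  define R where "R = 1 + 2 * (\<bar>c - f_val x + A\<bar> + (?G + C)) / m"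
  have R0: "0 \<le> R" unfolding R_def using m C0 by (intro add_nonneg_nonneg divide_nonneg_nonneg) auto
  have nb: "norm y \<le> R" if y: "(\<Sum>j\<in>UNIV. h j y) \<le> ereal c" for y
  proof -
    have "ereal (q y + (- A - C * norm y)) = ereal (q y) + (\<Sum>i\<in>UNIV. ereal (l i y))"
      by (simp add: l_sum)
    also have "\<dots> \<le> h None y + (\<Sum>i\<in>UNIV. h (Some i) y)"
      by (intro add_mono sum_mono l_le) (simp add: h_def)
    also have "\<dots> \<le> ereal c" using y by (simp add: sum_option_UNIV)
    finally have "m / 2 * (norm y)^2 \<le> (c - f_val x + A) + (?G + C) * norm y"
      using q_low[of y] by (simp add: algebra_simps)
    thus ?thesis unfolding R_def using m C0 by (intro quadratic_bound) auto
  qed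
  define L where "L = \<bar>f_val x\<bar> + ?G * R + \<bar>A\<bar> + C * R"
  have low: "ereal (- L) \<le> h j y" if y: "(\<Sum>j\<in>UNIV. h j y) \<le> ereal c" for j y
  proof (cases j)
    case None
    have "?G * norm y \<le> ?G * R" "0 \<le> C * R" "0 \<le> m / 2 * (norm y)^2"
      using nb[OF y] C0 R0 m by (auto intro: mult_left_mono)
    hence "- L \<le> q y" using q_low[of y] unfolding L_def by linarith
    thus ?thesis by (simp add: None h_def)
  next
    case (Some i)
    have "C * norm y \<le> C * R" "0 \<le> ?G * R"
      using nb[OF y] C0 R0 by (auto intro: mult_left_mono)
    hence "- L \<le> l i y" using l_low[of y i] unfolding L_def by linarith
    hence "ereal (- L) \<le> ereal (l i y)" by simp
    also have "\<dots> \<le> h j y" using l_le[of i y] Some by simp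
    finally show ?thesis .
  qed
  have "(\<Sum>j\<in>UNIV. h j 0) \<le> ereal c"
    unfolding sum_h using newton_model_finite[OF x, of 0] xd by (simp add: c_def F_val_def)
  hence "\<exists>d. \<forall>y. (\<Sum>j\<in>UNIV. h j d) \<le> (\<Sum>j\<in>UNIV. h j y)"
    using low nb by (intro sum_attains_min[OF closed, where c = c and L = L]) (auto simp: bounded_iff)
  then obtain d0 where "\<forall>y. newton_model x d0 \<le> newton_model x y"
    unfolding sum_h by blast
  hence "is_arg_min (newton_model x) (\<lambda>_. True) d0"
    by (simp add: is_arg_min_linorder)
  hence "is_arg_min (newton_model x) (\<lambda>_. True) (arg_min (newton_model x) (\<lambda>_. True))"
    unfolding arg_min_def by (rule someI)
  moreover have "arg_min (newton_model x) (\<lambda>_. True) = newton_direction f g x"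
    by (simp add: newton_direction_def newton_model_def[abs_def])
  ultimately show ?thesis by (simp add: is_arg_min_linorder)
qed

text \<open>
  First-order optimality of the model: \<open>- \<nabla>f(x) - B d\<close> is a subgradient of \<open>g\<close> at \<open>x + d\<close>. Along the segment
  to \<open>y\<close> the smooth part of the model is a quadratic polynomial in \<open>t\<close>, and \<open>g\<close> is convex.
\<close>

lemma newton_direction_optimality:
  assumes x: "x \<in> effective_domain F"
    and w: "\<And>i. w i \<in> block_space blk i"
    and s: "\<And>i. s i \<in> subdifferential_on (block_space blk i) (gi i) (w i)"
  defines "dt \<equiv> newton_direction f g x"
  shows "x + dt \<in> g_dom"
    and "y \<in> g_dom \<Longrightarrow>
      g_val (x + dt) - (gradient f x + hessian f x *v dt) \<bullet> (y - (x + dt)) \<le> g_val y"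
proof -
  let ?B = "hessian f x"
  have min: "newton_model x dt \<le> newton_model x d" for d
    unfolding dt_def by (rule newton_direction_minimizes[OF x w s])
  have xd: "x \<in> effective_domain f" "x \<in> g_dom" using x by (auto simp: dom_iff)
  show dom: "x + dt \<in> g_dom"
  proof (rule ccontr)
    assume "x + dt \<notin> g_dom"
    hence "newton_model x dt = \<infinity>"
      using f_not_MInfty[of x] by (simp add: newton_model_def g_infinite)
    moreover have "newton_model x 0 \<noteq> \<infinity>" using newton_model_finite[OF x, of 0] xd by simp
    ultimately show False using min[of 0] by auto
  qed
  assume y: "y \<in> g_dom"
  define u where "u = y - (x + dt)"
  define q where "q = (\<lambda>d. gradient f x \<bullet> d + 1/2 * (d \<bullet> (?B *v d)))"
  define D where "D = gradient f x \<bullet> u + u \<bullet> (?B *v dt)"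
  define \<psi> where "\<psi> = (\<lambda>t. q dt + t * D + t^2 * (1/2 * (u \<bullet> (?B *v u))))"
  have sym: "transpose ?B = ?B" by (rule pos_def_sym[OF hess_pd[OF x]])
  have q: "q (dt + t *\<^sub>R u) = \<psi> t" for t
  proof -
    have "dt \<bullet> (?B *v u) = u \<bullet> (?B *v dt)"
      by (metis symmetric_matrix_inner[OF sym] inner_commute)
    thus ?thesis
      by (simp add: q_def \<psi>_def D_def matrix_vector_right_distrib matrix_vector_mult_scaleR
          inner_add_left inner_add_right power2_eq_square algebra_simps)
  qed
  have "- (g_val y - g_val (x + dt)) \<le> D"
  proof (rule derivative_ge_of_right_growth[of \<psi>])
    show "(\<psi> has_real_derivative D) (at 0)"
      unfolding \<psi>_def by (auto intro!: derivative_eq_intros)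
    show "(0::real) < 1" by simp
    fix t :: real assume t: "0 < t" "t < 1"
    have ray: "x + dt + t *\<^sub>R u \<in> g_dom"
      "g_val (x + dt + t *\<^sub>R u) \<le> g_val (x + dt) + t * (g_val y - g_val (x + dt))"
      using g_ray[OF dom y, of t] t by (auto simp: u_def)
    have "newton_model x dt \<le> newton_model x (dt + t *\<^sub>R u)" by (rule min)
    hence "q dt + g_val (x + dt) \<le> q (dt + t *\<^sub>R u) + g_val (x + dt + t *\<^sub>R u)"
      using newton_model_finite[OF x dom] newton_model_finite[OF x, of "dt + t *\<^sub>R u"] ray(1)
      by (simp add: q_def add.assoc)
    thus "\<psi> 0 + - (g_val y - g_val (x + dt)) * t \<le> \<psi> t"
      using ray(2) q[of t] q[of 0] by (simp add: algebra_simps)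
  qed
  thus "g_val (x + dt) - (gradient f x + hessian f x *v dt) \<bullet> (y - (x + dt)) \<le> g_val y"
    by (simp add: D_def u_def inner_add_left inner_commute[of "y - (x + dt)"])
qed

subsection \<open>The inexact block directions\<close>

text \<open>
  The residual \<open>v\<close> is written as \<open>B y\<close> on its block, which replaces the bound on its dual norm by
  one on the local norm of \<open>y\<close>.
\<close>

lemma approx_block_direction_obtain:
  assumes x: "x \<in> effective_domain F" and a: "approx_block_direction blk f gi \<eta> x i d"
  obtains y s where "d \<in> block_space blk i" "y \<in> block_space blk i"
    "s \<in> subdifferential_on (block_space blk i) (gi i) (proj i x + d)"
    "energy_norm (hessian f x) y \<le> \<eta> * energy_norm (hessian f x) d"
    "\<And>z. z \<in> block_space blk i \<Longrightarrow> s \<bullet> z = - (gradient f x \<bullet> z) - z \<bullet> (hessian f x *v (d + y))"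
proof -
  let ?B = "hessian f x"
  from a obtain v s where d: "d \<in> block_space blk i" and v: "v \<in> block_space blk i"
    and s: "s \<in> subdifferential_on (block_space blk i) (gi i) (proj i x + d)"
    and eq: "- v = proj i (gradient f x) + block_matrix blk i ?B *v d + s"
    and le: "block_dual_norm blk i ?B v \<le> \<eta> * block_norm blk i ?B d"
    unfolding approx_block_direction_def by blast
  obtain y where y: "y \<in> block_space blk i" "block_matrix blk i ?B *v y = v"
    "block_dual_norm blk i ?B v = energy_norm ?B y"
    using block_dual_norm_obtain[OF hess_pd[OF x] v] by metis
  have "s \<bullet> z = - (gradient f x \<bullet> z) - z \<bullet> (?B *v (d + y))" if z: "z \<in> block_space blk i" for z
  proof -
    have "s = - proj i (gradient f x) - block_matrix blk i ?B *v (d + y)"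
    proof -
      have "s = (proj i (gradient f x) + block_matrix blk i ?B *v d + s)
          - proj i (gradient f x) - block_matrix blk i ?B *v d" by simp
      also have "\<dots> = - (block_matrix blk i ?B *v y) - proj i (gradient f x) - block_matrix blk i ?B *v d"
        by (simp add: y(2) flip: eq)
      finally show ?thesis by (simp add: matrix_vector_right_distrib)
    qed
    also have "block_matrix blk i ?B *v (d + y) = proj i (?B *v (d + y))"
      using block_proj_id[of "d + y" blk i] d y(1) subspace_block_space[of blk i]
      by (simp add: block_matrix_mult subspace_add)
    finally have "s \<bullet> z = - (proj i (gradient f x) \<bullet> z) - proj i (?B *v (d + y)) \<bullet> z"
      by (simp add: inner_diff_left)
    thus ?thesis by (simp add: inner_block_proj block_proj_id[OF z] inner_commute[of z])
  qed
  thus thesis using that d y s le block_norm_eq[OF d] by metis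
qed

lemma rbpdn_step_eq:
  assumes "d x i \<in> block_space blk i"
  shows "rbpdn_step blk f d i x
    = x + (1 / (1 + energy_norm (hessian f x) (d x i))) *\<^sub>R d x i"
  using assms unfolding block_norm_eq[OF assms, symmetric]
  by (auto simp: rbpdn_step_def vec_eq_iff block_space_def)

text \<open>
  With damping factor \<open>1 / (1 + \<lambda>)\<close> the step has local length \<open>\<lambda> / (1 + \<lambda>) < 1\<close>, so the
  self-concordant upper bound applies; it costs \<open>\<omega>\<^sub>*(\<lambda> / (1 + \<lambda>)) = ln (1 + \<lambda>) - \<lambda> / (1 + \<lambda>)\<close>, against
  the first-order gain \<open>(1 - \<eta>) \<lambda>\<^sup>2 / (1 + \<lambda>)\<close>. By \<open>ln (1 + \<lambda>) \<le> \<lambda> - \<lambda>\<^sup>2 / (2 (1 + \<lambda>))\<close> the balance is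
  \<open>(1/2 - \<eta>) \<lambda>\<^sup>2 / (1 + \<lambda>)\<close>, and \<open>\<eta> \<le> 1/4\<close> leaves a quarter of \<open>\<lambda>\<^sup>2 / (1 + \<lambda>)\<close>.
\<close>

lemma block_step_descent:
  assumes x: "x \<in> effective_domain F" and a: "approx_block_direction blk f gi \<eta> x i d"
    and eta: "\<eta> \<le> 1/4"
  defines "l \<equiv> energy_norm (hessian f x) d"
  defines "x' \<equiv> x + (1 / (1 + l)) *\<^sub>R d"
  shows "x' \<in> effective_domain F" "F_val x' \<le> F_val x - 1/2 * (l^2 / (2 * (1 + l)))"
proof -
  let ?B = "hessian f x"
  have pd: "pos_def ?B" by (rule hess_pd[OF x])
  have xd: "x \<in> effective_domain f" "x \<in> g_dom" using x by (auto simp: dom_iff)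
  obtain y s where d: "d \<in> block_space blk i" and y: "y \<in> block_space blk i"
    and s: "s \<in> subdifferential_on (block_space blk i) (gi i) (proj i x + d)"
    and yl: "energy_norm ?B y \<le> \<eta> * l"
    and sz: "\<And>z. z \<in> block_space blk i \<Longrightarrow> s \<bullet> z = - (gradient f x \<bullet> z) - z \<bullet> (?B *v (d + y))"
    using approx_block_direction_obtain[OF x a] unfolding l_def by metis
  have l: "0 \<le> l" unfolding l_def by (rule energy_norm_nonneg[OF pd])
  define \<tau> where "\<tau> = 1 / (1 + l)"
  have t: "0 < \<tau>" "\<tau> \<le> 1" using l by (auto simp: \<tau>_def)
  define p where "p = proj i x"
  define w where "w = p + d"
  have pw: "p \<in> block_space blk i" "w \<in> block_space blk i"
    using d subspace_block_space[of blk i] by (auto simp: p_def w_def block_proj_in intro: subspace_add)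
  have fin: "gi i p < \<infinity>" "gi i w < \<infinity>"
    using xd(2) gi_affine_minorant(1)[OF _ s] pw by (auto simp: g_dom_def p_def w_def)
  have proj_ray: "proj j (x + r *\<^sub>R d) = (if j = i then (1 - r) *\<^sub>R p + r *\<^sub>R w else proj j x)" for r j
    using block_proj_id[OF d] block_proj_other[OF d, of j]
    by (auto simp: proj_linear p_def w_def algebra_simps)
  have ray: "x + r *\<^sub>R d \<in> g_dom" if "0 \<le> r" "r \<le> 1" for r
    using gi_segment(1)[OF pw fin that] xd(2) by (auto simp: g_dom_def proj_ray)
  have minorant: "real_of_ereal (gi i w) + s \<bullet> (p - w) \<le> real_of_ereal (gi i p)"
  proof -
    have "ereal (real_of_ereal (gi i w) + s \<bullet> (p - w)) \<le> gi i p"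
      using gi_affine_minorant(2)[OF _ s, of x] pw by (simp add: p_def w_def)
    also have "\<dots> = ereal (real_of_ereal (gi i p))" by (rule gi_finite[OF pw(1) fin(1)])
    finally show ?thesis by simp
  qed
  have sd: "s \<bullet> d \<le> - (gradient f x \<bullet> d) - (1 - \<eta>) * l^2"
  proof -
    have dd: "d \<bullet> (?B *v d) = l^2" by (simp add: l_def energy_norm_sq[OF pd])
    have "- (d \<bullet> (?B *v y)) \<le> l * energy_norm ?B y"
      using energy_cauchy_schwarz[OF pd, of d y] by (simp add: l_def)
    also have "\<dots> \<le> l * (\<eta> * l)" by (rule mult_left_mono[OF yl l])
    finally have "- (d \<bullet> (?B *v y)) \<le> \<eta> * l^2" by (simp add: power2_eq_square mult.left_commute)
    thus ?thesis using sz[OF d] dd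
      by (simp add: matrix_vector_right_distrib inner_add_right algebra_simps)
  qed
  have "g_val (x + \<tau> *\<^sub>R d) \<le> g_val x + \<tau> * (s \<bullet> d)"
  proof -
    have "g_val (x + \<tau> *\<^sub>R d) - g_val x
       = (\<Sum>j\<in>UNIV. real_of_ereal (gi j (proj j (x + \<tau> *\<^sub>R d))) - real_of_ereal (gi j (proj j x)))"
      by (simp add: g_val_def sum_subtractf)
    also have "\<dots> = (\<Sum>j\<in>UNIV. if j = i then
        real_of_ereal (gi i ((1 - \<tau>) *\<^sub>R p + \<tau> *\<^sub>R w)) - real_of_ereal (gi i p) else 0)"
      by (intro sum.cong refl) (auto simp: proj_ray p_def)
    also have "\<dots> = real_of_ereal (gi i ((1 - \<tau>) *\<^sub>R p + \<tau> *\<^sub>R w)) - real_of_ereal (gi i p)" by simp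
    also have "\<dots> \<le> \<tau> * (real_of_ereal (gi i w) - real_of_ereal (gi i p))"
      using gi_segment(2)[OF pw fin, of \<tau>] t by (simp add: algebra_simps)
    also have "\<dots> \<le> \<tau> * (s \<bullet> d)"
      using minorant t by (intro mult_left_mono) (auto simp: w_def)
    finally show ?thesis by simp
  qed
  also have "\<tau> * (s \<bullet> d) \<le> \<tau> * (- (gradient f x \<bullet> d) - (1 - \<eta>) * l^2)"
    using sd t by (intro mult_left_mono) auto
  finally have g: "g_val x' \<le> g_val x - \<tau> * (gradient f x \<bullet> d) - \<tau> * ((1 - \<eta>) * l^2)"
    by (simp add: x'_def \<tau>_def right_diff_distrib)
  have len: "energy_norm ?B (\<tau> *\<^sub>R d) = \<tau> * l"
    using t by (simp add: energy_norm_def l_def matrix_vector_mult_scaleR real_sqrt_mult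
        flip: power2_eq_square mult.assoc)
  have tl: "\<tau> * l < 1" using l by (simp add: \<tau>_def)
  have pd_ray: "pos_def (hessian f (x + r *\<^sub>R (\<tau> *\<^sub>R d)))"
    if "0 \<le> r" "r \<le> 1" "x + r *\<^sub>R (\<tau> *\<^sub>R d) \<in> effective_domain f" for r
    using that ray[of "r * \<tau>"] t by (intro hess_pd) (auto simp: dom_iff mult_le_one)
  note up = self_concordant_upper_bound[OF f_sc xd(1) pd_ray, unfolded len, OF _ _ _ tl]
  show "x' \<in> effective_domain F"
    using up(1) ray[of \<tau>] t by (simp add: dom_iff x'_def \<tau>_def)
  have os: "omega_star (\<tau> * l) = ln (1 + l) - \<tau> * l"
  proof -
    have "1 - \<tau> * l = 1 / (1 + l)" using l by (simp add: \<tau>_def field_simps)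
    thus ?thesis using l by (simp add: omega_star_def ln_div)
  qed
  have q: "l^2 / (2 * (1 + l)) = \<tau> * l^2 / 2" using l by (simp add: \<tau>_def)
  have "f_val x' \<le> f_val x + \<tau> * (gradient f x \<bullet> d) + (ln (1 + l) - \<tau> * l)"
    using up(2)[unfolded os] by (simp add: x'_def \<tau>_def)
  moreover have "ln (1 + l) \<le> l - \<tau> * l^2 / 2"
    using half_square_le_diff_ln[OF l] unfolding q by simp
  moreover have "l - \<tau> * l = \<tau> * l^2"
    using l by (simp add: \<tau>_def field_simps power2_eq_square)
  moreover have "\<tau> * ((1 - \<eta>) * l^2) = \<tau> * l^2 - \<eta> * (\<tau> * l^2)" by (simp add: algebra_simps)
  moreover have "\<eta> * (\<tau> * l^2) \<le> 1/4 * (\<tau> * l^2)" using eta t by (intro mult_right_mono) auto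
  ultimately show "F_val x' \<le> F_val x - 1/2 * (l^2 / (2 * (1 + l)))"
    using g unfolding F_val_def q by linarith
qed

text \<open>
  The optimality conditions of the two subproblems are played off against each other by the
  monotonicity of \<open>\<partial>g\<close>. Writing \<open>v = H Y\<close> for the residuals of the block problems, this yields
  \<open>\<langle>H (D + Y) - B d, d - D\<rangle> \<ge> 0\<close> for the exact direction \<open>d\<close> and the joint block direction \<open>D\<close>.
  The term \<open>\<langle>H (D + Y), D\<rangle>\<close> is nonnegative as \<open>\<parallel>Y\<parallel>\<^sub>H \<le> \<eta> \<parallel>D\<parallel>\<^sub>H\<close>, and \<open>\<parallel>d\<parallel>\<^sub>B\<close> cancels from the rest.
\<close>

lemma newton_direction_le_block_directions:
  assumes x: "x \<in> effective_domain F" and a: "\<And>i. approx_block_direction blk f gi \<eta> x i (d i)"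
    and eta: "0 \<le> \<eta>" "\<eta> \<le> 1/4"
  defines "B \<equiv> hessian f x"
  defines "H \<equiv> block_diag blk B"
  shows "energy_norm B (newton_direction f g x)
    \<le> ((1 + \<eta>) * spectral_norm (sqrt_matrix H ** sqrt_matrix (matrix_inv B))
        + spectral_norm (sqrt_matrix (matrix_inv H) ** sqrt_matrix B))
      * sqrt (\<Sum>i\<in>UNIV. (energy_norm B (d i))^2)"
proof -
  define N1 where "N1 = spectral_norm (sqrt_matrix H ** sqrt_matrix (matrix_inv B))"
  define N2 where "N2 = spectral_norm (sqrt_matrix (matrix_inv H) ** sqrt_matrix B)"
  have B: "pos_def B" unfolding B_def by (rule hess_pd[OF x])
  have H: "pos_def H" unfolding H_def by (rule pos_def_block_diag[OF B])
  have xd: "x \<in> effective_domain f" "x \<in> g_dom" using x by (auto simp: dom_iff)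
  have "\<forall>i. \<exists>y s. d i \<in> block_space blk i \<and> y \<in> block_space blk i \<and>
    s \<in> subdifferential_on (block_space blk i) (gi i) (proj i x + d i) \<and>
    energy_norm B y \<le> \<eta> * energy_norm B (d i) \<and>
    (\<forall>z\<in>block_space blk i. s \<bullet> z = - (gradient f x \<bullet> z) - z \<bullet> (B *v (d i + y)))"
    unfolding B_def using approx_block_direction_obtain[OF x a] by metis
  then obtain y s where d: "\<And>i. d i \<in> block_space blk i" and y: "\<And>i. y i \<in> block_space blk i"
    and s: "\<And>i. s i \<in> subdifferential_on (block_space blk i) (gi i) (proj i x + d i)"
    and yl: "\<And>i. energy_norm B (y i) \<le> \<eta> * energy_norm B (d i)"
    and sz: "\<And>i z. z \<in> block_space blk i \<Longrightarrow>
        s i \<bullet> z = - (gradient f x \<bullet> z) - z \<bullet> (B *v (d i + y i))"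
    by metis
  define D where "D = (\<Sum>i\<in>UNIV. d i)"
  define Y where "Y = (\<Sum>i\<in>UNIV. y i)"
  have proj_sum: "proj i (\<Sum>j\<in>UNIV. z j) = z i" if "\<And>j. z j \<in> block_space blk j" for i z
  proof -
    have "proj i (\<Sum>j\<in>UNIV. z j) = (\<Sum>j\<in>UNIV. if j = i then z i else 0)"
      unfolding linear_sum[OF linear_block_proj]
      using block_proj_id[OF that] block_proj_other[OF that]
      by (intro sum.cong refl) (metis)
    thus ?thesis by simp
  qed
  have pD: "proj i D = d i" for i unfolding D_def by (rule proj_sum[OF d])
  have pY: "proj i Y = y i" for i unfolding Y_def by (rule proj_sum[OF y])
  have w: "proj i x + d i \<in> block_space blk i" for i
    using subspace_block_space[of blk i] d block_proj_in by (intro subspace_add)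
  have xD: "x + D \<in> g_dom"
    using gi_affine_minorant(1)[OF w s] by (simp add: g_dom_def proj_linear pD)
  define dt where "dt = newton_direction f g x"
  note opt = newton_direction_optimality[OF x w s, folded dt_def B_def]
  define e where "e = dt - D"
  have "g_val (x + D) + (- (gradient f x \<bullet> e) - e \<bullet> (H *v (D + Y))) \<le> g_val (x + dt)"
  proof -
    have "real_of_ereal (gi i (proj i (x + D))) + s i \<bullet> proj i e \<le> real_of_ereal (gi i (proj i (x + dt)))" for i
    proof -
      have "proj i (x + dt) - (proj i x + d i) = proj i e"
        by (simp add: e_def proj_linear linear_diff[OF linear_block_proj] pD)
      hence "ereal (real_of_ereal (gi i (proj i x + d i)) + s i \<bullet> proj i e) \<le> gi i (proj i (x + dt))"
        using gi_affine_minorant(2)[OF w s, of i "x + dt"] by simp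
      also have "\<dots> = ereal (real_of_ereal (gi i (proj i (x + dt))))" by (rule gi_proj_finite[OF opt(1)])
      finally show ?thesis by (simp add: proj_linear pD)
    qed
    hence "g_val (x + D) + (\<Sum>i\<in>UNIV. s i \<bullet> proj i e) \<le> g_val (x + dt)"
      unfolding g_val_def sum.distrib[symmetric] by (intro sum_mono)
    also have "(\<Sum>i\<in>UNIV. s i \<bullet> proj i e)
        = (\<Sum>i\<in>UNIV. - (gradient f x \<bullet> proj i e) - proj i e \<bullet> (B *v proj i (D + Y)))"
      by (simp add: sz[OF block_proj_in] proj_linear pD pY)
    also have "\<dots> = - (gradient f x \<bullet> e) - e \<bullet> (H *v (D + Y))"
      by (simp add: sum_subtractf sum_negf H_def block_diag_inner sum_block_proj flip: inner_sum_right)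
    finally show ?thesis .
  qed
  moreover have "g_val (x + dt) + (gradient f x \<bullet> e + (B *v dt) \<bullet> e) \<le> g_val (x + D)"
  proof -
    have "x + D - (x + dt) = - e" by (simp add: e_def)
    thus ?thesis using opt(2)[OF xD] by (simp add: inner_add_left)
  qed
  ultimately have "(B *v dt) \<bullet> e \<le> e \<bullet> (H *v (D + Y))" by linarith
  hence main: "dt \<bullet> (B *v dt) \<le> dt \<bullet> (B *v D) + dt \<bullet> (H *v (D + Y)) - D \<bullet> (H *v (D + Y))"
  proof -
    have "(B *v dt) \<bullet> e = dt \<bullet> (B *v dt) - dt \<bullet> (B *v D)"
      unfolding symmetric_matrix_inner[OF pos_def_sym[OF B], symmetric]
      by (simp add: e_def matrix_vector_mult_diff_distrib inner_diff_right)
    thus ?thesis using \<open>(B *v dt) \<bullet> e \<le> e \<bullet> (H *v (D + Y))\<close> by (simp add: e_def inner_diff_left)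
  qed
  define \<beta> where "\<beta> = energy_norm B dt"
  define \<Lambda> where "\<Lambda> = energy_norm H D"
  have nn: "0 \<le> \<beta>" "0 \<le> \<Lambda>" "0 \<le> N1" "0 \<le> N2"
    unfolding \<beta>_def \<Lambda>_def N1_def N2_def
    by (auto simp: energy_norm_nonneg B H spectral_norm_nonneg)
  have YD: "energy_norm H Y \<le> \<eta> * \<Lambda>"
  proof (rule power2_le_imp_le)
    have "(energy_norm H Y)^2 = (\<Sum>i\<in>UNIV. (energy_norm B (y i))^2)"
      by (simp add: H_def energy_norm_block_diag[OF B] pY)
    also have "\<dots> \<le> (\<Sum>i\<in>UNIV. (\<eta> * energy_norm B (d i))^2)"
      by (intro sum_mono power_mono yl energy_norm_nonneg[OF B])
    also have "\<dots> = (\<eta> * \<Lambda>)^2"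
      by (simp add: \<Lambda>_def H_def power_mult_distrib energy_norm_block_diag[OF B] pD sum_distrib_left)
    finally show "(energy_norm H Y)^2 \<le> (\<eta> * \<Lambda>)^2" .
  qed (use eta nn in auto)
  have "0 \<le> D \<bullet> (H *v (D + Y))"
  proof -
    have "- (D \<bullet> (H *v Y)) \<le> \<Lambda> * energy_norm H Y"
      using energy_cauchy_schwarz[OF H, of D Y] by (simp add: \<Lambda>_def)
    also have "\<dots> \<le> \<Lambda> * (\<eta> * \<Lambda>)" by (rule mult_left_mono[OF YD nn(2)])
    also have "\<dots> \<le> \<Lambda> * (1 * \<Lambda>)" using eta nn by (intro mult_left_mono mult_right_mono) auto
    also have "\<dots> = D \<bullet> (H *v D)" using energy_norm_sq[OF H, of D] by (simp add: \<Lambda>_def power2_eq_square)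
    finally show ?thesis by (simp add: matrix_vector_right_distrib inner_add_right)
  qed
  moreover have "dt \<bullet> (H *v (D + Y)) \<le> N1 * \<beta> * ((1 + \<eta>) * \<Lambda>)"
  proof -
    have "dt \<bullet> (H *v (D + Y)) \<le> energy_norm H dt * energy_norm H (D + Y)"
      using energy_cauchy_schwarz[OF H, of dt "D + Y"] by simp
    also have "\<dots> \<le> (N1 * \<beta>) * ((1 + \<eta>) * \<Lambda>)"
    proof (rule mult_mono)
      show "energy_norm H dt \<le> N1 * \<beta>"
        unfolding N1_def \<beta>_def by (rule energy_norm_le_spectral_norm[OF H B])
      show "energy_norm H (D + Y) \<le> (1 + \<eta>) * \<Lambda>"
        using energy_norm_triangle[OF H, of D Y] YD by (simp add: \<Lambda>_def algebra_simps)
    qed (use nn energy_norm_nonneg[OF H] in auto)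
    finally show ?thesis .
  qed
  moreover have "dt \<bullet> (B *v D) \<le> N2 * \<beta> * \<Lambda>"
    unfolding N2_def \<beta>_def \<Lambda>_def by (rule inner_le_spectral_norm_inv[OF H B])
  ultimately have "\<beta> * \<beta> \<le> \<beta> * (((1 + \<eta>) * N1 + N2) * \<Lambda>)"
    using main energy_norm_sq[OF B, of dt] by (simp add: \<beta>_def power2_eq_square algebra_simps)
  hence "\<beta> \<le> ((1 + \<eta>) * N1 + N2) * \<Lambda>"
    using nn eta by (cases "\<beta> = 0") auto
  moreover have "\<Lambda> = sqrt (\<Sum>i\<in>UNIV. (energy_norm B (d i))^2)"
    using energy_norm_block_diag[OF B, of blk D] nn(2)
    by (simp add: \<Lambda>_def H_def pD real_sqrt_unique)
  ultimately show ?thesis by (simp add: \<beta>_def N1_def N2_def dt_def)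
qed

end

section \<open>Randomized iterations\<close>

fun trajectory :: "('b \<Rightarrow> 'x \<Rightarrow> 'x) \<Rightarrow> 'x \<Rightarrow> (nat \<Rightarrow> 'b) \<Rightarrow> nat \<Rightarrow> 'x" where
  "trajectory step x0 s 0 = x0"
| "trajectory step x0 s (Suc k) = step (s k) (trajectory step x0 s k)"

lemma trajectory_cong:
  "(\<And>j. j < k \<Longrightarrow> s j = s' j) \<Longrightarrow> trajectory step x0 s k = trajectory step x0 s' k"
  by (induction k) auto

lemma trajectory_invariant:
  assumes "x0 \<in> S" "\<And>i x. x \<in> S \<Longrightarrow> step i x \<in> S"
  shows "trajectory step x0 s k \<in> S"
  using assms by (induction k) auto

text \<open>
  The left-hand side is the expectation of \<open>V\<close> after \<open>k\<close> steps, written as a sum over all sequences of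
  choices; summing over the last choice first yields one factor \<open>\<rho>\<close>.
\<close>

lemma weighted_trajectories_contract:
  fixes p :: "'b::finite \<Rightarrow> real" and V :: "'x \<Rightarrow> real"
  assumes p: "\<And>i. 0 \<le> p i"
    and S: "x0 \<in> S" "\<And>i x. x \<in> S \<Longrightarrow> step i x \<in> S"
    and contract: "\<And>x. x \<in> S \<Longrightarrow> (\<Sum>i\<in>UNIV. p i * V (step i x)) \<le> \<rho> * V x"
    and \<rho>: "0 \<le> \<rho>"
  shows "(\<Sum>s\<in>PiE {..<k} (\<lambda>_. UNIV). (\<Prod>j<k. p (s j)) * V (trajectory step x0 s k)) \<le> \<rho>^k * V x0"
proof (induction k)
  case 0
  show ?case by simp
next
  case (Suc k)
  define w where "w = (\<lambda>s. \<Prod>j<k. p (s j))"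
  let ?P = "PiE {..<k} (\<lambda>_. UNIV :: 'b set)"
  have upd: "(\<Prod>j<Suc k. p ((s(k := i)) j)) = w s * p i"
    "trajectory step x0 (s(k := i)) (Suc k) = step i (trajectory step x0 s k)" for s i
  proof -
    have "(\<Prod>j<k. p ((s(k := i)) j)) = w s" unfolding w_def by (intro prod.cong) auto
    thus "(\<Prod>j<Suc k. p ((s(k := i)) j)) = w s * p i" by simp
    have "trajectory step x0 (s(k := i)) k = trajectory step x0 s k"
      by (rule trajectory_cong) simp
    thus "trajectory step x0 (s(k := i)) (Suc k) = step i (trajectory step x0 s k)" by simp
  qed
  have eq: "PiE {..<Suc k} (\<lambda>_. UNIV) = (\<lambda>(i, s). s(k := i)) ` ((UNIV :: 'b set) \<times> ?P)"
    unfolding lessThan_Suc by (rule PiE_insert_eq)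
  have inj: "inj_on (\<lambda>(i, s). s(k := i)) ((UNIV :: 'b set) \<times> ?P)"
    by (rule inj_combinator) simp
  have "(\<Sum>s\<in>PiE {..<Suc k} (\<lambda>_. UNIV). (\<Prod>j<Suc k. p (s j)) * V (trajectory step x0 s (Suc k)))
     = (\<Sum>(i, s)\<in>UNIV \<times> ?P. w s * p i * V (step i (trajectory step x0 s k)))"
    unfolding eq sum.reindex[OF inj] by (intro sum.cong refl) (auto simp only: o_def upd split_beta fst_conv snd_conv)
  also have "\<dots> = (\<Sum>s\<in>?P. \<Sum>i\<in>UNIV. w s * p i * V (step i (trajectory step x0 s k)))"
    unfolding sum.cartesian_product[symmetric] by (rule sum.swap)
  also have "\<dots> = (\<Sum>s\<in>?P. w s * (\<Sum>i\<in>UNIV. p i * V (step i (trajectory step x0 s k))))"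
    by (simp add: sum_distrib_left mult.assoc)
  also have "\<dots> \<le> (\<Sum>s\<in>?P. w s * (\<rho> * V (trajectory step x0 s k)))"
    by (intro sum_mono mult_left_mono contract trajectory_invariant[of x0 S step, OF S])
      (simp_all add: w_def prod_nonneg p)
  also have "\<dots> = \<rho> * (\<Sum>s\<in>?P. w s * V (trajectory step x0 s k))"
    by (simp add: sum_distrib_left mult.left_commute)
  also have "\<dots> \<le> \<rho> * (\<rho>^k * V x0)"
    using Suc \<rho> unfolding w_def by (intro mult_left_mono)
  finally show ?case by (simp add: mult.assoc)
qed

text \<open>
  The state after \<open>k\<close> steps depends on \<open>k\<close> choices from a finite set. Splitting the sample space by these
  choices turns the integrand into a finite combination of indicators, and by independence each
  sequence of choices has the product of the single probabilities.
\<close>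

lemma (in prob_space) nn_integral_trajectory:
  fixes \<iota> :: "nat \<Rightarrow> 'a \<Rightarrow> 'b::finite" and V :: "'x \<Rightarrow> ennreal"
  assumes indep: "indep_vars (\<lambda>_. count_space UNIV) \<iota> UNIV"
    and dist: "\<And>k i. prob {\<omega> \<in> space M. \<iota> k \<omega> = i} = p i"
    and X: "\<And>\<omega>. \<omega> \<in> space M \<Longrightarrow> X \<omega> = trajectory step x0 (\<lambda>j. \<iota> j \<omega>) k"
  shows "(\<integral>\<^sup>+\<omega>. V (X \<omega>) \<partial>M)
    = (\<Sum>s\<in>PiE {..<k} (\<lambda>_. UNIV). ennreal (\<Prod>j<k. p (s j)) * V (trajectory step x0 s k))"
proof -
  let ?P = "PiE {..<k} (\<lambda>_. UNIV :: 'b set)"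
  have finP: "finite ?P" by (intro finite_PiE) auto
  define A where "A = (\<lambda>s. {\<omega> \<in> space M. \<forall>j<k. \<iota> j \<omega> = s j})"
  have meas: "\<iota> j \<in> measurable M (count_space UNIV)" for j
    using indep by (auto simp: indep_vars_def)
  have A_eq: "A s = space M \<inter> (\<Inter>j\<in>{..<k}. \<iota> j -` {s j} \<inter> space M)" for s
    by (auto simp: A_def)
  have A_sets: "A s \<in> events" for s
  proof -
    have "\<iota> j -` {s j} \<inter> space M \<in> events" for j by (rule measurable_sets[OF meas]) simp
    hence "{\<omega> \<in> space M. \<iota> j \<omega> = s j} \<in> events" for j
      by (simp add: vimage_def Int_def conj_commute)
    thus ?thesis unfolding A_def by (intro sets.sets_Collect_countable_All sets.sets_Collect_imp) auto
  qed
  have A_prob: "prob (A s) = (\<Prod>j<k. p (s j))" for s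
  proof (cases "k = 0")
    case True
    thus ?thesis by (simp add: A_def prob_space)
  next
    case False
    have "prob (A s) = prob (\<Inter>j\<in>{..<k}. \<iota> j -` {s j} \<inter> space M)"
      using False by (intro arg_cong[where f = prob]) (auto simp: A_eq)
    also have "\<dots> = (\<Prod>j<k. prob (\<iota> j -` {s j} \<inter> space M))"
      using False by (intro indep_varsD[OF indep]) auto
    also have "\<dots> = (\<Prod>j<k. p (s j))"
    proof (intro prod.cong refl)
      fix j
      have "\<iota> j -` {s j} \<inter> space M = {\<omega> \<in> space M. \<iota> j \<omega> = s j}" by auto
      thus "prob (\<iota> j -` {s j} \<inter> space M) = p (s j)" by (simp only: dist)
    qed
    finally show ?thesis .
  qed
  have "V (X \<omega>) = (\<Sum>s\<in>?P. V (trajectory step x0 s k) * indicator (A s) \<omega>)"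
    if \<omega>: "\<omega> \<in> space M" for \<omega>
  proof -
    define s0 where "s0 = restrict (\<lambda>j. \<iota> j \<omega>) {..<k}"
    have s0: "s0 \<in> ?P" by (simp add: s0_def)
    have ind: "indicator (A s) \<omega> = (if s = s0 then 1 else 0 :: ennreal)" if "s \<in> ?P" for s
    proof -
      have "\<omega> \<in> A s \<longleftrightarrow> s = s0"
        using \<omega> that by (auto simp: A_def s0_def PiE_def extensional_def fun_eq_iff)
      thus ?thesis by (simp add: indicator_def)
    qed
    have "(\<Sum>s\<in>?P. V (trajectory step x0 s k) * indicator (A s) \<omega>)
        = (\<Sum>s\<in>?P. if s = s0 then V (trajectory step x0 s0 k) else 0)"
      by (intro sum.cong refl) (simp add: ind)
    also have "\<dots> = V (trajectory step x0 s0 k)" using s0 finP by simp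
    also have "trajectory step x0 s0 k = X \<omega>"
      unfolding X[OF \<omega>] by (rule trajectory_cong) (simp add: s0_def)
    finally show ?thesis by simp
  qed
  hence "(\<integral>\<^sup>+\<omega>. V (X \<omega>) \<partial>M)
      = (\<integral>\<^sup>+\<omega>. (\<Sum>s\<in>?P. V (trajectory step x0 s k) * indicator (A s) \<omega>) \<partial>M)"
    by (rule nn_integral_cong)
  also have "\<dots> = (\<Sum>s\<in>?P. \<integral>\<^sup>+\<omega>. V (trajectory step x0 s k) * indicator (A s) \<omega> \<partial>M)"
    using A_sets by (intro nn_integral_sum) auto
  also have "\<dots> = (\<Sum>s\<in>?P. ennreal (\<Prod>j<k. p (s j)) * V (trajectory step x0 s k))"
    using A_sets by (intro sum.cong refl)
      (simp add: nn_integral_cmult_indicator emeasure_eq_measure A_prob mult.commute[of "ennreal _"])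
  finally show ?thesis .
qed

lemma (in prob_space) expected_contraction:
  fixes \<iota> :: "nat \<Rightarrow> 'a \<Rightarrow> 'b::finite" and V :: "'x \<Rightarrow> real"
  assumes indep: "indep_vars (\<lambda>_. count_space UNIV) \<iota> UNIV"
    and dist: "\<And>k i. prob {\<omega> \<in> space M. \<iota> k \<omega> = i} = p i"
    and X: "\<And>\<omega>. \<omega> \<in> space M \<Longrightarrow> X \<omega> = trajectory step x0 (\<lambda>j. \<iota> j \<omega>) k"
    and S: "x0 \<in> S" "\<And>i x. x \<in> S \<Longrightarrow> step i x \<in> S"
    and V: "\<And>x. x \<in> S \<Longrightarrow> 0 \<le> V x"
    and contract: "\<And>x. x \<in> S \<Longrightarrow> (\<Sum>i\<in>UNIV. p i * V (step i x)) \<le> \<rho> * V x"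
    and \<rho>: "0 \<le> \<rho>"
  shows "(\<integral>\<^sup>+\<omega>. ennreal (V (X \<omega>)) \<partial>M) \<le> ennreal (\<rho>^k * V x0)"
proof -
  have p: "0 \<le> p i" for i using dist[of 0 i] measure_nonneg by metis
  note inv = trajectory_invariant[of x0 S step, OF S]
  have w: "0 \<le> (\<Prod>j<k. p (s j))" for s by (simp add: prod_nonneg p)
  have "(\<integral>\<^sup>+\<omega>. ennreal (V (X \<omega>)) \<partial>M)
    = (\<Sum>s\<in>PiE {..<k} (\<lambda>_. UNIV). ennreal (\<Prod>j<k. p (s j)) * ennreal (V (trajectory step x0 s k)))"
    by (rule nn_integral_trajectory[OF indep dist X])
  also have "\<dots> = (\<Sum>s\<in>PiE {..<k} (\<lambda>_. UNIV). ennreal ((\<Prod>j<k. p (s j)) * V (trajectory step x0 s k)))"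
    by (intro sum.cong refl ennreal_mult[symmetric] w V inv)
  also have "\<dots> = ennreal (\<Sum>s\<in>PiE {..<k} (\<lambda>_. UNIV). (\<Prod>j<k. p (s j)) * V (trajectory step x0 s k))"
    by (intro sum_ennreal mult_nonneg_nonneg w V inv)
  also have "\<dots> \<le> ennreal (\<rho>^k * V x0)"
    by (intro ennreal_leI weighted_trajectories_contract[where S = S and p = p and V = V]) (use p S contract \<rho> in auto)
  finally show ?thesis .
qed

section \<open>The method on the initial sublevel set\<close>

locale rbpdn = composite blk f g F gi
  for blk :: "'n::finite \<Rightarrow> 'b::finite"
    and f g F :: "real^'n \<Rightarrow> ereal"
    and gi :: "'b \<Rightarrow> real^'n \<Rightarrow> ereal" +
  fixes xstar x0 :: "real^'n" and \<eta> :: real and d :: "real^'n \<Rightarrow> 'b \<Rightarrow> real^'n"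
  assumes hess_cont: "continuous_on (effective_domain F) (hessian f)"
    and optimal: "is_arg_min F (\<lambda>_. True) xstar"
    and x0: "x0 \<in> effective_domain F"
    and eta: "0 \<le> \<eta>" "\<eta> \<le> 1/4"
    and approx: "\<And>x i. x \<in> effective_domain F \<Longrightarrow> approx_block_direction blk f gi \<eta> x i (d x i)"
begin

definition sublevel :: "(real^'n) set" where
  "sublevel = {x. F x \<le> F x0}"

lemma F_xstar_le: "F xstar \<le> F x"
  using optimal by (simp add: is_arg_min_linorder)

lemma sublevel_iff: "x \<in> sublevel \<longleftrightarrow> x \<in> effective_domain F \<and> F_val x \<le> F_val x0"
proof (cases "x \<in> effective_domain F")
  case True
  thus ?thesis by (simp add: sublevel_def F_finite[OF True] F_finite[OF x0])
next
  case False
  thus ?thesis by (simp add: sublevel_def F_infinite[OF False] F_finite[OF x0])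
qed

lemma sublevel_dom: "x \<in> sublevel \<Longrightarrow> x \<in> effective_domain F"
  by (simp add: sublevel_iff)

lemma x0_sublevel: "x0 \<in> sublevel" by (simp add: sublevel_def)

lemma xstar_sublevel: "xstar \<in> sublevel" by (simp add: sublevel_def F_xstar_le)

lemma xstar_dom: "xstar \<in> effective_domain F" by (rule sublevel_dom[OF xstar_sublevel])

lemma F_val_xstar_le: "x \<in> effective_domain F \<Longrightarrow> F_val xstar \<le> F_val x"
  using F_xstar_le[of x] by (simp add: F_finite xstar_dom)

lemma zero_subgradient: "0 \<in> subdifferential_on UNIV F xstar"
  by (simp add: subdifferential_on_def F_xstar_le zero_ereal_def[symmetric])

text \<open>
  As zero is a subgradient at the minimizer, self-concordance makes \<open>F\<close> grow by \<open>r - ln (1 + r)\<close> at local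
  distance \<open>r\<close> from it.
\<close>

lemma bounded_sublevel: "bounded sublevel"
proof -
  define \<delta> where "\<delta> = F_val x0 - F_val xstar"
  have \<delta>: "0 \<le> \<delta>" using F_val_xstar_le[OF x0] by (simp add: \<delta>_def)
  have pd: "pos_def (hessian f xstar)" by (rule hess_pd[OF xstar_dom])
  define m where "m = lambda_min (hessian f xstar)"
  have m: "0 < m" unfolding m_def by (rule lambda_min_pos[OF pd])
  have "norm (y - xstar) \<le> (1 + 4 * \<delta>) / sqrt m" if y: "y \<in> sublevel" for y
  proof -
    define r where "r = energy_norm (hessian f xstar) (y - xstar)"
    have r: "0 \<le> r" unfolding r_def by (rule energy_norm_nonneg[OF pd])
    have "r - ln (1 + r) \<le> \<delta>"
      using growth[OF xstar_dom zero_subgradient sublevel_dom[OF y]] y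
      by (simp add: r_def \<delta>_def sublevel_iff)
    hence "r^2 / (2 * (1 + r)) \<le> \<delta>" using half_square_le_diff_ln[OF r] by linarith
    hence "2 / 2 * r^2 \<le> 2 * \<delta> + (2 * \<delta>) * r" using r by (simp add: field_simps)
    hence "r \<le> 1 + 2 * (\<bar>2 * \<delta>\<bar> + 2 * \<delta>) / 2" using r \<delta> by (intro quadratic_bound) auto
    hence r': "r \<le> 1 + 4 * \<delta>" using \<delta> by simp
    have "m * (norm (y - xstar))^2 \<le> r^2"
      using lambda_min_bound(1)[OF pos_def_sym[OF pd]] energy_norm_sq[OF pd]
      by (simp add: m_def r_def)
    hence "sqrt (m * (norm (y - xstar))^2) \<le> sqrt (r^2)" by (rule real_sqrt_le_mono)
    hence "sqrt m * norm (y - xstar) \<le> r" using r by (simp add: real_sqrt_mult)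
    thus ?thesis using m r' by (simp add: field_simps)
  qed
  hence "sublevel \<subseteq> cball xstar ((1 + 4 * \<delta>) / sqrt m)"
    by (auto simp: dist_norm norm_minus_commute)
  thus ?thesis using bounded_cball bounded_subset by blast
qed

text \<open>
  \<open>F\<close> is the sum of \<open>f\<close> and the \<open>g\<^sub>i\<close>, indexed by an option type. Each summand has a closed epigraph and
  an affine minorant: the tangent of \<open>f\<close> at \<open>x0\<close>, and the subgradients of the \<open>g\<^sub>i\<close> that come with the
  block directions at \<open>x0\<close>.
\<close>

lemma compact_sublevel: "compact sublevel"
proof -
  define h where "h = (\<lambda>j x. case j of None \<Rightarrow> f x | Some i \<Rightarrow> gi i (proj i x))"
  have sum_h: "(\<Sum>j\<in>UNIV. h j x) = F x" for x
    by (simp add: sum_option_UNIV h_def F_def g_def separable_sum_def)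
  have S_eq: "sublevel = {x. (\<Sum>j\<in>UNIV. h j x) \<le> ereal (F_val x0)}"
    by (simp add: sublevel_def sum_h F_finite[OF x0])
  have closed: "closed (ereal_epigraph UNIV (h j))" for j
  proof (cases j)
    case None
    thus ?thesis using f_sc by (simp add: h_def self_concordant_def closed_convex_on_def)
  next
    case (Some i)
    thus ?thesis using closed_epigraph_gi_shift[of i 0] by (simp add: h_def)
  qed
  obtain R where R: "\<And>x. x \<in> sublevel \<Longrightarrow> norm x \<le> R" using bounded_sublevel by (auto simp: bounded_iff)
  have R0: "0 \<le> R" using R[OF x0_sublevel] norm_ge_zero order_trans by blast
  have "\<forall>i. \<exists>s. d x0 i \<in> block_space blk i \<and>
      s \<in> subdifferential_on (block_space blk i) (gi i) (proj i x0 + d x0 i)"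
    using approx_block_direction_obtain[OF x0 approx[OF x0]] by metis
  then obtain s where d: "\<And>i. d x0 i \<in> block_space blk i"
    and s: "\<And>i. s i \<in> subdifferential_on (block_space blk i) (gi i) (proj i x0 + d x0 i)" by metis
  define w where "w = (\<lambda>i. proj i x0 + d x0 i)"
  define a where "a = (\<lambda>i. real_of_ereal (gi i (w i)))"
  have s_w: "s i \<in> subdifferential_on (block_space blk i) (gi i) (w i)" for i
    unfolding w_def by (rule s)
  have w: "w i \<in> block_space blk i" for i
    unfolding w_def using subspace_block_space[of blk i] d block_proj_in by (intro subspace_add)
  have x0d: "x0 \<in> effective_domain f" using x0 by (simp add: dom_iff)
  define b where "b = (\<lambda>i. \<bar>a i\<bar> + norm (s i) * (R + norm (w i)))"
  define e where "e = \<bar>f_val x0\<bar> + norm (gradient f x0) * (R + norm x0)"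
  have nn: "0 \<le> b i" "0 \<le> e" for i
    unfolding b_def e_def
    by (intro add_nonneg_nonneg mult_nonneg_nonneg abs_ge_zero norm_ge_zero R0)+
  define L where "L = e + (\<Sum>i\<in>UNIV. b i)"
  have low: "ereal (- L) \<le> h j x" if x: "x \<in> sublevel" for j x
  proof (cases j)
    case None
    have xd: "x \<in> effective_domain f" using sublevel_dom[OF x] by (simp add: dom_iff)
    define r where "r = energy_norm (hessian f x0) (x - x0)"
    have r: "0 \<le> r" unfolding r_def by (rule energy_norm_nonneg[OF hess_pd[OF x0]])
    have "f_val x0 + gradient f x0 \<bullet> (x - x0) + (r - ln (1 + r)) \<le> f_val x"
      unfolding r_def using x0d xd
      by (intro self_concordant_lower_bound[OF f_sc] hess_pd dom_ray x0 sublevel_dom[OF x])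
    moreover have "ln (1 + r) \<le> r" using r by (rule ln_add_one_self_le_self)
    moreover have "\<bar>gradient f x0 \<bullet> (x - x0)\<bar> \<le> norm (gradient f x0) * norm (x - x0)"
      by (rule Cauchy_Schwarz_ineq2)
    moreover have "norm (gradient f x0) * norm (x - x0) \<le> norm (gradient f x0) * (R + norm x0)"
      using norm_triangle_ineq4[of x x0] R[OF x] by (intro mult_left_mono) auto
    ultimately have "- e \<le> f_val x" unfolding e_def by linarith
    moreover have "0 \<le> (\<Sum>i\<in>UNIV. b i)" using nn by (intro sum_nonneg) auto
    ultimately have "- L \<le> f_val x" by (simp add: L_def)
    moreover obtain v where "f x = ereal v" using f_finite[OF xd] by blast
    ultimately show ?thesis by (simp add: None h_def)
  next
    case (Some i)
    have "norm (proj i x - w i) \<le> R + norm (w i)"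
      using norm_triangle_ineq4[of "proj i x" "w i"] norm_proj_le[of i x] R[OF x] by linarith
    hence "norm (s i) * norm (proj i x - w i) \<le> norm (s i) * (R + norm (w i))"
      by (intro mult_left_mono) auto
    moreover have "\<bar>s i \<bullet> (proj i x - w i)\<bar> \<le> norm (s i) * norm (proj i x - w i)"
      by (rule Cauchy_Schwarz_ineq2)
    ultimately have "- b i \<le> a i + s i \<bullet> (proj i x - w i)" unfolding b_def by linarith
    moreover have "b i \<le> (\<Sum>i\<in>UNIV. b i)" using nn by (intro member_le_sum) auto
    ultimately have "ereal (- L) \<le> ereal (a i + s i \<bullet> (proj i x - w i))"
      using nn by (simp add: L_def)
    also have "\<dots> \<le> gi i (proj i x)"
      unfolding a_def by (rule gi_affine_minorant(2)[OF w s_w])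
    finally show ?thesis by (simp add: Some h_def)
  qed
  show ?thesis unfolding S_eq
    by (rule compact_sublevel_sum[OF closed, where L = L]) (use low bounded_sublevel in \<open>auto simp: S_eq\<close>)
qed

text \<open>
  The quadratic form of the Hessian is continuous and positive on the compact product of the
  sublevel set with the unit sphere.
\<close>

lemma hessian_bounds:
  obtains m K where "0 < m" "\<And>x v. x \<in> sublevel \<Longrightarrow> m * (norm v)^2 \<le> v \<bullet> (hessian f x *v v)"
    "\<And>x v. x \<in> sublevel \<Longrightarrow> v \<bullet> (hessian f x *v v) \<le> K * (norm v)^2"
proof -
  define T where "T = sublevel \<times> (sphere 0 1 :: (real^'n) set)"
  define q where "q = (\<lambda>z. snd z \<bullet> (hessian f (fst z) *v snd z))"
  have "compact T" unfolding T_def by (intro compact_Times compact_sublevel compact_sphere)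
  moreover have "T \<noteq> {}"
  proof -
    have "axis undefined 1 \<in> (sphere 0 1 :: (real^'n) set)" by simp
    thus ?thesis using x0_sublevel by (auto simp: T_def)
  qed
  moreover have "continuous_on T q"
  proof -
    have "continuous_on T (\<lambda>z. hessian f (fst z))"
      by (rule continuous_on_compose2[OF hess_cont])
        (auto simp: T_def sublevel_dom intro!: continuous_intros)
    thus ?thesis
      unfolding q_def inner_vec_def matrix_vector_mult_def
      by (auto intro!: continuous_intros)
  qed
  ultimately obtain z1 z2 where z: "z1 \<in> T" "\<And>z. z \<in> T \<Longrightarrow> q z1 \<le> q z"
      "z2 \<in> T" "\<And>z. z \<in> T \<Longrightarrow> q z \<le> q z2"
    using continuous_attains_inf[of T q] continuous_attains_sup[of T q] by metis
  have pos: "0 < q z1"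
  proof -
    have "snd z1 \<noteq> 0" using z(1) by (auto simp: T_def)
    moreover have "fst z1 \<in> sublevel" using z(1) by (auto simp: T_def)
    hence "pos_def (hessian f (fst z1))" by (intro hess_pd sublevel_dom)
    ultimately show ?thesis unfolding q_def by (intro pos_def_pos)
  qed
  have scale: "q z1 * (norm v)^2 \<le> v \<bullet> (hessian f x *v v) \<and> v \<bullet> (hessian f x *v v) \<le> q z2 * (norm v)^2"
    if x: "x \<in> sublevel" for x v
  proof (cases "v = 0")
    case False
    define u where "u = (1 / norm v) *\<^sub>R v"
    have "(x, u) \<in> T" using x False by (simp add: T_def u_def)
    moreover have "q (x, u) = (v \<bullet> (hessian f x *v v)) / (norm v)^2"
      by (simp add: q_def u_def matrix_vector_mult_scaleR power2_eq_square)
    ultimately have "q z1 \<le> (v \<bullet> (hessian f x *v v)) / (norm v)^2"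
      "(v \<bullet> (hessian f x *v v)) / (norm v)^2 \<le> q z2" using z(2,4) by metis+
    thus ?thesis using False by (simp add: field_simps)
  qed simp
  show thesis using that[OF pos] scale by blast
qed

text \<open>
  The expression maximized in \<open>c\<^sub>1\<close>; it bounds the local length of the exact Newton direction in terms of
  the block directions.
\<close>

definition norm_ratio :: "real^'n \<Rightarrow> real" where
  "norm_ratio x = (1 + \<eta>) * spectral_norm (sqrt_matrix (block_diag blk (hessian f x))
                                   ** sqrt_matrix (matrix_inv (hessian f x)))
         + spectral_norm (sqrt_matrix (matrix_inv (block_diag blk (hessian f x)))
                          ** sqrt_matrix (hessian f x))"

lemma norm_ratio_nonneg: "0 \<le> norm_ratio x"
  unfolding norm_ratio_def using eta by (simp add: spectral_norm_nonneg)

text \<open>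
  The supremum in \<open>c\<^sub>1\<close> dominates the single values because the spectra of
  the Hessians, and with them those of their block diagonal parts, lie in a common compact
  interval of positive numbers.
\<close>

lemma bdd_above_norm_ratio: "bdd_above (norm_ratio ` sublevel)"
proof -
  obtain m K where m: "0 < m" and low: "\<And>x v. x \<in> sublevel \<Longrightarrow> m * (norm v)^2 \<le> v \<bullet> (hessian f x *v v)"
    and upp: "\<And>x v. x \<in> sublevel \<Longrightarrow> v \<bullet> (hessian f x *v v) \<le> K * (norm v)^2"
    using hessian_bounds by metis
  have "norm_ratio x \<le> (1 + \<eta>) * sqrt (K / m) + sqrt (K / m)" if x: "x \<in> sublevel" for x
  proof -
    let ?B = "hessian f x" and ?H = "block_diag blk (hessian f x)"
    have B: "pos_def ?B" by (rule hess_pd[OF sublevel_dom[OF x]])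
    have H: "pos_def ?H" by (rule pos_def_block_diag[OF B])
    have Hlow: "m * (norm v)^2 \<le> v \<bullet> (?H *v v)" for v
      unfolding block_diag_inner norm_block_proj_sum[of v blk] sum_distrib_left
      by (intro sum_mono low x)
    have Hupp: "v \<bullet> (?H *v v) \<le> K * (norm v)^2" for v
      unfolding block_diag_inner norm_block_proj_sum[of v blk] sum_distrib_left
      by (intro sum_mono upp x)
    show ?thesis unfolding norm_ratio_def
      using spectral_norm_sqrt_le(1)[OF H B m Hupp low[OF x]]
        spectral_norm_sqrt_le(2)[OF B H m upp[OF x] Hlow] eta
      by (intro add_mono mult_left_mono) auto
  qed
  thus ?thesis by (auto simp: bdd_above_def)
qed

lemma sigma_f_le: "x \<in> sublevel \<Longrightarrow> sigma_f f sublevel \<le> lambda_min (hessian f x)"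
  unfolding sigma_f_def
  by (intro cINF_lower bdd_belowI[of _ 0])
    (auto intro: less_imp_le lambda_min_pos hess_pd sublevel_dom)

lemma sigma_f_nonneg: "0 \<le> sigma_f f sublevel"
  unfolding sigma_f_def using x0_sublevel
  by (intro cINF_greatest) (auto intro: less_imp_le lambda_min_pos hess_pd sublevel_dom)

lemma step_in_sublevel:
  assumes x: "x \<in> sublevel"
  shows "rbpdn_step blk f d i x \<in> sublevel"
    "F_val (rbpdn_step blk f d i x)
      \<le> F_val x - 1/2 * ((energy_norm (hessian f x) (d x i))^2 / (2 * (1 + energy_norm (hessian f x) (d x i))))"
proof -
  have xd: "x \<in> effective_domain F" by (rule sublevel_dom[OF x])
  have din: "d x i \<in> block_space blk i"
    using approx[OF xd, of i] by (simp add: approx_block_direction_def)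
  note desc = block_step_descent[OF xd approx[OF xd, of i] eta(2), folded rbpdn_step_eq[where d = d and x = x and i = i, OF din]]
  show le: "F_val (rbpdn_step blk f d i x)
      \<le> F_val x - 1/2 * ((energy_norm (hessian f x) (d x i))^2 / (2 * (1 + energy_norm (hessian f x) (d x i))))"
    by (rule desc(2))
  have "0 \<le> 1/2 * ((energy_norm (hessian f x) (d x i))^2 / (2 * (1 + energy_norm (hessian f x) (d x i))))"
    using energy_norm_nonneg[OF hess_pd[OF xd], of "d x i"] by simp
  thus "rbpdn_step blk f d i x \<in> sublevel"
    using le desc(1) x unfolding sublevel_iff by linarith
qed

text \<open>
  After the cancellation of \<open>\<surd>n\<close> and \<open>1 - \<eta>\<close> the constant is \<open>c\<^sub>4 = c\<^sub>3 \<surd>\<sigma>\<^sub>f / N\<close> with \<open>N\<close> the supremum in \<open>c\<^sub>1\<close>. So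
  \<open>c\<^sub>4 t\<close> is at most \<open>\<surd>\<sigma>\<^sub>f / N\<close> times the Euclidean length of the Newton direction, hence at most \<open>1 / N\<close> times
  its local length, which is bounded by the block directions.
\<close>

lemma block_lengths_ge_gap:
  assumes x: "x \<in> sublevel" and c3: "0 < c3"
    and c3_bound: "ereal c3 * lambda_bar f F x \<le> ereal (norm (newton_direction f g x))"
  defines "c4 \<equiv> rbpdn_c1 blk f \<eta> sublevel * c3 * sqrt (real CARD('b) * sigma_f f sublevel) / (1 - \<eta>)"
  shows "0 \<le> c4"
    and "c4 * omega_star_inv (F_val x - F_val xstar)
      \<le> (\<Sum>i\<in>UNIV. energy_norm (hessian f x) (d x i))"
proof -
  let ?B = "hessian f x"
  have xd: "x \<in> effective_domain F" by (rule sublevel_dom[OF x])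
  have B: "pos_def ?B" by (rule hess_pd[OF xd])
  define N where "N = (SUP x\<in>sublevel. norm_ratio x)"
  have Nx: "norm_ratio x \<le> N" unfolding N_def by (rule cSUP_upper[OF x bdd_above_norm_ratio])
  hence N0: "0 \<le> N" using norm_ratio_nonneg[of x] by linarith
  have n: "0 < sqrt (real CARD('b))" by simp
  have c4: "c4 = c3 * sqrt (sigma_f f sublevel) / N"
  proof -
    have "rbpdn_c1 blk f \<eta> sublevel = (1 - \<eta>) / (sqrt (real CARD('b)) * N)"
      by (simp add: rbpdn_c1_def N_def norm_ratio_def)
    thus ?thesis unfolding c4_def using eta n by (simp add: real_sqrt_mult)
  qed
  show "0 \<le> c4" unfolding c4 using c3 sigma_f_nonneg N0 by simp
  define t where "t = omega_star_inv (F_val x - F_val xstar)"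
  define \<Lambda> where "\<Lambda> = sqrt (\<Sum>i\<in>UNIV. (energy_norm ?B (d x i))^2)"
  have \<Lambda>0: "0 \<le> \<Lambda>" unfolding \<Lambda>_def by (intro real_sqrt_ge_zero sum_nonneg) auto
  have t: "c3 * t \<le> norm (newton_direction f g x)"
  proof -
    have "ereal t \<le> lambda_bar f F x"
      unfolding t_def by (rule omega_star_inv_gap_le_lambda_bar[OF xd xstar_dom F_val_xstar_le[OF xd]])
    hence "ereal c3 * ereal t \<le> ereal c3 * lambda_bar f F x"
      using c3 by (intro ereal_mult_left_mono) auto
    also note c3_bound
    finally show ?thesis by simp
  qed
  have "sqrt (sigma_f f sublevel) * norm (newton_direction f g x) \<le> energy_norm ?B (newton_direction f g x)"
  proof -
    let ?v = "newton_direction f g x"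
    have "sigma_f f sublevel * (norm ?v)^2 \<le> lambda_min ?B * (norm ?v)^2"
      by (rule mult_right_mono[OF sigma_f_le[OF x]]) simp
    also have "\<dots> \<le> ?v \<bullet> (?B *v ?v)" by (rule lambda_min_bound(1)[OF pos_def_sym[OF B]])
    finally have "sqrt (sigma_f f sublevel * (norm ?v)^2) \<le> energy_norm ?B ?v"
      unfolding energy_norm_def by (rule real_sqrt_le_mono)
    thus ?thesis by (simp add: real_sqrt_mult)
  qed
  also have "\<dots> \<le> norm_ratio x * \<Lambda>"
    unfolding norm_ratio_def \<Lambda>_def by (rule newton_direction_le_block_directions[OF xd approx[OF xd] eta])
  also have "\<dots> \<le> N * \<Lambda>" by (rule mult_right_mono[OF Nx \<Lambda>0])
  finally have *: "sqrt (sigma_f f sublevel) * norm (newton_direction f g x) \<le> N * \<Lambda>" .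
  have "sqrt (sigma_f f sublevel) * (c3 * t) \<le> sqrt (sigma_f f sublevel) * norm (newton_direction f g x)"
    using t sigma_f_nonneg by (intro mult_left_mono) auto
  with * have **: "c3 * sqrt (sigma_f f sublevel) * t \<le> N * \<Lambda>" by (simp add: mult_ac)
  have "c4 * t \<le> \<Lambda>"
  \<comment> \<open>For \<open>N = 0\<close> the division by zero in \<open>c\<^sub>1\<close> makes \<open>c\<^sub>4\<close> vanish.\<close>
  proof (cases "N = 0")
    case True thus ?thesis using \<Lambda>0 by (simp add: c4)
  next
    case False thus ?thesis using ** N0 by (simp add: c4 field_simps)
  qed
  also have "\<Lambda> \<le> (\<Sum>i\<in>UNIV. energy_norm ?B (d x i))"
    using L2_set_le_sum[of UNIV "\<lambda>i. energy_norm ?B (d x i)"] energy_norm_nonneg[OF B]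
    by (simp add: \<Lambda>_def L2_set_def)
  finally show "c4 * omega_star_inv (F_val x - F_val xstar)
      \<le> (\<Sum>i\<in>UNIV. energy_norm ?B (d x i))" by (simp add: t_def)
qed

text \<open>
  Average the decrease over the blocks by Jensen's inequality and insert \<open>\<Sum>\<^sub>i p\<^sub>i \<lambda>\<^sub>i \<ge> p\<^sub>m\<^sub>i\<^sub>n \<Sum>\<^sub>i \<lambda>\<^sub>i \<ge> c\<^sub>4 p\<^sub>m\<^sub>i\<^sub>n t\<close>.
\<close>

lemma expected_step_contraction:
  fixes p :: "'b \<Rightarrow> real"
  assumes x: "x \<in> sublevel" and p: "\<And>i. 0 < p i" "(\<Sum>i\<in>UNIV. p i) = 1"
    and c4: "0 \<le> c4" "c4 * omega_star_inv (F_val x - F_val xstar)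
      \<le> (\<Sum>i\<in>UNIV. energy_norm (hessian f x) (d x i))"
  defines "pmin \<equiv> Min (range p)"
  defines "t0 \<equiv> omega_star_inv (F_val x0 - F_val xstar)"
  shows "(\<Sum>i\<in>UNIV. p i * (F_val (rbpdn_step blk f d i x) - F_val xstar))
    \<le> (1 - c4^2 * pmin^2 * (1 - t0) / (2 * (1 + c4 * pmin * t0))) * (F_val x - F_val xstar)"
proof -
  have xd: "x \<in> effective_domain F" by (rule sublevel_dom[OF x])
  have B: "pos_def (hessian f x)" by (rule hess_pd[OF xd])
  define \<delta> where "\<delta> = F_val x - F_val xstar"
  define t where "t = omega_star_inv \<delta>"
  define l where "l = (\<lambda>i. energy_norm (hessian f x) (d x i))"
  define u where "u = (\<Sum>i\<in>UNIV. p i * l i)"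
  define c where "c = c4 * pmin"
  have \<delta>: "0 \<le> \<delta>" "\<delta> \<le> F_val x0 - F_val xstar"
    using F_val_xstar_le[OF xd] x by (auto simp: \<delta>_def sublevel_iff)
  have t: "0 \<le> t" "t \<le> t0" "t0 < 1" "omega_star t = \<delta>"
    using omega_star_inv[OF \<delta>(1)] omega_star_inv(1)[of "F_val x0 - F_val xstar"]
      omega_star_inv_mono[OF \<delta>] \<delta> by (auto simp: t_def t0_def)
  have l: "0 \<le> l i" for i unfolding l_def by (rule energy_norm_nonneg[OF B])
  have pmin: "pmin \<le> p i" for i unfolding pmin_def by (intro Min_le) auto
  have pmin0: "0 \<le> pmin" unfolding pmin_def using p(1) by (intro less_imp_le) simp
  have c: "0 \<le> c" using c4 pmin0 by (simp add: c_def)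
  have "c * t \<le> pmin * (\<Sum>i\<in>UNIV. l i)"
    using mult_left_mono[OF c4(2) pmin0] by (simp add: c_def l_def t_def \<delta>_def mult_ac)
  also have "\<dots> \<le> u"
    unfolding u_def sum_distrib_left by (intro sum_mono mult_right_mono pmin l)
  finally have ctu: "c * t \<le> u" .
  have "(\<Sum>i\<in>UNIV. p i * (F_val (rbpdn_step blk f d i x) - F_val xstar))
      \<le> (\<Sum>i\<in>UNIV. p i * (\<delta> - 1/2 * ((l i)^2 / (2 * (1 + l i)))))"
  proof (intro sum_mono mult_left_mono)
    fix i show "F_val (rbpdn_step blk f d i x) - F_val xstar \<le> \<delta> - 1/2 * ((l i)^2 / (2 * (1 + l i)))"
      using step_in_sublevel(2)[OF x, of i] unfolding l_def \<delta>_def by linarith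
  qed (use p in \<open>auto intro: less_imp_le\<close>)
  also have "\<dots> = (\<Sum>i\<in>UNIV. p i * \<delta> - 1/2 * (p i * ((l i)^2 / (2 * (1 + l i)))))"
    by (intro sum.cong refl) (simp add: right_diff_distrib)
  also have "\<dots> = (\<Sum>i\<in>UNIV. p i) * \<delta> - 1/2 * (\<Sum>i\<in>UNIV. p i * ((l i)^2 / (2 * (1 + l i))))"
    by (simp only: sum_subtractf sum_distrib_left sum_distrib_right)
  also have "\<dots> \<le> \<delta> - 1/2 * (u^2 / (2 * (1 + u)))"
  proof -
    have "u^2 / (2 * (1 + u)) \<le> (\<Sum>i\<in>UNIV. p i * ((l i)^2 / (2 * (1 + l i))))"
      unfolding u_def using p l by (intro half_square_jensen) (auto intro: less_imp_le)
    thus ?thesis unfolding p(2) by linarith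
  qed
  also have "\<dots> \<le> \<delta> - 1/2 * ((c * t)^2 / (2 * (1 + c * t)))"
  proof -
    have "(c * t)^2 / (2 * (1 + c * t)) \<le> u^2 / (2 * (1 + u))"
      by (rule half_square_mono[OF _ ctu]) (use c t in simp)
    thus ?thesis by linarith
  qed
  also have "\<dots> \<le> \<delta> - c^2 * (1 - t0) / (2 * (1 + c * t0)) * \<delta>"
    using rate_bound[OF c t(1-3)] t(4) by simp
  also have "\<dots> = (1 - c4^2 * pmin^2 * (1 - t0) / (2 * (1 + c4 * pmin * t0))) * \<delta>"
    by (simp add: c_def power_mult_distrib left_diff_distrib)
  finally show ?thesis by (simp add: \<delta>_def)
qed

end

theorem theorem4p3:
  fixes blk :: "'n::finite \<Rightarrow> 'b::finite"
    and f g F :: "real^'n \<Rightarrow> ereal"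
    and gi :: "'b \<Rightarrow> real^'n \<Rightarrow> ereal"
    and xstar x0 :: "real^'n"
    and \<eta> c1 c3 c4 \<delta>0 pmin :: real
    and p :: "'b \<Rightarrow> real"
    and S :: "(real^'n) set"
    and d :: "real^'n \<Rightarrow> 'b \<Rightarrow> real^'n"
    and M :: "'w measure"
    and \<iota> :: "nat \<Rightarrow> 'w \<Rightarrow> 'b"
    and X :: "nat \<Rightarrow> 'w \<Rightarrow> real^'n"
  assumes blocks: "surj blk"
    and gi: "\<And>i. proper_on (block_space blk i) (gi i)"
            "\<And>i. closed_convex_on (block_space blk i) (gi i)"
    and g_def: "g = separable_sum blk gi"
    and F_def: "F = (\<lambda>x. f x + g x)"
    and f_sc: "self_concordant f"
    and hess_cont: "continuous_on (effective_domain F) (hessian f)"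
    and hess_pd: "\<And>x. x \<in> effective_domain F \<Longrightarrow> pos_def (hessian f x)"
    and optimal: "\<And>x. is_arg_min F (\<lambda>_. True) x \<longleftrightarrow> x = xstar"
    and x0: "x0 \<in> effective_domain F"
    and eta: "0 \<le> \<eta>" "\<eta> \<le> 1/4"
    and p: "\<And>i. p i > 0" "(\<Sum>i\<in>UNIV. p i) = 1"
    and approx: "\<And>x i. x \<in> effective_domain F \<Longrightarrow> approx_block_direction blk f gi \<eta> x i (d x i)"
    and M: "prob_space M"
    and iota_indep: "prob_space.indep_vars M (\<lambda>_. count_space UNIV) \<iota> UNIV"
    and iota_prob: "\<And>k i. measure M {\<omega> \<in> space M. \<iota> k \<omega> = i} = p i"
    and X_0: "\<And>\<omega>. \<omega> \<in> space M \<Longrightarrow> X 0 \<omega> = x0"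
    and X_Suc: "\<And>k \<omega>. \<omega> \<in> space M \<Longrightarrow> X (Suc k) \<omega> = rbpdn_step blk f d (\<iota> k \<omega>) (X k \<omega>)"
    and S_def: "S = {x. F x \<le> F x0}"
    and pmin_def: "pmin = Min (range p)"
    and delta0_def: "\<delta>0 = real_of_ereal (F x0 - F xstar)"
    and c3: "c3 > 0"
            "\<And>x. x \<in> S \<Longrightarrow> ereal (norm (newton_direction f g x)) \<ge> ereal c3 * lambda_bar f F x"
    and c1_def: "c1 = rbpdn_c1 blk f \<eta> S"
    and c4_def: "c4 = c1 * c3 * sqrt (real CARD('b) * sigma_f f S) / (1 - \<eta>)"
  shows "\<forall>k. enn2ereal (\<integral>\<^sup>+\<omega>. e2ennreal (F (X k \<omega>) - F xstar) \<partial>M)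
           \<le> ereal ((1 - c4^2 * pmin^2 * (1 - omega_star_inv \<delta>0)
                         / (2 * (1 + c4 * pmin * omega_star_inv \<delta>0))) ^ k * \<delta>0)"
proof
  fix k
  interpret rbpdn blk f g F gi xstar x0 \<eta> d
    using gi g_def F_def f_sc hess_pd hess_cont optimal x0 eta approx by unfold_locales auto
  interpret prob_space M by (rule M)
  have S_eq: "sublevel = S" by (simp add: sublevel_def S_def)
  note S_iff' = sublevel_iff[unfolded S_eq]
  let ?step = "rbpdn_step blk f d"
  define V where "V = (\<lambda>x. F_val x - F_val xstar)"
  define \<rho> where "\<rho> = 1 - c4^2 * pmin^2 * (1 - omega_star_inv \<delta>0)
                         / (2 * (1 + c4 * pmin * omega_star_inv \<delta>0))"
  have \<delta>0: "\<delta>0 = V x0"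
    unfolding delta0_def V_def F_finite[OF x0] F_finite[OF xstar_dom] by simp
  have V: "0 \<le> V x" "e2ennreal (F x - F xstar) = ennreal (V x)" if "x \<in> S" for x
  proof -
    have xd: "x \<in> effective_domain F" using that by (simp add: S_iff')
    show "0 \<le> V x" using F_val_xstar_le[OF xd] by (simp add: V_def)
    show "e2ennreal (F x - F xstar) = ennreal (V x)"
      unfolding V_def F_finite[OF xd] F_finite[OF xstar_dom] by (simp add: e2ennreal_ereal)
  qed
  have inv: "?step i x \<in> S" if "x \<in> S" for i x
    using step_in_sublevel(1)[unfolded S_eq, OF that] .
  have x0S: "x0 \<in> S" by (simp add: S_def)
  have contract: "(\<Sum>i\<in>UNIV. p i * V (?step i x)) \<le> \<rho> * V x" if x: "x \<in> S" for x
  proof -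
    have x': "x \<in> sublevel" using x by (simp add: S_eq)
    note c4 = block_lengths_ge_gap[OF x' c3(1) c3(2)[OF x], unfolded S_eq, folded c1_def, folded c4_def]
    show ?thesis
      unfolding \<rho>_def \<delta>0 pmin_def V_def by (rule expected_step_contraction[OF x' p c4])
  qed
  have X: "X k \<omega> = trajectory ?step x0 (\<lambda>j. \<iota> j \<omega>) k" if "\<omega> \<in> space M" for k \<omega>
    by (induction k) (simp_all add: X_0 X_Suc that)
  have XS: "X k \<omega> \<in> S" if "\<omega> \<in> space M" for \<omega>
    unfolding X[OF that] by (intro trajectory_invariant x0S inv)
  \<comment> \<open>Nonnegativity of \<open>\<rho>\<close> follows from the contraction itself, unless the initial gap is zero; then
    the sublevel set contains minimizers only.\<close>
  have bound: "(\<integral>\<^sup>+\<omega>. ennreal (V (X k \<omega>)) \<partial>M) \<le> ennreal (\<rho>^k * V x0) \<and> 0 \<le> \<rho>^k * V x0"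
  proof (cases "V x0 = 0")
    case True
    have "V (X k \<omega>) = 0" if "\<omega> \<in> space M" for \<omega>
      using XS[OF that] V(1)[OF XS[OF that]] True by (auto simp: V_def S_iff')
    hence "(\<integral>\<^sup>+\<omega>. ennreal (V (X k \<omega>)) \<partial>M) = (\<integral>\<^sup>+\<omega>. 0 \<partial>M)"
      by (intro nn_integral_cong) simp
    thus ?thesis using True by simp
  next
    case False
    have "0 \<le> (\<Sum>i\<in>UNIV. p i * V (?step i x0))"
      by (intro sum_nonneg mult_nonneg_nonneg V(1) inv x0S) (simp add: p(1) less_imp_le)
    also have "\<dots> \<le> \<rho> * V x0" by (rule contract[OF x0S])
    finally have "0 \<le> \<rho>" using False V(1)[OF x0S] by (simp add: zero_le_mult_iff)
    thus ?thesis
      using expected_contraction[OF iota_indep iota_prob X x0S inv V(1) contract] V(1)[OF x0S] by simp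
  qed
  have "(\<integral>\<^sup>+\<omega>. e2ennreal (F (X k \<omega>) - F xstar) \<partial>M) = (\<integral>\<^sup>+\<omega>. ennreal (V (X k \<omega>)) \<partial>M)"
    by (intro nn_integral_cong V(2) XS)
  also have "\<dots> \<le> ennreal (\<rho>^k * V x0)" using bound by blast
  finally have "enn2ereal (\<integral>\<^sup>+\<omega>. e2ennreal (F (X k \<omega>) - F xstar) \<partial>M) \<le> enn2ereal (ennreal (\<rho>^k * V x0))"
    by (simp add: less_eq_ennreal.rep_eq)
  also have "\<dots> = ereal (\<rho>^k * \<delta>0)"
    using bound by (simp add: \<delta>0)
  finally show "enn2ereal (\<integral>\<^sup>+\<omega>. e2ennreal (F (X k \<omega>) - F xstar) \<partial>M)
           \<le> ereal ((1 - c4^2 * pmin^2 * (1 - omega_star_inv \<delta>0)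
                         / (2 * (1 + c4 * pmin * omega_star_inv \<delta>0))) ^ k * \<delta>0)"
    by (simp add: \<rho>_def)
qed

end
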